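(* Let $\alpha>0$. For $n_1$ even let $n_2=\lfloor\alpha n_1/2\rfloor$. For $j\ge1$ let $U_j$ denote the number of connected components with exactly $j$ vertices in a random multigraph drawn from $\mathcal{MG}_{n_1,n_2}$ according to the configuration model. Then, as $n_1\to\infty$ along the even integers, for every $j\ge2$, \[ \mathbb{E}[U_j]\sim\frac{\alpha^{j-2}}{(1+\alpha)^{j-1}}\frac{n_1}{2}\qquad\text{and}\qquad\operatorname{Var}(U_j)=O\!\left(\frac{n_1}{2}\right), \] and \[ \mathbb{E}[U_1]\sim\frac12\,\frac{\alpha}{1+\alpha}\qquad\text{and}\qquad\operatorname{Var}(U_1)\sim\frac12\,\frac{\alpha}{1+\alpha}. \] Furthermore, for any integer $q\ge2$, as $n_1\to\infty$ along the even integers, the vector \[ \frac{1}{\sqrt{n_1/2}}\left(U_j-\frac{\alpha^{j-2}}{(1+\alpha)^{j-1}}\frac{n_1}{2}\right)_{2\le j\le q} \] converges in distribution to a multivariate Gaussian $\mathcal{N}(\mathbf{0},\mathcal{H}(\alpha))$, where \[ \mathcal{H}_{i,j}(\alpha)=-\frac{\alpha^{i+j-4}}{(1+\alpha)^{i+j-2}}\left(1+\frac{(i-2-\alpha)(j-2-\alpha)}{\alpha(1+\alpha)}\right)+\frac{\mathbb{1}_{i=j}}{1+\alpha}\left(\frac{\alpha}{1+\alpha}\right)^{i-2}\quad(2\le i,j\le q) \] is positive semi-definite, and $U_1$ converges in distribution to a Poisson random variable with parameter $\frac12\frac{\alpha}{1+\alpha}$.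
   Context: $\mathcal{MG}_{n_1,n_2}$ is the set of vertex-labelled multigraphs (loops and multiple edges allowed; a loop contributes $2$ to the degree) on vertex set $\{1,\dots,n_1+n_2\}$ with exactly $n_1$ vertices of degree $1$ and $n_2$ vertices of degree $2$. For a multigraph $G$ on $[n]$ with $m$ edges, $\operatorname{seqv}(G)$ is the number of sequences $(v_1,w_1,\dots,v_m,w_m)\in[n]^{2m}$ such that the multiset of edges $\{\{v_i,w_i\}:1\le i\le m\}$ equals the edge multiset of $G$, and the compensation factor is $\kappa(G)=\operatorname{seqv}(G)/(2^m m!)$. The configuration model distribution on $\mathcal{MG}_{n_1,n_2}$ assigns to each $G$ probability proportional to $\kappa(G)$ (equivalently, the law induced by a uniform random perfect matching of half-edges with the prescribed degrees). The size of a component is its number of vertices. $\mathbb{1}_{i=j}$ is $1$ if $i=j$ and $0$ otherwise. *)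

theory Defs
  imports "HOL-Probability.Probability"
begin

text \<open>Multigraphs on vertex set {1..n}: an edge is a 2-element multiset of vertices
  (a loop v is the multiset with v twice), a multigraph is a multiset of edges.\<close>

definition deg :: "nat multiset multiset \<Rightarrow> nat \<Rightarrow> nat" where
  "deg G v = sum_mset (image_mset (\<lambda>e. count e v) G)"

definition MG :: "nat \<Rightarrow> nat \<Rightarrow> nat multiset multiset set" where
  "MG n1 n2 = {G. (\<forall>e\<in>#G. size e = 2 \<and> set_mset e \<subseteq> {1..n1+n2})
      \<and> card {v\<in>{1..n1+n2}. deg G v = 1} = n1
      \<and> card {v\<in>{1..n1+n2}. deg G v = 2} = n2}"

definition seqv :: "nat \<Rightarrow> nat multiset multiset \<Rightarrow> nat" where
  "seqv n G = card {xs. length xs = 2 * size G \<and> set xs \<subseteq> {1..n} \<and>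
      mset (map (\<lambda>i. {#xs ! (2*i), xs ! (2*i+1)#}) [0..<size G]) = G}"

definition kappa :: "nat \<Rightarrow> nat multiset multiset \<Rightarrow> real" where
  "kappa n G = real (seqv n G) / (2 ^ size G * fact (size G))"

definition CM :: "nat \<Rightarrow> nat \<Rightarrow> nat multiset multiset pmf" where
  "CM n1 n2 = embed_pmf (\<lambda>G. if G \<in> MG n1 n2
      then kappa (n1+n2) G / (\<Sum>H\<in>MG n1 n2. kappa (n1+n2) H) else 0)"

definition adj :: "nat multiset multiset \<Rightarrow> nat \<Rightarrow> nat \<Rightarrow> bool" where
  "adj G u v \<longleftrightarrow> {#u, v#} \<in># G"

definition comp :: "nat multiset multiset \<Rightarrow> nat \<Rightarrow> nat set" where
  "comp G v = {w. (adj G)\<^sup>*\<^sup>* v w}"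

definition components :: "nat \<Rightarrow> nat multiset multiset \<Rightarrow> nat set set" where
  "components n G = comp G ` {1..n}"

definition U :: "nat \<Rightarrow> nat \<Rightarrow> nat multiset multiset \<Rightarrow> nat" where
  "U n j G = card {C \<in> components n G. card C = j}"

definition Hmat :: "real \<Rightarrow> nat \<Rightarrow> nat \<Rightarrow> real" where
  "Hmat \<alpha> i j = - (\<alpha> ^ (i + j - 4) / (1 + \<alpha>) ^ (i + j - 2)) *
        (1 + (real i - 2 - \<alpha>) * (real j - 2 - \<alpha>) / (\<alpha> * (1 + \<alpha>)))
      + (if i = j then 1 / (1 + \<alpha>) * (\<alpha> / (1 + \<alpha>)) ^ (i - 2) else 0)"

definition psd_on :: "nat set \<Rightarrow> (nat \<Rightarrow> nat \<Rightarrow> real) \<Rightarrow> bool" where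
  "psd_on I A \<longleftrightarrow> (\<forall>t::nat \<Rightarrow> real. 0 \<le> (\<Sum>i\<in>I. \<Sum>j\<in>I. t i * A i j * t j))"

text \<open>Centered multivariate Gaussian N(0,A) on R^I (I finite), vectors being
  extensional functions on I, characterised by its characteristic function
  (this allows singular A).\<close>
definition gaussian_vec :: "nat set \<Rightarrow> (nat \<Rightarrow> nat \<Rightarrow> real) \<Rightarrow> (nat \<Rightarrow> real) measure \<Rightarrow> bool" where
  "gaussian_vec I A \<mu> \<longleftrightarrow> prob_space \<mu> \<and> sets \<mu> = sets (PiM I (\<lambda>_. borel)) \<and>
     (\<forall>t::nat \<Rightarrow> real. (\<integral>x. cis (\<Sum>i\<in>I. t i * x i) \<partial>\<mu>) =
        complex_of_real (exp (- (\<Sum>i\<in>I. \<Sum>j\<in>I. t i * A i j * t j) / 2)))"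

definition weak_conv_vec :: "nat set \<Rightarrow> (nat \<Rightarrow> (nat \<Rightarrow> real) measure) \<Rightarrow> (nat \<Rightarrow> real) measure \<Rightarrow> bool" where
  "weak_conv_vec I M \<mu> \<longleftrightarrow>
     (\<forall>f :: (nat \<Rightarrow> real) \<Rightarrow> real.
        continuous_on (PiE I (\<lambda>_. UNIV)) f \<and> bounded (f ` PiE I (\<lambda>_. UNIV)) \<longrightarrow>
        (\<lambda>k. \<integral>x. f x \<partial>M k) \<longlonglongrightarrow> (\<integral>x. f x \<partial>\<mu>))"

end

theory Submission
  imports Defs "HOL-Combinatorics.Multiset_Permutations" "HOL-Real_Asymp.Real_Asymp"
begin

text \<open>
  All degrees are at most 2, so every component is a path or a cycle. Peeling off leaves one at a
  time, and cutting a leafless graph open at a vertex, gives for \<open>2k\<close> vertices of degree 1 and \<open>n\<close>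
  vertices of degree 2
  \[ E \prod_C u_{|C|} = \frac{[x^n]\, P_u(x)^k Q_u(x)}{[x^n]\, P_1(x)^k Q_1(x)}, \qquad
     P_u(x) = \sum_{i \ge 0} u_{i+2} x^i, \quad Q_u(x) = \exp\Bigl(\frac12 \sum_{j \ge 1} u_j \frac{x^j}{j}\Bigr). \]
  Differentiating in a single \<open>u\<^sub>j\<close> at 1 gives exact factorial moments, since
  \<open>P\<^sub>1(x)\<^sup>k Q\<^sub>1(x) = (1 - x) powr (- k - 1/2)\<close>. For unimodular \<open>u\<close>, Cauchy's formula on the circle of radius
  \<open>\<alpha> / (1 + \<alpha>)\<close> turns the quotient into a ratio of Fourier integrals of \<open>k\<close>-th powers of characteristic
  functions of geometric variables. After rescaling the angle by \<open>sqrt k\<close> these converge to Gaussian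
  integrals: the paths behave like \<open>k\<close> independent geometric lengths conditioned on their sum, which is
  where the rank two correction in \<open>Hmat\<close> comes from, while the loops contribute the Poisson factor
  through \<open>Q\<^sub>u\<close>.
\<close>

subsection \<open>Sums over pairings of a multiset of half-edges\<close>

text \<open>The parameter \<open>k\<close> is n1/2, the number of paths. Weights \<open>u\<close>
  live in a general field, so that one recursion serves both the real marking \<open>1 + y\<close>
  of the moments and the unimodular weights of the characteristic functions. The radius
  \<alpha>/(1+\<alpha>) is the saddle point: it gives the geometric lengths mean \<alpha>, which
  agrees with n/k up to O(1/k), and so removes a linear phase that would otherwise be of order sqrt
  k. The denominator is the same integral with trivial weights, so the prefactors cancel and no
  separate estimate of the partition function is made. Moments do not follow from weak convergence.
  In the variance the terms of order k^2 must cancel, which is why coefficient ratios are tracked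
  with an error O(1/k); the same variance bound then supplies tightness. Since
  \<open>weak_conv_vec\<close> tests against all bounded continuous functions, convergence of
  characteristic functions is passed on by tightness together with approximation by trigonometric
  polynomials on boxes.\<close>

fun pairs :: "'a list \<Rightarrow> 'a multiset multiset" where
  "pairs (x # y # zs) = add_mset {#x, y#} (pairs zs)"
| "pairs [] = {#}"
| "pairs [x] = {#}"

text \<open>Bridge from the index form used in \<open>seqv\<close> to the recursive
  \<open>pairs\<close>, on which induction works.\<close>

lemma pairs_eq_nth:
  assumes "length xs = 2 * m"
  shows "mset (map (\<lambda>i. {#xs ! (2 * i), xs ! (2 * i + 1)#}) [0..<m]) = pairs xs"
  using assms
proof (induction m arbitrary: xs)
  case (Suc m)
  then obtain x y zs where xs: "xs = x # y # zs"
    by (cases xs rule: pairs.cases) auto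
  have "map (\<lambda>i. {#xs ! (2 * i), xs ! (2 * i + 1)#}) [0..<Suc m]
      = {#x, y#} # map (\<lambda>i. {#zs ! (2 * i), zs ! (2 * i + 1)#}) [0..<m]"
    unfolding map_upt_Suc by (simp add: xs)
  with Suc.IH[of zs] Suc.prems show ?case
    by (simp add: xs del: upt_Suc)
qed simp

lemma size_pairs: "size (pairs xs) = length xs div 2"
  by (induction xs rule: pairs.induct) auto

lemma pairs_map: "pairs (map h xs) = image_mset (image_mset h) (pairs xs)"
  by (induction xs rule: pairs.induct) auto

lemma sum_mset_pairs: "even (length xs) \<Longrightarrow> sum_mset (pairs xs) = mset xs"
  by (induction xs rule: pairs.induct) auto

lemma size_edge_pairs: "e \<in># pairs xs \<Longrightarrow> size e = 2"
  by (induction xs rule: pairs.induct) auto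

lemma edge_subset_pairs: "e \<in># pairs xs \<Longrightarrow> set_mset e \<subseteq> set xs"
  by (induction xs rule: pairs.induct) auto

text \<open>Runs over distinct arrangements of the multiset, not over matchings of labelled
  half-edges. This is how \<open>seqv\<close> counts, so loops and multiple edges receive their
  compensation factor automatically.\<close>

definition psum :: "'a multiset \<Rightarrow> ('a multiset multiset \<Rightarrow> 'b) \<Rightarrow> 'b :: comm_monoid_add" where
  "psum M f = (\<Sum>xs\<in>permutations_of_multiset M. f (pairs xs))"

lemma sum_permutations_Cons:
  fixes f :: "'a list \<Rightarrow> 'b :: comm_monoid_add"
  assumes "M \<noteq> {#}"
  shows "(\<Sum>xs\<in>permutations_of_multiset M. f xs)
    = (\<Sum>x\<in>set_mset M. \<Sum>xs\<in>permutations_of_multiset (M - {#x#}). f (x # xs))"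
  unfolding permutations_of_multiset_nonempty[OF assms]
  by (subst sum.UNION_disjoint) (auto simp: sum.reindex)

lemma psum_Cons:
  assumes "size M \<ge> 2"
  shows "psum M f = (\<Sum>x\<in>set_mset M. \<Sum>y\<in>set_mset (M - {#x#}).
    psum (M - {#x#} - {#y#}) (\<lambda>G. f (add_mset {#x, y#} G)))"
proof -
  have "M \<noteq> {#}" using assms by auto
  moreover have "M - {#x#} \<noteq> {#}" if "x \<in># M" for x
    using assms size_Diff_singleton[OF that] by force
  ultimately show ?thesis
    unfolding psum_def by (simp add: sum_permutations_Cons cong: sum.cong)
qed

lemma psum_cong: "(\<And>xs. mset xs = M \<Longrightarrow> f (pairs xs) = g (pairs xs)) \<Longrightarrow> psum M f = psum M g"
  unfolding psum_def by (intro sum.cong) (auto dest: permutations_of_multisetD)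

lemma psum_empty [simp]: "psum {#} f = f {#}"
  by (simp add: psum_def)

text \<open>Both sides run over the triples of entries that can be removed in succession from
  \<open>M - {#v#}\<close>, a condition that does not depend on the order of removal.\<close>

lemma sum_mem_diff_conv:
  fixes g :: "'a \<Rightarrow> 'a \<Rightarrow> 'a \<Rightarrow> 'b :: comm_monoid_add"
  assumes "count M v = 1"
  shows "(\<Sum>x\<in>set_mset (M - {#v#}). \<Sum>y\<in>set_mset (M - {#x#} - {#v#}). \<Sum>z\<in>set_mset (M - {#x#} - {#y#} - {#v#}). g x y z)
    = (\<Sum>z\<in>set_mset (M - {#v#}). \<Sum>x\<in>set_mset (M - {#v#} - {#z#}). \<Sum>y\<in>set_mset (M - {#v#} - {#z#} - {#x#}). g x y z)"
proof -
  define N where "N = M - {#v#}"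
  have e: "M - {#x#} - {#y#} - {#v#} = N - {#x#} - {#y#}" "M - {#x#} - {#v#} = N - {#x#}" for x y
    by (simp_all add: N_def multiset_eq_iff)
  have "(\<Sum>x\<in>set_mset N. \<Sum>y\<in>set_mset (N - {#x#}). \<Sum>z\<in>set_mset (N - {#x#} - {#y#}). g x y z)
    = (\<Sum>z\<in>set_mset N. \<Sum>x\<in>set_mset (N - {#z#}). \<Sum>y\<in>set_mset (N - {#z#} - {#x#}). g x y z)"
    by (simp add: sum.Sigma, rule sum.reindex_bij_witness[where
          i = "\<lambda>(z,x,y). (x,y,z)" and j = "\<lambda>(x,y,z). (z,x,y)"])
       (auto simp: in_diff_count split: if_splits)
  then show ?thesis unfolding e N_def[symmetric] .
qed

text \<open>The only half-edge of \<open>v\<close> can stand at any of the \<open>2 * Suc m\<close>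
  list positions, and all positions contribute the same because \<open>pairs\<close> ignores the
  order of edges and of their ends. The induction splits off the first edge: \<open>v\<close> is its
  first end, its second end, or occurs later.\<close>

lemma psum_leaf:
  fixes f :: "'a multiset multiset \<Rightarrow> 'b :: comm_semiring_1"
  assumes "count M v = 1" "size M = 2 * Suc m"
  shows "psum M f = of_nat (2 * Suc m) *
    (\<Sum>y\<in>set_mset (M - {#v#}). psum (M - {#v#} - {#y#}) (\<lambda>G. f (add_mset {#v, y#} G)))"
  using assms
proof (induction m arbitrary: M f)
  case (0 M f)
  have v: "v \<in># M" using 0 by (metis count_eq_zero_iff zero_neq_one)
  obtain w where M: "M = {#v, w#}"
  proof -
    have "size (M - {#v#}) = 1" using v 0 by (simp add: size_Diff_singleton)
    then obtain w where "M - {#v#} = {#w#}" using size_1_singleton_mset by blast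
    with v that show ?thesis by (metis insert_DiffM)
  qed
  with 0 have "v \<noteq> w" by auto
  then show ?case
    by (subst psum_Cons) (auto simp: M add_mset_commute insert_commute mult_2)
next
  case (Suc m M f)
  let ?S = "\<lambda>f. (\<Sum>y\<in>set_mset (M - {#v#}). psum (M - {#v#} - {#y#}) (\<lambda>G. f (add_mset {#v, y#} G)))"
  have v: "v \<in># M" using Suc.prems by (metis count_eq_zero_iff zero_neq_one)
  have set: "set_mset (M - {#v#}) = set_mset M - {v}"
    using Suc.prems by (auto simp: in_diff_count split: if_splits)
  have "psum M f = (\<Sum>x\<in>set_mset M. \<Sum>y\<in>set_mset (M - {#x#}).
    psum (M - {#x#} - {#y#}) (\<lambda>G. f (add_mset {#x, y#} G)))"
    using Suc.prems by (intro psum_Cons) auto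
  also have "\<dots> = ?S f + (\<Sum>x\<in>set_mset (M - {#v#}). \<Sum>y\<in>set_mset (M - {#x#}).
    psum (M - {#x#} - {#y#}) (\<lambda>G. f (add_mset {#x, y#} G)))"
    using v by (subst sum.remove[of _ v]) (auto simp: set)
  also have "(\<Sum>x\<in>set_mset (M - {#v#}). \<Sum>y\<in>set_mset (M - {#x#}).
      psum (M - {#x#} - {#y#}) (\<lambda>G. f (add_mset {#x, y#} G)))
    = (\<Sum>x\<in>set_mset (M - {#v#}). psum (M - {#x#} - {#v#}) (\<lambda>G. f (add_mset {#x, v#} G))
       + (\<Sum>y\<in>set_mset (M - {#x#} - {#v#}). psum (M - {#x#} - {#y#}) (\<lambda>G. f (add_mset {#x, y#} G))))"
  proof (intro sum.cong refl)
    fix x assume x: "x \<in># M - {#v#}"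
    then have "v \<in># M - {#x#}" "set_mset (M - {#x#} - {#v#}) = set_mset (M - {#x#}) - {v}"
      using Suc.prems v by (auto simp: in_diff_count set split: if_splits)
    then show "(\<Sum>y\<in>set_mset (M - {#x#}). psum (M - {#x#} - {#y#}) (\<lambda>G. f (add_mset {#x, y#} G)))
      = psum (M - {#x#} - {#v#}) (\<lambda>G. f (add_mset {#x, v#} G))
       + (\<Sum>y\<in>set_mset (M - {#x#} - {#v#}). psum (M - {#x#} - {#y#}) (\<lambda>G. f (add_mset {#x, y#} G)))"
      by (simp add: sum.remove[of "set_mset (M - {#x#})" v])
  qed
  \<comment> \<open>Edges are unordered, so \<open>v\<close> in second position yields the same sum
    \<open>?S f\<close> as \<open>v\<close> in first position.\<close>
  also have "\<dots> = ?S f + (\<Sum>x\<in>set_mset (M - {#v#}). \<Sum>y\<in>set_mset (M - {#x#} - {#v#}). psum (M - {#x#} - {#y#}) (\<lambda>G. f (add_mset {#x, y#} G)))"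
  proof -
    have "M - {#x#} - {#v#} = M - {#v#} - {#x#}" "{#x, v#} = {#v, x#}" for x
      by (simp_all add: multiset_eq_iff)
    then show ?thesis unfolding sum.distrib by presburger
  qed
  also have "(\<Sum>x\<in>set_mset (M - {#v#}). \<Sum>y\<in>set_mset (M - {#x#} - {#v#}). psum (M - {#x#} - {#y#}) (\<lambda>G. f (add_mset {#x, y#} G)))
    = (\<Sum>x\<in>set_mset (M - {#v#}). \<Sum>y\<in>set_mset (M - {#x#} - {#v#}). of_nat (2 * Suc m) *
        (\<Sum>z\<in>set_mset (M - {#x#} - {#y#} - {#v#}). psum (M - {#x#} - {#y#} - {#v#} - {#z#}) (\<lambda>G. f (add_mset {#x, y#} (add_mset {#v, z#} G)))))"
  proof (intro sum.cong refl Suc.IH)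
    fix x y assume "x \<in># M - {#v#}" "y \<in># M - {#x#} - {#v#}"
    then have xy: "x \<in># M" "y \<in># M - {#x#}" "x \<noteq> v" "y \<noteq> v"
      using Suc.prems by (auto simp: in_diff_count set split: if_splits)
    show "count (M - {#x#} - {#y#}) v = 1" using xy Suc.prems by auto
    show "size (M - {#x#} - {#y#}) = 2 * Suc m" using xy(2) size_Diff_singleton[OF xy(1)] Suc.prems(2)
        size_Diff_singleton[OF xy(2)] by presburger
  qed
  also have "\<dots> = of_nat (2 * Suc m) * (\<Sum>x\<in>set_mset (M - {#v#}). \<Sum>y\<in>set_mset (M - {#x#} - {#v#}). 
        \<Sum>z\<in>set_mset (M - {#x#} - {#y#} - {#v#}). psum (M - {#x#} - {#y#} - {#v#} - {#z#}) (\<lambda>G. f (add_mset {#x, y#} (add_mset {#v, z#} G))))"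
    by (simp only: sum_distrib_left)
  \<comment> \<open>The neighbour \<open>z\<close> of \<open>v\<close> is now chosen first; the two
    inner sums are then an instance of \<open>psum_Cons\<close> read backwards.\<close>
  also have "\<dots> = of_nat (2 * Suc m) * (\<Sum>z\<in>set_mset (M - {#v#}). \<Sum>x\<in>set_mset (M - {#v#} - {#z#}).
        \<Sum>y\<in>set_mset (M - {#v#} - {#z#} - {#x#}). psum (M - {#v#} - {#z#} - {#x#} - {#y#}) (\<lambda>G. f (add_mset {#v, z#} (add_mset {#x, y#} G))))"
  proof -
    have "M - {#x#} - {#y#} - {#v#} - {#z#} = M - {#v#} - {#z#} - {#x#} - {#y#}" for x y z
      by (simp add: multiset_eq_iff)
    moreover have "(\<lambda>G. f (add_mset {#x, y#} (add_mset {#v, z#} G))) = (\<lambda>G. f (add_mset {#v, z#} (add_mset {#x, y#} G)))" for x y z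
      by (simp add: add_mset_commute)
    ultimately show ?thesis
      unfolding sum_mem_diff_conv[OF Suc.prems(1), symmetric] by presburger
  qed
  also have "\<dots> = of_nat (2 * Suc m) * ?S f"
  proof -
    have "size (M - {#v#} - {#z#}) \<ge> 2" if "z \<in># M - {#v#}" for z
      using size_Diff_singleton[OF that] size_Diff_singleton[OF v] Suc.prems(2) by presburger
    then show ?thesis
      by (intro arg_cong[where f = "(*) _"] sum.cong refl psum_Cons[symmetric])
  qed
  finally have "psum M f = ?S f + (?S f + of_nat (2 * Suc m) * ?S f)" .
  moreover have "a + (a + of_nat (2 * Suc m) * a) = of_nat (2 * Suc (Suc m)) * a" for a :: 'b
    by (simp add: algebra_simps)
  ultimately show ?case by (simp only:)
qed

subsection \<open>Component weights under removal of a leaf\<close>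

lemma adj_sym: "adj G u v \<longleftrightarrow> adj G v u"
  by (simp add: adj_def add_mset_commute)

lemma in_comp_self: "v \<in> comp G v"
  by (simp add: comp_def)

lemma comp_trans: "y \<in> comp G x \<Longrightarrow> z \<in> comp G y \<Longrightarrow> z \<in> comp G x"
  by (simp add: comp_def)

lemma comp_step: "adj G x y \<Longrightarrow> y \<in> comp G x"
  by (auto simp: comp_def)

lemma in_comp_sym: "y \<in> comp G x \<longleftrightarrow> x \<in> comp G y"
proof -
  have "symp (adj G)" by (auto simp: symp_def adj_sym)
  then have "symp (adj G)\<^sup>*\<^sup>*" by (rule symp_rtranclp)
  then show ?thesis by (auto simp: comp_def symp_def)
qed

lemma comp_eq_iff: "comp G x = comp G y \<longleftrightarrow> y \<in> comp G x"
  by (metis (no_types, opaque_lifting) comp_trans in_comp_self in_comp_sym subsetI subset_antisym)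

lemma comp_leastI:
  assumes "x \<in> C" "\<And>y z. y \<in> C \<Longrightarrow> adj G y z \<Longrightarrow> z \<in> C"
  shows "comp G x \<subseteq> C"
proof
  fix y assume "y \<in> comp G x"
  then have "(adj G)\<^sup>*\<^sup>* x y" by (simp add: comp_def)
  then show "y \<in> C" by induction (use assms in auto)
qed

lemma comp_subset:
  assumes "\<forall>e\<in>#G. set_mset e \<subseteq> V" "x \<in> V"
  shows "comp G x \<subseteq> V"
  by (rule comp_leastI) (use assms in \<open>auto simp: adj_def\<close>)

text \<open>A vertex \<open>x\<close> stands for \<open>s x\<close> original vertices; peeling a leaf moves its size to its neighbour.\<close>
definition weight :: "(nat \<Rightarrow> 'a :: comm_monoid_mult) \<Rightarrow> (nat \<Rightarrow> nat) \<Rightarrow> nat set \<Rightarrow> nat multiset multiset \<Rightarrow> 'a" where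
  "weight u s V G = (\<Prod>C\<in>comp G ` V. u (\<Sum>x\<in>C. s x))"

lemma weight_empty [simp]: "weight u s {} G = 1"
  by (simp add: weight_def)

lemma weight_cong_size:
  assumes "\<forall>e\<in>#G. set_mset e \<subseteq> V" "\<And>x. x \<in> V \<Longrightarrow> s x = s' x"
  shows "weight u s V G = weight u s' V G"
  unfolding weight_def using comp_subset[OF assms(1)] assms(2)
  by (intro prod.cong refl arg_cong[where f = u] sum.cong) auto

text \<open>The new edge changes only the component of \<open>w\<close>, which gains
  \<open>v\<close>; adding \<open>s v\<close> to the size of \<open>w\<close> gives the same total.
  The map \<open>f\<close> restores \<open>v\<close> to that component and is injective, so no
  factor of the product is lost.\<close>

lemma weight_leaf:
  assumes G: "\<forall>e\<in>#G. set_mset e \<subseteq> V" and "finite V" "v \<notin> V" "w \<in> V"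
  shows "weight u s (insert v V) (add_mset {#v, w#} G) = weight u (s(w := s w + s v)) V G"
proof -
  define H where "H = add_mset {#v, w#} G"
  define f where "f C = (if w \<in> C then insert v C else C)" for C
  have adjH: "adj H a b \<longleftrightarrow> adj G a b \<or> (a = v \<and> b = w) \<or> (a = w \<and> b = v)" for a b
    by (auto simp: H_def adj_def add_eq_conv_ex add_mset_commute)
  have adjG: "a \<in> V \<and> b \<in> V" if "adj G a b" for a b
    using that G by (auto simp: adj_def)
  have compH: "comp H x = f (comp G x)" if x: "x \<in> V" for x
  proof
    have sub: "comp G x \<subseteq> V" by (rule comp_subset[OF G x])
    show "comp H x \<subseteq> f (comp G x)"
    proof (rule comp_leastI)
      show "x \<in> f (comp G x)" by (simp add: f_def in_comp_self)
      fix y z assume y: "y \<in> f (comp G x)" and "adj H y z"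
      then consider "adj G y z" | "y = v" "z = w" | "y = w" "z = v" using adjH by auto
      then show "z \<in> f (comp G x)"
      proof cases
        case 1
        then have "y \<in> comp G x" using y adjG assms(3) by (auto simp: f_def split: if_splits)
        with 1 show ?thesis using comp_step comp_trans by (metis f_def insertCI)
      next
        case 2
        then show ?thesis using y sub assms(3) by (auto simp: f_def split: if_splits)
      next
        case 3
        then show ?thesis using y assms by (auto simp: f_def split: if_splits)
      qed
    qed
    have GH: "comp G x \<subseteq> comp H x"
      by (rule comp_leastI) (auto simp: in_comp_self intro: comp_trans comp_step adjH[THEN iffD2])
    moreover have "v \<in> comp H x" if "w \<in> comp G x"
      using that GH comp_trans[of w H x v] comp_step[of H w v] adjH by auto
    ultimately show "f (comp G x) \<subseteq> comp H x" by (auto simp: f_def)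
  qed
  have "comp H v = comp H w" by (simp add: comp_eq_iff comp_step adjH)
  then have "comp H ` insert v V = comp H ` V" using assms by auto
  also have "\<dots> = f ` comp G ` V" using compH by (auto simp: image_image)
  finally have im: "comp H ` insert v V = f ` comp G ` V" .
  have sub: "C \<subseteq> V" if "C \<in> comp G ` V" for C using that comp_subset[OF G] by auto
  have inj: "inj_on f (comp G ` V)"
  proof (rule inj_onI)
    fix C D assume "C \<in> comp G ` V" "D \<in> comp G ` V" "f C = f D"
    moreover from this have "v \<notin> C" "v \<notin> D" using sub assms by blast+
    ultimately show "C = D" unfolding f_def by (metis insert_ident insertCI)
  qed
  have "sum s (f C) = sum (s(w := s w + s v)) C" if "C \<in> comp G ` V" for C
  proof -
    have C: "C \<subseteq> V" using sub that by auto
    then have fin: "finite C" "v \<notin> C" using assms finite_subset by blast+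
    show ?thesis
    proof (cases "w \<in> C")
      case True
      have "sum (s(w := s w + s v)) C = s w + s v + sum (s(w := s w + s v)) (C - {w})"
        using True fin by (simp add: sum.remove)
      also have "sum (s(w := s w + s v)) (C - {w}) = sum s (C - {w})" by (intro sum.cong) auto
      also have "s w + s v + sum s (C - {w}) = s v + sum s C"
        using True fin by (simp add: sum.remove[of C w s])
      finally show ?thesis using True fin by (simp add: f_def)
    next
      case False
      then show ?thesis by (auto simp: f_def intro!: sum.cong)
    qed
  qed
  then show ?thesis
    unfolding weight_def H_def[symmetric] im by (subst prod.reindex[OF inj]) (auto intro!: prod.cong)
qed

text \<open>Serves the case of an edge between two leaves: after one of them is peeled, the other
  carries the size of a finished component, whose factor splits off.\<close>

lemma weight_isolated:
  assumes G: "\<forall>e\<in>#G. set_mset e \<subseteq> V" and "finite V" "w \<notin> V"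
  shows "weight u s (insert w V) G = u (s w) * weight u s V G"
proof -
  have "comp G w = {w}"
  proof
    have "\<not> adj G w z" for z using G assms(3) by (auto simp: adj_def)
    then show "comp G w \<subseteq> {w}" by (intro comp_leastI) auto
  qed (simp add: in_comp_self)
  moreover have "{w} \<notin> comp G ` V" using comp_subset[OF G] assms by blast
  ultimately show ?thesis using assms by (simp add: weight_def)
qed

section \<open>Cutting a component open at a vertex\<close>

lemma size_mset_eq_2E:
  assumes "size e = 2"
  obtains a b where "e = {#a, b#}"
proof -
  obtain a e' where "e = add_mset a e'" "size e' = 1"
    using assms size_eq_Suc_imp_eq_union[of e 1] by auto
  then show ?thesis using that size_1_singleton_mset by metis
qed

text \<open>The handshake lemma inside one component: an edge has both ends or neither in it and so
  contributes 2 or 0.\<close>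

lemma even_sum_deg_comp:
  assumes "\<forall>e\<in>#G. size e = 2" "finite (comp G v)"
  shows "even (\<Sum>x\<in>comp G v. deg G x)"
proof -
  let ?C = "comp G v"
  have "(\<Sum>x\<in>C. deg H x) = (\<Sum>e\<in>#H. \<Sum>x\<in>C. count e x)" for C H
    unfolding deg_def by (induction H) (simp_all add: sum.distrib)
  then have "(\<Sum>x\<in>?C. deg G x) = (\<Sum>e\<in>#G. \<Sum>x\<in>?C. count e x)" .
  moreover have "even (\<Sum>x\<in>?C. count e x)" if "e \<in># G" for e
  proof -
    from assms that obtain a b where e: "e = {#a, b#}"
      by (metis size_mset_eq_2E)
    have "a \<in> ?C \<longleftrightarrow> b \<in> ?C"
      using that e comp_step comp_trans adj_sym by (metis adj_def)
    moreover have "count e x = (if a = x then 1 else 0) + (if b = x then 1 else 0)" for x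
      by (simp add: e)
    ultimately show ?thesis using assms(2) by (simp add: sum.distrib)
  qed
  moreover have "(\<And>e. e \<in># H \<Longrightarrow> even (f e)) \<Longrightarrow> even (\<Sum>e\<in>#H. f e)" for f :: "nat multiset \<Rightarrow> nat" and H
    by (induction H) auto
  ultimately show ?thesis by presburger
qed

text \<open>The map \<open>h\<close> glues \<open>v'\<close> to \<open>v\<close>. Both already lie
  in one component, so gluing merges nothing, and since \<open>v'\<close> has size 0 the totals are
  unchanged.\<close>

lemma weight_split:
  assumes G: "\<forall>e\<in>#G. set_mset e \<subseteq> insert v' V" "\<forall>e\<in>#G. size e = 2" and "finite V" "v' \<notin> V" "v \<in> V" "v' \<in> comp G v"
  defines "h \<equiv> \<lambda>x. if x = v' then v else x"
  shows "weight u s V (image_mset (image_mset h) G) = weight u (s(v' := 0)) (insert v' V) G"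
proof -
  define H where "H = image_mset (image_mset h) G"
  have adjH: "adj H a b \<longleftrightarrow> (\<exists>a' b'. adj G a' b' \<and> h a' = a \<and> h b' = b)" for a b
  proof
    assume "adj H a b"
    then obtain e where e: "e \<in># G" "image_mset h e = {#a, b#}" by (auto simp: adj_def H_def)
    with G obtain a' b' where e': "e = {#a', b'#}" by (metis size_mset_eq_2E)
    with e have "h a' = a \<and> h b' = b \<or> h a' = b \<and> h b' = a" by (auto simp: add_eq_conv_ex)
    moreover have "adj G a' b'" using e e' by (simp add: adj_def)
    ultimately show "\<exists>a' b'. adj G a' b' \<and> h a' = a \<and> h b' = b" using adj_sym by blast
  next
    assume "\<exists>a' b'. adj G a' b' \<and> h a' = a \<and> h b' = b"
    then show "adj H a b" unfolding adj_def H_def by force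
  qed
  have h: "comp G (h x) = comp G x" for x
    using assms(6) comp_eq_iff[of G v v'] by (auto simp: h_def)
  have compH: "comp H x = comp G x - {v'}" if "x \<in> V" for x
  proof
    show "comp H x \<subseteq> comp G x - {v'}"
    proof (rule comp_leastI)
      show "x \<in> comp G x - {v'}" using that assms by (auto simp: in_comp_self)
      fix y z assume y: "y \<in> comp G x - {v'}" and "adj H y z"
      then obtain a b where "adj G a b" "h a = y" "h b = z" using adjH by blast
      then have "comp G z = comp G y" using h by (metis comp_eq_iff comp_step)
      moreover have "z \<noteq> v'" using \<open>h b = z\<close> \<open>v \<in> V\<close> \<open>v' \<notin> V\<close> by (auto simp: h_def split: if_splits)
      ultimately show "z \<in> comp G x - {v'}" using y by (metis Diff_iff comp_eq_iff empty_iff insert_iff)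
    qed
    have "comp G x \<subseteq> {y. h y \<in> comp H x}"
    proof (rule comp_leastI)
      show "x \<in> {y. h y \<in> comp H x}" using that assms by (auto simp: h_def in_comp_self)
      fix y z assume "y \<in> {y. h y \<in> comp H x}" "adj G y z"
      then show "z \<in> {y. h y \<in> comp H x}" using adjH comp_step comp_trans by (metis mem_Collect_eq)
    qed
    moreover have "h y = y" if "y \<noteq> v'" for y using that by (simp add: h_def)
    ultimately show "comp G x - {v'} \<subseteq> comp H x" by force
  qed
  have "comp G v' = comp G v" using assms comp_eq_iff by metis
  then have im: "comp G ` insert v' V = comp G ` V" using assms by auto
  have imH: "comp H ` V = (\<lambda>C. C - {v'}) ` comp G ` V" using compH by (auto simp: image_image)
  have inj: "inj_on (\<lambda>C. C - {v'}) (comp G ` V)"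
  proof (rule inj_onI, clarsimp)
    fix x y assume "x \<in> V" "y \<in> V" "comp G x - {v'} = comp G y - {v'}"
    then have "x \<in> comp G y" using in_comp_self[of x G] assms by auto
    then show "comp G x = comp G y" using comp_eq_iff by metis
  qed
  have "sum s (C - {v'}) = sum (s(v' := 0)) C" if "C \<in> comp G ` V" for C
  proof -
    have "C \<subseteq> insert v' V" using that comp_subset[OF G(1)] by auto
    then have "finite C" using assms(3) finite_subset by auto
    then have "sum (s(v' := 0)) C = sum (s(v' := 0)) (C - {v'})"
      by (intro sum.mono_neutral_right) auto
    also have "\<dots> = sum s (C - {v'})" by (intro sum.cong) auto
    finally show ?thesis by simp
  qed
  then show ?thesis
    unfolding weight_def H_def[symmetric] im imH
    by (subst prod.reindex[OF inj]) (auto intro!: prod.cong)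
qed

text \<open>An arrangement with two copies of \<open>v\<close> arises from exactly two arrangements
  with \<open>v\<close> and \<open>v'\<close>, according to which copy is renamed. The map
  \<open>p\<close> renames the copy at position \<open>i\<close>, and \<open>?I ys\<close> holds the
  two candidate positions.\<close>

lemma sum_permutations_split:
  fixes g :: "'a list \<Rightarrow> 'b :: comm_semiring_1"
  assumes "v \<notin># N" "v' \<notin># N" "v \<noteq> v'"
  defines "h \<equiv> \<lambda>x. if x = v' then v else x"
  shows "(\<Sum>xs\<in>permutations_of_multiset (add_mset v (add_mset v' N)). g (map h xs))
    = 2 * (\<Sum>ys\<in>permutations_of_multiset (add_mset v (add_mset v N)). g ys)"
proof -
  let ?A = "permutations_of_multiset (add_mset v (add_mset v' N))"
  let ?B = "permutations_of_multiset (add_mset v (add_mset v N))"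
  let ?I = "\<lambda>ys. {i. i < length ys \<and> v = ys ! i}"
  define p where "p = (\<lambda>(ys, i). list_update ys i v')"
  have B: "v' \<notin> set ys" "map h ys = ys" "card (?I ys) = 2" if "ys \<in> ?B" for ys
  proof -
    have m: "mset ys = add_mset v (add_mset v N)" using that by (rule permutations_of_multisetD)
    then have "set ys = set_mset (add_mset v (add_mset v N))" by (metis set_mset_mset)
    then show 1: "v' \<notin> set ys" using assms by auto
    then show "map h ys = ys" by (intro map_idI) (auto simp: h_def)
    have "count (mset ys) v = 2" using assms by (simp add: m not_in_iff)
    then show "card (?I ys) = 2" by (simp only: count_mset count_list_eq_length_filter length_filter_conv_card)
  qed
  have map_p: "map h (p (ys, i)) = ys" if "ys \<in> ?B" "i \<in> ?I ys" for ys i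
    using B[OF that(1)] that by (simp add: p_def map_update h_def)
  have "bij_betw p (SIGMA ys:?B. ?I ys) ?A"
  proof (rule bij_betw_imageI)
    show "inj_on p (SIGMA ys:?B. ?I ys)"
    proof (rule inj_onI)
      fix a b assume ab: "a \<in> (SIGMA ys:?B. ?I ys)" "b \<in> (SIGMA ys:?B. ?I ys)" "p a = p b"
      then obtain ys i zs j where eq: "a = (ys, i)" "b = (zs, j)" by (metis surj_pair)
      with ab have *: "ys \<in> ?B" "zs \<in> ?B" "i < length ys" "j < length zs" "ys ! i = v" "zs ! j = v" "p (ys, i) = p (zs, j)"
        by auto
      then have zs: "ys = zs" using map_p[of ys i] map_p[of zs j] by auto
      have "i = j"
      proof (rule ccontr)
        assume "i \<noteq> j"
        then have "p (zs, j) ! i = ys ! i" using zs by (simp add: p_def)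
        moreover have "p (ys, i) ! i = v'" using *(3) by (simp add: p_def)
        ultimately show False using * assms(3) by auto
      qed
      with zs show "a = b" by (simp add: eq)
    qed
    show "p ` (SIGMA ys:?B. ?I ys) = ?A"
    proof (intro equalityI subsetI)
      fix xs assume "xs \<in> p ` (SIGMA ys:?B. ?I ys)"
      then obtain ys i where *: "ys \<in> ?B" "i < length ys" "ys ! i = v" "xs = list_update ys i v'"
        by (auto simp: p_def)
      then have "mset xs = add_mset v' (add_mset v (add_mset v N) - {#v#})"
        by (simp add: mset_update permutations_of_multisetD)
      then show "xs \<in> ?A" by (intro permutations_of_multisetI) (simp add: add_mset_commute)
    next
      fix xs assume "xs \<in> ?A"
      then have m: "mset xs = add_mset v (add_mset v' N)" by (rule permutations_of_multisetD)
      then have "v' \<in> set xs" by (metis set_mset_mset insert_iff set_mset_add_mset_insert)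
      then obtain as bs where xs: "xs = as @ v' # bs" by (metis split_list)
      have eq: "mset as + mset bs = add_mset v N" using m by (simp add: xs add_mset_commute)
      have "v' \<notin># mset as + mset bs" unfolding eq using assms by auto
      then have "v' \<notin> set as" "v' \<notin> set bs" by auto
      have "as @ v # bs \<in> ?B"
        using eq by (intro permutations_of_multisetI) simp
      moreover have "xs = p (as @ v # bs, length as)" by (simp add: p_def xs)
      ultimately show "xs \<in> p ` (SIGMA ys:?B. ?I ys)" by force
    qed
  qed
  then have "(\<Sum>xs\<in>?A. g (map h xs)) = (\<Sum>x\<in>(SIGMA ys:?B. ?I ys). g (map h (p x)))"
    by (rule sum.reindex_bij_betw[symmetric])
  also have "\<dots> = (\<Sum>ys\<in>?B. \<Sum>i\<in>?I ys. g (map h (p (ys, i))))"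
    by (subst sum.Sigma) (auto simp: case_prod_beta)
  also have "\<dots> = (\<Sum>ys\<in>?B. \<Sum>i\<in>?I ys. g ys)"
    by (intro sum.cong refl) (simp add: map_p)
  also have "\<dots> = 2 * (\<Sum>ys\<in>?B. g ys)"
    using B(3) by (simp add: sum_distrib_left)
  finally show ?thesis .
qed

lemma psum_split:
  fixes F :: "'a multiset multiset \<Rightarrow> 'b :: comm_semiring_1"
  assumes "v \<notin># N" "v' \<notin># N" "v \<noteq> v'"
  shows "psum (add_mset v (add_mset v' N)) (\<lambda>G. F (image_mset (image_mset (\<lambda>x. if x = v' then v else x)) G))
    = 2 * psum (add_mset v (add_mset v N)) F"
  using sum_permutations_split[OF assms, of "\<lambda>xs. F (pairs xs)"] by (simp add: psum_def pairs_map)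

section \<open>Weighted sums over graphs with a prescribed set of leaves\<close>

lemma deg_eq_count_sum_mset: "deg G v = count (sum_mset G) v"
  unfolding deg_def by (induction G) auto

lemma deg_pairs:
  assumes "even (length xs)"
  shows "deg (pairs xs) v = count (mset xs) v"
  by (simp add: deg_eq_count_sum_mset sum_mset_pairs[OF assms])

definition degree_mset :: "nat set \<Rightarrow> nat set \<Rightarrow> nat multiset" where
  "degree_mset S1 S2 = mset_set S1 + mset_set S2 + mset_set S2"

lemma size_degree_mset: "size (degree_mset S1 S2) = card S1 + 2 * card S2"
  by (simp add: degree_mset_def)

lemma set_degree_mset: "finite S1 \<Longrightarrow> finite S2 \<Longrightarrow> set_mset (degree_mset S1 S2) = S1 \<union> S2"
  by (auto simp: degree_mset_def)

text \<open>Using up one half-edge of a vertex of degree two turns that vertex into a leaf; thus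
  peeling stays within degree sequences of ones and twos.\<close>

lemma degree_mset_diff:
  assumes "finite S1" "finite S2" "S1 \<inter> S2 = {}"
  shows "v \<in> S1 \<Longrightarrow> degree_mset S1 S2 - {#v#} = degree_mset (S1 - {v}) S2"
    and "v \<in> S2 \<Longrightarrow> degree_mset S1 S2 - {#v#} = degree_mset (insert v S1) (S2 - {v})"
  using assms by (auto simp: degree_mset_def multiset_eq_iff count_mset_set')

text \<open>Normalised so as to be the \<open>kappa\<close>-weighted sum of \<open>F\<close> over the multigraphs with leaves \<open>S1\<close> and
  vertices of degree two \<open>S2\<close>.\<close>
definition ksum :: "nat set \<Rightarrow> nat set \<Rightarrow> (nat multiset multiset \<Rightarrow> 'a :: field_char_0) \<Rightarrow> 'a" where
  "ksum S1 S2 F = psum (degree_mset S1 S2) F /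
     (2 ^ (size (degree_mset S1 S2) div 2) * fact (size (degree_mset S1 S2) div 2))"

lemma ksum_cong:
  assumes "finite S1" "finite S2"
    and "\<And>xs. mset xs = degree_mset S1 S2 \<Longrightarrow> set xs = S1 \<union> S2 \<Longrightarrow> F (pairs xs) = H (pairs xs)"
  shows "ksum S1 S2 F = ksum S1 S2 H"
  unfolding ksum_def
  by (intro arg_cong2[where f = "(/)"] psum_cong refl assms(3)) (metis set_mset_mset set_degree_mset assms(1,2))+

text \<open>The factor \<open>2 * Suc m\<close> from \<open>psum_leaf\<close> is exactly the
  quotient of the normalisations \<open>2 ^ Suc m * fact (Suc m)\<close> and
  \<open>2 ^ m * fact m\<close>, so the normalised recursion has coefficients one.\<close>

lemma ksum_leaf:
  assumes "finite S1" "finite S2" "S1 \<inter> S2 = {}" "even (card S1)" "v \<in> S1"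
  shows "ksum S1 S2 F = (\<Sum>w\<in>S1 - {v}. ksum (S1 - {v} - {w}) S2 (\<lambda>G. F (add_mset {#v, w#} G)))
    + (\<Sum>w\<in>S2. ksum (insert w (S1 - {v})) (S2 - {w}) (\<lambda>G. F (add_mset {#v, w#} G)))"
proof -
  let ?M = "degree_mset S1 S2"
  have "card S1 \<noteq> 0" using assms by auto
  then have "card S1 > 0" by simp
  then obtain m where m: "size ?M = 2 * Suc m"
    using assms unfolding size_degree_mset by (metis Suc_pred add_gr_0 dvd_triv_left even_add evenE nat_0_less_mult_iff pos2)
  have "v \<notin> S2" using assms by auto
  then have c: "count ?M v = 1" using assms by (simp add: degree_mset_def count_mset_set')
  let ?c = "2 ^ m * fact m :: 'a"
  let ?f = "\<lambda>w. psum (?M - {#v#} - {#w#}) (\<lambda>G. F (add_mset {#v, w#} G)) / ?c"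
  have sz: "size (?M - {#v#} - {#w#}) = 2 * m" if "w \<in># ?M - {#v#}" for w
    using m that c size_Diff_singleton[OF that] size_Diff_singleton[of v ?M]
    by (metis add_2_eq_Suc' count_eq_zero_iff diff_Suc_1 mult_Suc_right zero_neq_one add_2_eq_Suc diff_Suc_Suc minus_nat.diff_0 One_nat_def)
  have M1: "?M - {#v#} = degree_mset (S1 - {v}) S2" using degree_mset_diff assms by auto
  have M2: "degree_mset (S1 - {v}) S2 - {#w#} = degree_mset (S1 - {v} - {w}) S2" if "w \<in> S1 - {v}" for w
    using assms that by (intro degree_mset_diff) auto
  have M3: "degree_mset (S1 - {v}) S2 - {#w#} = degree_mset (insert w (S1 - {v})) (S2 - {w})" if "w \<in> S2" for w
    using assms that by (intro degree_mset_diff) auto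
  have sz1: "size (degree_mset (S1 - {v} - {w}) S2) = 2 * m" if "w \<in> S1 - {v}" for w
    using that sz[of w] M2[OF that] assms by (simp add: M1 set_degree_mset)
  have sz2: "size (degree_mset (insert w (S1 - {v})) (S2 - {w})) = 2 * m" if "w \<in> S2" for w
    using that sz[of w] M3[OF that] assms by (simp add: M1 set_degree_mset)
  have set: "set_mset (?M - {#v#}) = (S1 - {v}) \<union> S2" using assms by (simp add: M1 set_degree_mset)
  have "ksum S1 S2 F = (of_nat (2 * Suc m) *
      (\<Sum>w\<in>set_mset (?M - {#v#}). psum (?M - {#v#} - {#w#}) (\<lambda>G. F (add_mset {#v, w#} G)))) / (2 ^ Suc m * fact (Suc m))"
    unfolding ksum_def psum_leaf[OF c m] m by simp
  also have "\<dots> = (\<Sum>w\<in>set_mset (?M - {#v#}). psum (?M - {#v#} - {#w#}) (\<lambda>G. F (add_mset {#v, w#} G))) / ?c"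
    by (simp add: field_simps del: of_nat_Suc of_nat_mult) (simp add: algebra_simps)
  also have "\<dots> = (\<Sum>w\<in>(S1 - {v}) \<union> S2. ?f w)" by (simp only: set sum_divide_distrib)
  also have "\<dots> = (\<Sum>w\<in>S1 - {v}. ?f w) + (\<Sum>w\<in>S2. ?f w)"
    using assms by (intro sum.union_disjoint) auto
  also have "(\<Sum>w\<in>S1 - {v}. ?f w) = (\<Sum>w\<in>S1 - {v}. ksum (S1 - {v} - {w}) S2 (\<lambda>G. F (add_mset {#v, w#} G)))"
    by (intro sum.cong refl) (simp add: ksum_def M1 M2 sz1)
  also have "(\<Sum>w\<in>S2. ?f w) = (\<Sum>w\<in>S2. ksum (insert w (S1 - {v})) (S2 - {w}) (\<lambda>G. F (add_mset {#v, w#} G)))"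
    by (intro sum.cong refl) (simp add: ksum_def M1 M3 sz2)
  finally show ?thesis .
qed

definition wsum :: "(nat \<Rightarrow> 'a :: field_char_0) \<Rightarrow> (nat \<Rightarrow> nat) \<Rightarrow> nat set \<Rightarrow> nat set \<Rightarrow> 'a" where
  "wsum u s S1 S2 = ksum S1 S2 (weight u s (S1 \<union> S2))"

lemma wsum_cong_size:
  assumes "finite S1" "finite S2" "\<And>x. x \<in> S1 \<union> S2 \<Longrightarrow> s x = s' x"
  shows "wsum u s S1 S2 = wsum u s' S1 S2"
  unfolding wsum_def
  by (intro ksum_cong weight_cong_size assms) (use edge_subset_pairs in blast)+

lemma ksum_mult_left: "ksum S1 S2 (\<lambda>G. c * F G) = c * ksum S1 S2 F"
  by (simp add: ksum_def psum_def sum_distrib_left)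

text \<open>If the neighbour of \<open>v\<close> is a leaf, a path of total size
  \<open>s v + s w\<close> is complete and its factor leaves the sum. If the neighbour has degree
  two, it becomes a leaf that carries both sizes.\<close>

lemma wsum_leaf:
  assumes "finite S1" "finite S2" "S1 \<inter> S2 = {}" "even (card S1)" "v \<in> S1"
  shows "wsum u s S1 S2 = (\<Sum>w\<in>S1 - {v}. u (s v + s w) * wsum u s (S1 - {v} - {w}) S2)
    + (\<Sum>w\<in>S2. wsum u (s(w := s v + s w)) (insert w (S1 - {v})) (S2 - {w}))"
  unfolding wsum_def ksum_leaf[OF assms]
proof (intro arg_cong2[where f = "(+)"] sum.cong refl)
  fix w assume w: "w \<in> S1 - {v}"
  let ?V = "(S1 - {v} - {w}) \<union> S2"
  have V: "S1 \<union> S2 = insert v (insert w ?V)" using w assms by auto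
  have "ksum (S1 - {v} - {w}) S2 (\<lambda>G. weight u s (S1 \<union> S2) (add_mset {#v, w#} G))
      = ksum (S1 - {v} - {w}) S2 (\<lambda>G. u (s v + s w) * weight u s ?V G)"
  proof (rule ksum_cong)
    fix xs assume "set xs = ?V"
    then have e: "\<forall>e\<in>#pairs xs. set_mset e \<subseteq> ?V" using edge_subset_pairs by blast
    have "weight u s (S1 \<union> S2) (add_mset {#v, w#} (pairs xs)) = weight u (s(w := s w + s v)) (insert w ?V) (pairs xs)"
      unfolding V using e assms w by (intro weight_leaf) auto
    also have "\<dots> = u (s w + s v) * weight u (s(w := s w + s v)) ?V (pairs xs)"
      using e assms w by (subst weight_isolated) auto
    also have "weight u (s(w := s w + s v)) ?V (pairs xs) = weight u s ?V (pairs xs)"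
      using e assms w by (intro weight_cong_size) auto
    finally show "weight u s (S1 \<union> S2) (add_mset {#v, w#} (pairs xs)) = u (s v + s w) * weight u s ?V (pairs xs)"
      by (simp add: add.commute)
  qed (use assms in auto)
  then show "ksum (S1 - {v} - {w}) S2 (\<lambda>G. weight u s (S1 \<union> S2) (add_mset {#v, w#} G))
      = u (s v + s w) * ksum (S1 - {v} - {w}) S2 (weight u s ?V)"
    by (simp add: ksum_mult_left)
next
  fix w assume w: "w \<in> S2"
  let ?V = "insert w (S1 - {v}) \<union> (S2 - {w})"
  have V: "S1 \<union> S2 = insert v ?V" using w assms by auto
  show "ksum (insert w (S1 - {v})) (S2 - {w}) (\<lambda>G. weight u s (S1 \<union> S2) (add_mset {#v, w#} G))
    = ksum (insert w (S1 - {v})) (S2 - {w}) (weight u (s(w := s v + s w)) ?V)"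
  proof (rule ksum_cong)
    fix xs assume "set xs = ?V"
    then have e: "\<forall>e\<in>#pairs xs. set_mset e \<subseteq> ?V" using edge_subset_pairs by blast
    have "weight u s (S1 \<union> S2) (add_mset {#v, w#} (pairs xs)) = weight u (s(w := s w + s v)) ?V (pairs xs)"
      unfolding V using e assms w by (intro weight_leaf) auto
    then show "weight u s (S1 \<union> S2) (add_mset {#v, w#} (pairs xs)) = weight u (s(w := s v + s w)) ?V (pairs xs)"
      by (simp add: add.commute)
  qed (use assms in auto)
qed

subsection \<open>The generating function of component sizes\<close>

text \<open>Follows the path from \<open>v\<close> to its other end \<open>w\<close> through
  \<open>i\<close> inner vertices. Their ordered choice from \<open>S2\<close> accounts for the
  change of factorial, and \<open>D w m\<close> is the normalised value of what remains with
  \<open>m\<close> vertices of degree two. Keeping \<open>D\<close> abstract lets the lemma serve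
  paths in \<open>wsum_eq\<close> and opened cycles in \<open>wsum_cycles\<close>.\<close>

lemma wsum_chain:
  assumes "finite S1" "finite S2" "S1 \<inter> S2 = {}" "even (card S1)" "v \<in> S1" "\<forall>x\<in>S2. s x = 1"
    and "\<And>w T. w \<in> S1 - {v} \<Longrightarrow> T \<subseteq> S2 \<Longrightarrow> wsum u s (S1 - {v} - {w}) T = fact (card T) * D w (card T)"
  shows "wsum u s S1 S2 = fact (card S2) *
    (\<Sum>w\<in>S1 - {v}. \<Sum>i\<le>card S2. u (s v + s w + i) * D w (card S2 - i))"
  using assms
proof (induction "card S2" arbitrary: S1 S2 v s)
  case 0
  then have "S2 = {}" by auto
  then show ?case using 0 by (subst wsum_leaf[where v = v]) auto
next
  case (Suc n S2 S1 v s)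
  note prems = Suc.prems
  let ?E = "\<lambda>w. \<Sum>i\<le>n. u (Suc (s v) + s w + i) * D w (n - i)"
  \<comment> \<open>After a move to \<open>x\<close> the walk continues from a leaf of size
    \<open>Suc (s v)\<close>. The value does not depend on \<open>x\<close>, so the choice of
    \<open>x\<close> only contributes the factor \<open>card S2\<close>.\<close>
  have step: "wsum u (s(x := s v + s x)) (insert x (S1 - {v})) (S2 - {x}) = fact n * (\<Sum>w\<in>S1 - {v}. ?E w)"
    if x: "x \<in> S2" for x
  proof -
    define s' where "s' = s(x := s v + s x)"
    have s'x: "s' x = Suc (s v)" using x prems by (simp add: s'_def)
    have n: "n = card (S2 - {x})" using x prems Suc.hyps by simp
    have x1: "x \<notin> S1" using x prems by auto
    then have S: "insert x (S1 - {v}) - {x} = S1 - {v}" by auto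
    have "wsum u s' (insert x (S1 - {v})) (S2 - {x}) = fact (card (S2 - {x})) *
      (\<Sum>w\<in>insert x (S1 - {v}) - {x}. \<Sum>i\<le>card (S2 - {x}). u (s' x + s' w + i) * D w (card (S2 - {x}) - i))"
    proof (rule Suc.hyps(1)[OF n])
      have "card (insert x (S1 - {v})) = Suc (card (S1 - {v}))"
        using prems x1 by (intro card_insert_disjoint) auto
      also have "\<dots> = card S1" using prems by (intro card_Suc_Diff1)
      finally show "even (card (insert x (S1 - {v})))" using prems by simp
      fix w T assume wT: "w \<in> insert x (S1 - {v}) - {x}" "T \<subseteq> S2 - {x}"
      have "finite T" using wT prems finite_subset by blast
      then have "wsum u s' (S1 - {v} - {w}) T = wsum u s (S1 - {v} - {w}) T"
        using prems wT x1 by (intro wsum_cong_size) (auto simp: s'_def)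
      also have "\<dots> = fact (card T) * D w (card T)" using wT by (intro prems(7)) auto
      finally show "wsum u s' (insert x (S1 - {v}) - {x} - {w}) T = fact (card T) * D w (card T)" by (simp only: S)
    qed (use prems x in \<open>auto simp: s'_def\<close>)
    also have "\<dots> = fact n * (\<Sum>w\<in>S1 - {v}. ?E w)"
      unfolding S n[symmetric] s'x
      by (intro arg_cong2[where f = "(*)"] refl sum.cong) (use x1 in \<open>auto simp: s'_def\<close>)
    finally show ?thesis unfolding s'_def .
  qed
  have "wsum u s S1 S2 = (\<Sum>w\<in>S1 - {v}. u (s v + s w) * (fact (card S2) * D w (card S2)))
    + of_nat (card S2) * (fact n * (\<Sum>w\<in>S1 - {v}. ?E w))"
  proof -
    have "(\<Sum>w\<in>S2. wsum u (s(w := s v + s w)) (insert w (S1 - {v})) (S2 - {w}))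
      = (\<Sum>w\<in>S2. fact n * (\<Sum>w\<in>S1 - {v}. ?E w))"
      by (intro sum.cong refl step)
    moreover have "(\<Sum>w\<in>S1 - {v}. u (s v + s w) * wsum u s (S1 - {v} - {w}) S2)
      = (\<Sum>w\<in>S1 - {v}. u (s v + s w) * (fact (card S2) * D w (card S2)))"
      using prems(7) by (intro sum.cong refl) auto
    ultimately show ?thesis
      unfolding wsum_leaf[OF prems(1-5)] by (simp only: sum_constant)
  qed
  also have "of_nat (card S2) * (fact n * (\<Sum>w\<in>S1 - {v}. ?E w)) = fact (Suc n) * (\<Sum>w\<in>S1 - {v}. ?E w)"
    by (simp add: Suc.hyps(2)[symmetric])
  also have "(\<Sum>w\<in>S1 - {v}. u (s v + s w) * (fact (card S2) * D w (card S2))) + fact (Suc n) * (\<Sum>w\<in>S1 - {v}. ?E w)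
    = fact (Suc n) * (\<Sum>w\<in>S1 - {v}. u (s v + s w) * D w (Suc n) + ?E w)"
    by (simp add: Suc.hyps(2)[symmetric] sum.distrib distrib_left sum_distrib_left mult_ac del: fact_Suc)
  \<comment> \<open>A path that ends at once is the term \<open>i = 0\<close>; the longer ones have
    their index shifted by one.\<close>
  also have "(\<Sum>w\<in>S1 - {v}. u (s v + s w) * D w (Suc n) + ?E w)
    = (\<Sum>w\<in>S1 - {v}. \<Sum>i\<le>Suc n. u (s v + s w + i) * D w (Suc n - i))"
    by (intro sum.cong refl) (simp add: sum.atMost_Suc_shift del: sum.atMost_Suc)
  finally show ?case by (simp only: Suc.hyps(2)[symmetric])
qed

text \<open>Were the two leaves separated, the component of \<open>v\<close> would consist of one
  vertex of degree 1 and otherwise vertices of degree 2, hence have odd degree sum.\<close>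

lemma leaves_connected:
  assumes "finite T" "v \<notin> T" "v' \<notin> T" "v \<noteq> v'" "mset xs = degree_mset {v, v'} T"
  shows "v' \<in> comp (pairs xs) v"
proof (rule ccontr)
  let ?C = "comp (pairs xs) v"
  assume "v' \<notin> ?C"
  have "length xs = 2 + 2 * card T"
    using assms(4) by (metis assms(5) size_degree_mset size_mset card_2_iff)
  then have ev: "even (length xs)" by simp
  have set: "set xs = {v, v'} \<union> T"
    using assms by (metis finite.emptyI finite_insert set_degree_mset set_mset_mset)
  have sub: "?C \<subseteq> {v, v'} \<union> T"
    by (rule comp_subset) (use edge_subset_pairs set in blast)+
  then have fin: "finite ?C" using assms(1) finite_subset by blast
  have "even (\<Sum>x\<in>?C. deg (pairs xs) x)"
    by (rule even_sum_deg_comp[OF _ fin]) (auto simp: size_edge_pairs)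
  also have "(\<Sum>x\<in>?C. deg (pairs xs) x) = deg (pairs xs) v + (\<Sum>x\<in>?C - {v}. deg (pairs xs) x)"
    using fin in_comp_self by (simp add: sum.remove)
  also have "deg (pairs xs) v = 1" using assms ev by (simp add: deg_pairs degree_mset_def)
  also have "(\<Sum>x\<in>?C - {v}. deg (pairs xs) x) = (\<Sum>x\<in>?C - {v}. 2)"
  proof (intro sum.cong refl)
    fix x assume "x \<in> ?C - {v}"
    with sub \<open>v' \<notin> ?C\<close> have "x \<in> T" "x \<noteq> v" "x \<noteq> v'" by auto
    then show "deg (pairs xs) x = 2" using assms ev by (simp add: deg_pairs degree_mset_def)
  qed
  finally show False by simp
qed

text \<open>A graph without leaves is cut open at a vertex: one of its two half-edges is moved to a new
  vertex of size zero.\<close>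
lemma wsum_cycle:
  fixes u :: "nat \<Rightarrow> 'a :: field_char_0"
  assumes "finite S" "v \<in> S" "v' \<notin> S"
  shows "wsum u s {} S = wsum u (s(v' := 0)) {v, v'} (S - {v}) / 2"
proof -
  let ?N = "degree_mset {} (S - {v})"
  let ?h = "\<lambda>x. if x = v' then v else x"
  have neq: "v \<noteq> v'" using assms by auto
  have M: "degree_mset {} S = add_mset v (add_mset v ?N)" "degree_mset {v, v'} (S - {v}) = add_mset v (add_mset v' ?N)"
    using assms neq by (auto simp: degree_mset_def multiset_eq_iff count_mset_set')
  have N: "v \<notin># ?N" "v' \<notin># ?N" using assms by (auto simp: degree_mset_def)
  have "ksum {v, v'} (S - {v}) (weight u (s(v' := 0)) ({v, v'} \<union> (S - {v})))
    = ksum {v, v'} (S - {v}) (\<lambda>G. weight u s S (image_mset (image_mset ?h) G))"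
  proof (rule ksum_cong)
    fix xs assume xs: "mset xs = degree_mset {v, v'} (S - {v})" "set xs = {v, v'} \<union> (S - {v})"
    have V: "{v, v'} \<union> (S - {v}) = insert v' S" using assms by auto
    show "weight u (s(v' := 0)) ({v, v'} \<union> (S - {v})) (pairs xs) = weight u s S (image_mset (image_mset ?h) (pairs xs))"
      unfolding V
    proof (rule weight_split[symmetric])
      show "\<forall>e\<in>#pairs xs. set_mset e \<subseteq> insert v' S" using edge_subset_pairs xs V by blast
      show "v' \<in> comp (pairs xs) v" by (rule leaves_connected[OF _ _ _ neq xs(1)]) (use assms in auto)
    qed (use assms in \<open>auto simp: size_edge_pairs\<close>)
  qed (use assms in auto)
  \<comment> \<open>Either of the two half-edges at \<open>v\<close> may be the one moved to
    \<open>v'\<close>, which is the source of the factor 2.\<close>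
  also have "\<dots> = 2 * ksum {} S (weight u s S)"
    unfolding ksum_def M psum_split[OF N neq] by simp
  finally show ?thesis by (simp add: wsum_def)
qed

text \<open>The coefficients of \<open>Q\<^sub>u\<close>.\<close>
fun cycle_coeff :: "(nat \<Rightarrow> 'a :: field_char_0) \<Rightarrow> nat \<Rightarrow> 'a" where
  "cycle_coeff u n = (if n = 0 then 1 else (\<Sum>j<n. u (n - j) * cycle_coeff u j) / (2 * of_nat n))"

declare cycle_coeff.simps [simp del]

definition path_fps :: "(nat \<Rightarrow> 'a :: field_char_0) \<Rightarrow> 'a fps" where
  "path_fps u = Abs_fps (\<lambda>i. u (i + 2))"

definition cycle_fps :: "(nat \<Rightarrow> 'a :: field_char_0) \<Rightarrow> 'a fps" where
  "cycle_fps u = Abs_fps (cycle_coeff u)"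

text \<open>The opened cycle is a path from \<open>v\<close> of size 1 to \<open>v'\<close> of size
  0, so with \<open>i\<close> inner vertices it has total size \<open>Suc i\<close>, and the rest is
  again leafless. The resulting recursion is 2 x Q' = (\<Sum>j\<ge>1. u j x^j) Q in coefficient
  form.\<close>

lemma wsum_cycles:
  fixes u :: "nat \<Rightarrow> 'a :: field_char_0"
  assumes "finite S"
  shows "wsum u (\<lambda>_. 1) {} S = fact (card S) * cycle_coeff u (card S)"
  using assms
proof (induction "card S" arbitrary: S rule: less_induct)
  case less
  show ?case
  proof (cases "S = {}")
    case True
    then show ?thesis
      by (simp add: wsum_def ksum_def degree_mset_def cycle_coeff.simps[of u 0])
  next
    case False
    then obtain v where v: "v \<in> S" by auto
    obtain v' where v': "v' \<notin> S" using less.prems ex_new_if_finite infinite_UNIV_nat by blast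
    have neq: "v \<noteq> v'" using v v' by auto
    define n where "n = card (S - {v})"
    have n: "card S = Suc n" unfolding n_def using card_Suc_Diff1[OF less.prems v] ..
    have S: "{v, v'} - {v} = {v'}" using neq by auto
    have "wsum u ((\<lambda>_. 1)(v' := 0)) {v, v'} (S - {v}) = fact (card (S - {v})) *
      (\<Sum>w\<in>{v, v'} - {v}. \<Sum>i\<le>card (S - {v}). u (((\<lambda>_. 1)(v' := 0)) v + ((\<lambda>_. 1)(v' := 0)) w + i) * cycle_coeff u (card (S - {v}) - i))"
    proof (rule wsum_chain)
      fix w T assume w: "w \<in> {v, v'} - {v}" and T: "T \<subseteq> S - {v}"
      have fin: "finite T" using T less.prems finite_subset by blast
      have "{v, v'} - {v} - {w} = {}" using w by blast
      moreover have "wsum u ((\<lambda>_. 1)(v' := 0)) {} T = wsum u (\<lambda>_. 1) {} T"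
        using T fin v' by (intro wsum_cong_size) auto
      moreover have "card T < card S" using T v less.prems psubset_card_mono[of S T] by blast
      ultimately show "wsum u ((\<lambda>_. 1)(v' := 0)) ({v, v'} - {v} - {w}) T = fact (card T) * cycle_coeff u (card T)"
        using less.hyps[of T] fin by metis
    qed (use less.prems v v' neq in auto)
    also have "\<dots> = fact n * (\<Sum>i\<le>n. u (Suc i) * cycle_coeff u (n - i))"
      using neq by (simp add: S n_def[symmetric])
    also have "(\<Sum>i\<le>n. u (Suc i) * cycle_coeff u (n - i)) = (\<Sum>j<Suc n. u (Suc n - j) * cycle_coeff u j)"
      by (rule sum.reindex_bij_witness[where i = "\<lambda>j. n - j" and j = "\<lambda>i. n - i"]) (auto simp: Suc_diff_le)
    finally have W: "wsum u ((\<lambda>_. 1)(v' := 0)) {v, v'} (S - {v})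
      = fact n * (\<Sum>j<Suc n. u (Suc n - j) * cycle_coeff u j)" .
    have c: "cycle_coeff u (Suc n) = (\<Sum>j<Suc n. u (Suc n - j) * cycle_coeff u j) / (2 * of_nat (Suc n))"
      by (subst cycle_coeff.simps) simp
    have "fact (Suc n) * (X / (2 * of_nat (Suc n))) = fact n * X / 2" for X :: 'a
      by (simp add: field_simps del: of_nat_Suc)
    then show ?thesis
      unfolding wsum_cycle[OF less.prems v v'] W n c by simp
  qed
qed

text \<open>Removing the whole path at one leaf multiplies the series by \<open>path_fps u\<close>
  and gives one odd factor for the choice of the opposite leaf. Their product is the number of
  pairings of the \<open>2 * k\<close> leaves into path ends.\<close>

theorem wsum_eq:
  fixes u :: "nat \<Rightarrow> 'a :: field_char_0"
  assumes "finite S1" "finite S2" "S1 \<inter> S2 = {}" "card S1 = 2 * k"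
  shows "wsum u (\<lambda>_. 1) S1 S2 = (\<Prod>i<k. of_nat (2 * i + 1)) * fact (card S2) *
    fps_nth (path_fps u ^ k * cycle_fps u) (card S2)"
  using assms
proof (induction k arbitrary: S1 S2)
  case 0
  then show ?case using wsum_cycles[of S2 u] by (simp add: cycle_fps_def)
next
  case (Suc k)
  let ?c = "(\<Prod>i<k. of_nat (2 * i + 1)) :: 'a"
  have "S1 \<noteq> {}" using Suc.prems by auto
  then obtain v where v: "v \<in> S1" by auto
  have "wsum u (\<lambda>_. 1) S1 S2 = fact (card S2) *
    (\<Sum>w\<in>S1 - {v}. \<Sum>i\<le>card S2. u (1 + 1 + i) * (?c * fps_nth (path_fps u ^ k * cycle_fps u) (card S2 - i)))"
  proof (rule wsum_chain)
    fix w T assume w: "w \<in> S1 - {v}" and T: "T \<subseteq> S2"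
    have "card (S1 - {v} - {w}) = 2 * k" using w v Suc.prems by simp
    moreover have "finite T" "(S1 - {v} - {w}) \<inter> T = {}" using T Suc.prems finite_subset by blast+
    ultimately show "wsum u (\<lambda>_. 1) (S1 - {v} - {w}) T = fact (card T) * (?c * fps_nth (path_fps u ^ k * cycle_fps u) (card T))"
      using Suc.prems by (subst Suc.IH) auto
  qed (use Suc.prems v in auto)
  also have "\<dots> = fact (card S2) * (of_nat (card (S1 - {v})) * (?c * (\<Sum>i\<le>card S2. u (i + 2) * fps_nth (path_fps u ^ k * cycle_fps u) (card S2 - i))))"
    by (simp add: sum_distrib_left mult_ac)
  also have "card (S1 - {v}) = 2 * k + 1" using v Suc.prems by simp
  also have "(\<Sum>i\<le>card S2. u (i + 2) * fps_nth (path_fps u ^ k * cycle_fps u) (card S2 - i)) = fps_nth (path_fps u ^ Suc k * cycle_fps u) (card S2)"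
  proof -
    have "path_fps u ^ Suc k * cycle_fps u = path_fps u * (path_fps u ^ k * cycle_fps u)"
      by (simp add: mult.assoc)
    moreover have "fps_nth (path_fps u) i = u (i + 2)" for i by (simp add: path_fps_def)
    ultimately show ?thesis by (simp only: fps_mult_nth[of "path_fps u"] atLeast0AtMost)
  qed
  finally show ?case by (simp add: mult_ac)
qed

subsection \<open>The configuration model\<close>

lemma ex_pairs:
  assumes "\<forall>e\<in>#G. size e = 2"
  shows "\<exists>xs. even (length xs) \<and> pairs xs = G"
  using assms
proof (induction G)
  case (add e G)
  then obtain xs where "even (length xs)" "pairs xs = G" by auto
  moreover obtain a b where "e = {#a, b#}" using add.prems size_mset_eq_2E[of e] by auto
  ultimately have "even (length (a # b # xs)) \<and> pairs (a # b # xs) = add_mset e G" by simp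
  then show ?case by blast
qed (auto intro: exI[of _ "[]"])

definition leaf_sets :: "nat \<Rightarrow> nat \<Rightarrow> nat set set" where
  "leaf_sets n1 n2 = {S. S \<subseteq> {1..n1 + n2} \<and> card S = n1}"

lemma finite_leaf_sets: "finite (leaf_sets n1 n2)"
  unfolding leaf_sets_def by (rule finite_subset[of _ "Pow {1..n1 + n2}"]) auto

lemma card_leaf_sets: "card (leaf_sets n1 n2) = (n1 + n2) choose n1"
  unfolding leaf_sets_def by (subst n_subsets) auto

lemma leaf_setsD:
  assumes "S \<in> leaf_sets n1 n2"
  shows "finite S" "card S = n1" "card ({1..n1 + n2} - S) = n2" "S \<union> ({1..n1 + n2} - S) = {1..n1 + n2}"
proof -
  have S: "S \<subseteq> {1..n1 + n2}" "card S = n1" using assms by (auto simp: leaf_sets_def)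
  then show "finite S" "card S = n1" by (auto intro: finite_subset)
  with S show "card ({1..n1 + n2} - S) = n2" by (simp add: card_Diff_subset)
qed (use assms in \<open>auto simp: leaf_sets_def\<close>)

text \<open>The two degree classes are disjoint and together have \<open>n1 + n2\<close> elements,
  so they exhaust the vertex set; the half-edge multiset is therefore determined by the set of
  leaves.\<close>

lemma pairs_in_MG_iff:
  assumes "even (length xs)"
  shows "pairs xs \<in> MG n1 n2 \<longleftrightarrow> (\<exists>S\<in>leaf_sets n1 n2. mset xs = degree_mset S ({1..n1 + n2} - S))"
proof
  let ?V = "{1..n1 + n2}"
  assume "pairs xs \<in> MG n1 n2"
  then have e: "\<forall>e\<in>#pairs xs. set_mset e \<subseteq> ?V"
    and c: "card {v\<in>?V. count (mset xs) v = 1} = n1" "card {v\<in>?V. count (mset xs) v = 2} = n2"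
    using assms by (auto simp: MG_def deg_pairs)
  let ?S = "{v\<in>?V. count (mset xs) v = 1}" and ?T = "{v\<in>?V. count (mset xs) v = 2}"
  have "card (?S \<union> ?T) = card ?V" using c by (subst card_Un_disjoint) auto
  then have un: "?S \<union> ?T = ?V" by (intro card_subset_eq) auto
  have V: "set xs \<subseteq> ?V"
  proof -
    have "\<forall>e\<in>#H. set_mset e \<subseteq> ?V \<Longrightarrow> set_mset (sum_mset H) \<subseteq> ?V" for H :: "nat multiset multiset"
      by (induction H) auto
    from this[OF e] show ?thesis unfolding sum_mset_pairs[OF assms] by simp
  qed
  have S: "?S \<in> leaf_sets n1 n2" using c by (auto simp: leaf_sets_def)
  have "?S \<inter> ?T = {}" by auto
  with un have T: "?V - ?S = ?T" by blast
  have "mset xs = degree_mset ?S (?V - ?S)"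
  proof (rule multiset_eqI)
    fix v
    show "count (mset xs) v = count (degree_mset ?S (?V - ?S)) v"
    proof (cases "v \<in> ?V")
      case True
      then have "v \<in> ?S \<or> v \<in> ?T" using un by blast
      then show ?thesis unfolding T by (auto simp: degree_mset_def count_mset_set')
    next
      case False
      then have "count (mset xs) v = 0" using V by (meson count_mset_0_iff subsetD)
      then show ?thesis using False unfolding T by (auto simp: degree_mset_def count_mset_set')
    qed
  qed
  with S show "\<exists>S\<in>leaf_sets n1 n2. mset xs = degree_mset S (?V - S)" by blast
next
  let ?V = "{1..n1 + n2}"
  assume "\<exists>S\<in>leaf_sets n1 n2. mset xs = degree_mset S ({1..n1 + n2} - S)"
  then obtain S where S: "S \<in> leaf_sets n1 n2" and m: "mset xs = degree_mset S (?V - S)" by blast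
  note SD = leaf_setsD[OF S]
  have "set xs = ?V" using SD m by (metis finite_Diff finite_atLeastAtMost set_degree_mset set_mset_mset)
  then have "\<forall>e\<in>#pairs xs. size e = 2 \<and> set_mset e \<subseteq> ?V"
    using edge_subset_pairs size_edge_pairs by blast
  moreover have "{v\<in>?V. deg (pairs xs) v = 1} = S" "{v\<in>?V. deg (pairs xs) v = 2} = ?V - S"
    using S SD(1) assms by (auto simp: deg_pairs m degree_mset_def count_mset_set' leaf_sets_def)
  ultimately show "pairs xs \<in> MG n1 n2" using SD unfolding MG_def by simp
qed

definition MG_lists :: "nat \<Rightarrow> nat \<Rightarrow> nat list set" where
  "MG_lists n1 n2 = (\<Union>S\<in>leaf_sets n1 n2. permutations_of_multiset (degree_mset S ({1..n1 + n2} - S)))"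

lemma finite_MG_lists: "finite (MG_lists n1 n2)"
  by (auto simp: MG_lists_def finite_leaf_sets)

lemma length_MG_lists: "xs \<in> MG_lists n1 n2 \<Longrightarrow> length xs = n1 + 2 * n2"
  unfolding MG_lists_def using leaf_setsD(2,3) size_degree_mset
  by (auto dest!: permutations_of_multisetD simp del: One_nat_def simp flip: size_mset)

lemma set_MG_lists: "xs \<in> MG_lists n1 n2 \<Longrightarrow> set xs = {1..n1 + n2}"
proof -
  assume "xs \<in> MG_lists n1 n2"
  then obtain S where S: "S \<in> leaf_sets n1 n2" "mset xs = degree_mset S ({1..n1 + n2} - S)"
    by (auto simp: MG_lists_def dest: permutations_of_multisetD)
  then have "set_mset (mset xs) = S \<union> ({1..n1 + n2} - S)"
    using leaf_setsD(1) set_degree_mset by simp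
  then show "set xs = {1..n1 + n2}" unfolding leaf_setsD(4)[OF S(1)] by simp
qed

lemma mem_MG_lists_iff:
  assumes "even (length xs)"
  shows "xs \<in> MG_lists n1 n2 \<longleftrightarrow> pairs xs \<in> MG n1 n2"
  unfolding pairs_in_MG_iff[OF assms] MG_lists_def permutations_of_multiset_def by blast

lemma MG_eq_pairs:
  assumes "even n1"
  shows "MG n1 n2 = pairs ` MG_lists n1 n2"
proof (intro equalityI subsetI)
  fix G assume G: "G \<in> MG n1 n2"
  then obtain xs where "even (length xs)" "pairs xs = G" using ex_pairs[of G] by (auto simp: MG_def)
  then show "G \<in> pairs ` MG_lists n1 n2" using mem_MG_lists_iff G by blast
next
  fix G assume "G \<in> pairs ` MG_lists n1 n2"
  then obtain xs where "xs \<in> MG_lists n1 n2" "G = pairs xs" by blast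
  moreover from this have "even (length xs)" using length_MG_lists assms by simp
  ultimately show "G \<in> MG n1 n2" using mem_MG_lists_iff by blast
qed

lemma finite_MG: "even n1 \<Longrightarrow> finite (MG n1 n2)"
  by (simp add: MG_eq_pairs finite_MG_lists)

lemma size_MG: "even n1 \<Longrightarrow> G \<in> MG n1 n2 \<Longrightarrow> size G = n1 div 2 + n2"
  by (auto simp: MG_eq_pairs size_pairs length_MG_lists)

lemma seqv_MG:
  assumes "even n1" "G \<in> MG n1 n2"
  shows "seqv (n1 + n2) G = card {xs \<in> MG_lists n1 n2. pairs xs = G}"
proof -
  have "{xs. length xs = 2 * size G \<and> set xs \<subseteq> {1..n1 + n2} \<and>
      mset (map (\<lambda>i. {#xs ! (2*i), xs ! (2*i+1)#}) [0..<size G]) = G} = {xs \<in> MG_lists n1 n2. pairs xs = G}"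
    (is "?A = ?B")
  proof (intro equalityI subsetI)
    fix xs assume "xs \<in> ?A"
    then show "xs \<in> ?B" using pairs_eq_nth[of xs "size G"] mem_MG_lists_iff[of xs n1 n2] assms(2) by auto
  next
    fix xs assume "xs \<in> ?B"
    then show "xs \<in> ?A"
      using pairs_eq_nth[of xs "size G"] assms size_MG[OF assms] length_MG_lists[of xs n1 n2] set_MG_lists[of xs n1 n2]
      by auto
  qed
  then show ?thesis by (simp add: seqv_def)
qed

text \<open>All graphs in question have the same number of edges, so \<open>kappa\<close> has a
  common denominator. Its numerators count lists, which can be grouped by their graph or, for the
  right-hand side, by their set of leaves.\<close>

lemma sum_kappa_MG:
  fixes F :: "nat multiset multiset \<Rightarrow> 'a :: {field_char_0, real_field}"
  assumes "even n1"
  shows "(\<Sum>G\<in>MG n1 n2. of_real (kappa (n1 + n2) G) * F G) = (\<Sum>S\<in>leaf_sets n1 n2. ksum S ({1..n1 + n2} - S) F)"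
proof -
  let ?V = "{1..n1 + n2}"
  let ?m = "n1 div 2 + n2"
  have "(\<Sum>G\<in>MG n1 n2. of_real (kappa (n1 + n2) G) * F G)
    = (\<Sum>G\<in>MG n1 n2. \<Sum>xs\<in>{xs \<in> MG_lists n1 n2. pairs xs = G}. F (pairs xs)) / (2 ^ ?m * fact ?m)"
    unfolding sum_divide_distrib
    by (intro sum.cong refl) (simp add: kappa_def seqv_MG[OF assms] size_MG[OF assms] of_real_divide)
  also have "(\<Sum>G\<in>MG n1 n2. \<Sum>xs\<in>{xs \<in> MG_lists n1 n2. pairs xs = G}. F (pairs xs)) = (\<Sum>xs\<in>MG_lists n1 n2. F (pairs xs))"
    by (intro sum.group) (auto simp: finite_MG_lists finite_MG assms MG_eq_pairs)
  also have "\<dots> = (\<Sum>S\<in>leaf_sets n1 n2. psum (degree_mset S (?V - S)) F)"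
    unfolding MG_lists_def psum_def
  \<comment> \<open>The leaf set can be read off a list as the vertices of multiplicity one, so
    different leaf sets give disjoint sets of lists.\<close>
  proof (rule sum.UNION_disjoint)
    show "\<forall>S\<in>leaf_sets n1 n2. \<forall>T\<in>leaf_sets n1 n2. S \<noteq> T \<longrightarrow>
      permutations_of_multiset (degree_mset S (?V - S)) \<inter> permutations_of_multiset (degree_mset T (?V - T)) = {}"
    proof (intro ballI impI, rule ccontr)
      fix S T assume *: "S \<in> leaf_sets n1 n2" "T \<in> leaf_sets n1 n2" "S \<noteq> T"
        "permutations_of_multiset (degree_mset S (?V - S)) \<inter> permutations_of_multiset (degree_mset T (?V - T)) \<noteq> {}"
      then have eq: "degree_mset S (?V - S) = degree_mset T (?V - T)"
        by (auto dest!: permutations_of_multisetD)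
      have "S = {v. count (degree_mset S (?V - S)) v = 1}" if "S \<in> leaf_sets n1 n2" for S
        using leaf_setsD[OF that] by (auto simp: degree_mset_def count_mset_set' split: if_splits)
      from this[OF *(1)] this[OF *(2)] eq *(3) show False by simp
    qed
  qed (auto simp: finite_leaf_sets)
  also have "\<dots> / (2 ^ ?m * fact ?m) = (\<Sum>S\<in>leaf_sets n1 n2. ksum S (?V - S) F)"
    unfolding sum_divide_distrib ksum_def
    by (intro sum.cong refl) (use assms in \<open>simp add: size_degree_mset leaf_setsD del: One_nat_def\<close>)
  finally show ?thesis .
qed

definition comp_coeff :: "(nat \<Rightarrow> 'a :: field_char_0) \<Rightarrow> nat \<Rightarrow> nat \<Rightarrow> 'a" where
  "comp_coeff u k n = fps_nth (path_fps u ^ k * cycle_fps u) n"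

text \<open>Every leaf set contributes equally, since \<open>wsum_eq\<close> depends on
  cardinalities alone. Only \<open>comp_coeff\<close> involves \<open>u\<close>, and the other
  factors cancel against the normalising constant.\<close>

lemma sum_kappa_weight:
  fixes u :: "nat \<Rightarrow> 'a :: {field_char_0, real_field}"
  shows "(\<Sum>G\<in>MG (2 * k) n. of_real (kappa (2 * k + n) G) * (\<Prod>C\<in>components (2 * k + n) G. u (card C)))
    = of_nat ((2 * k + n) choose (2 * k)) * (\<Prod>i<k. of_nat (2 * i + 1)) * fact n * comp_coeff u k n"
proof -
  let ?V = "{1..2 * k + n}"
  have "(\<Prod>C\<in>components (2 * k + n) G. u (card C)) = weight u (\<lambda>_. 1) ?V G" for G
    by (simp add: components_def weight_def)
  then have "(\<Sum>G\<in>MG (2 * k) n. of_real (kappa (2 * k + n) G) * (\<Prod>C\<in>components (2 * k + n) G. u (card C)))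
    = (\<Sum>S\<in>leaf_sets (2 * k) n. ksum S (?V - S) (weight u (\<lambda>_. 1) ?V))"
    by (simp add: sum_kappa_MG)
  also have "\<dots> = (\<Sum>S\<in>leaf_sets (2 * k) n. wsum u (\<lambda>_. 1) S (?V - S))"
    unfolding wsum_def by (intro sum.cong refl) (simp only: leaf_setsD(4))
  also have "\<dots> = (\<Sum>S\<in>leaf_sets (2 * k) n. (\<Prod>i<k. of_nat (2 * i + 1)) * fact n * comp_coeff u k n)"
    by (intro sum.cong refl) (subst wsum_eq[where k = k], auto simp: leaf_setsD comp_coeff_def simp del: One_nat_def)
  finally show ?thesis by (simp add: card_leaf_sets mult.assoc)
qed

lemma sum_kappa:
  "(\<Sum>G\<in>MG (2 * k) n. kappa (2 * k + n) G)
    = of_nat ((2 * k + n) choose (2 * k)) * (\<Prod>i<k. of_nat (2 * i + 1)) * fact n * comp_coeff (\<lambda>_. 1) k n"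
  using sum_kappa_weight[of k n "\<lambda>_. 1 :: real"] by simp

lemma cycle_coeff_pos: "cycle_coeff (\<lambda>_. 1 :: real) n > 0"
proof (induction n rule: less_induct)
  case (less n)
  show ?case
  proof (cases "n = 0")
    case False
    then have "(\<Sum>j<n. cycle_coeff (\<lambda>_. 1 :: real) j) > 0" using less by (intro sum_pos) auto
    with False show ?thesis by (subst cycle_coeff.simps) simp
  qed (simp add: cycle_coeff.simps)
qed

lemma comp_coeff_pos: "comp_coeff (\<lambda>_. 1 :: real) k n > 0"
  unfolding comp_coeff_def
proof (induction k arbitrary: n)
  case (Suc k)
  then show ?case
    by (simp only: power_Suc mult.assoc fps_mult_nth[of "path_fps _"])
       (auto simp: path_fps_def intro!: sum_pos)
qed (simp add: cycle_fps_def cycle_coeff_pos)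

text \<open>Makes the normalising constant of \<open>CM\<close> nonzero, so that
  \<open>embed_pmf\<close> returns the intended masses.\<close>

lemma sum_kappa_pos: "(\<Sum>G\<in>MG (2 * k) n. kappa (2 * k + n) G) > 0"
  unfolding sum_kappa by (intro mult_pos_pos comp_coeff_pos prod_pos) auto

lemma pmf_CM: "pmf (CM (2 * k) n) G = (if G \<in> MG (2 * k) n
      then kappa (2 * k + n) G / (\<Sum>H\<in>MG (2 * k) n. kappa (2 * k + n) H) else 0)"
  unfolding CM_def
proof (rule pmf_embed_pmf)
  let ?Z = "\<Sum>H\<in>MG (2 * k) n. kappa (2 * k + n) H"
  let ?p = "\<lambda>G. if G \<in> MG (2 * k) n then kappa (2 * k + n) G / ?Z else 0"
  show nn: "?p G \<ge> 0" for G
    using sum_kappa_pos[of k n] by (simp add: kappa_def)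
  have "(\<integral>\<^sup>+x. ennreal (?p x) \<partial>count_space UNIV) = (\<Sum>x\<in>MG (2 * k) n. ennreal (?p x))"
    by (rule nn_integral_count_space') (auto simp: finite_MG)
  also have "\<dots> = ennreal (\<Sum>x\<in>MG (2 * k) n. ?p x)"
    using nn by (intro sum_ennreal)
  also have "(\<Sum>x\<in>MG (2 * k) n. ?p x) = 1"
    using sum_kappa_pos[of k n] by (simp flip: sum_divide_distrib)
  finally show "(\<integral>\<^sup>+x. ennreal (?p x) \<partial>count_space UNIV) = 1" by simp
qed

lemma finite_set_pmf_CM: "finite (set_pmf (CM (2 * k) n))"
  by (rule finite_subset[OF _ finite_MG[of "2 * k" n]]) (auto simp: set_pmf_eq pmf_CM)

theorem expectation_CM_prod:
  fixes u :: "nat \<Rightarrow> 'a :: {real_normed_field, banach, second_countable_topology}"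
  shows "measure_pmf.expectation (CM (2 * k) n) (\<lambda>G. \<Prod>C\<in>components (2 * k + n) G. u (card C))
    = comp_coeff u k n / of_real (comp_coeff (\<lambda>_. 1) k n)"
proof -
  let ?Z = "\<Sum>H\<in>MG (2 * k) n. kappa (2 * k + n) H"
  let ?F = "\<lambda>G. \<Prod>C\<in>components (2 * k + n) G. u (card C)"
  have "measure_pmf.expectation (CM (2 * k) n) ?F = (\<Sum>G\<in>MG (2 * k) n. pmf (CM (2 * k) n) G *\<^sub>R ?F G)"
    by (rule integral_measure_pmf) (auto simp: finite_MG set_pmf_eq pmf_CM split: if_splits)
  also have "\<dots> = (\<Sum>G\<in>MG (2 * k) n. of_real (kappa (2 * k + n) G) * ?F G) / of_real ?Z"
    unfolding sum_divide_distrib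
    by (intro sum.cong refl) (simp add: pmf_CM scaleR_conv_of_real)
  also have "\<dots> = comp_coeff u k n / of_real (comp_coeff (\<lambda>_. 1) k n)"
  proof -
    have "(\<Prod>i<k. of_nat (2 * i + 1)) \<noteq> (0 :: 'a)" by (simp del: of_nat_Suc of_nat_add of_nat_mult)
    then show ?thesis
      unfolding sum_kappa_weight sum_kappa by (simp add: of_real_prod)
  qed
  finally show ?thesis .
qed

subsection \<open>Factorial moments\<close>

text \<open>Coefficientwise derivative of a series in a parameter. No convergence of the series
  enters, since each coefficient is differentiated on its own.\<close>

definition fps_has_deriv :: "(real \<Rightarrow> real fps) \<Rightarrow> real fps \<Rightarrow> real \<Rightarrow> bool" where
  "fps_has_deriv F F' y \<longleftrightarrow> (\<forall>n. ((\<lambda>z. fps_nth (F z) n) has_real_derivative fps_nth F' n) (at y))"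

lemma fps_has_derivD: "fps_has_deriv F F' y \<Longrightarrow> ((\<lambda>z. fps_nth (F z) n) has_real_derivative fps_nth F' n) (at y)"
  by (simp add: fps_has_deriv_def)

lemma fps_has_deriv_const: "fps_has_deriv (\<lambda>_. F) 0 y"
  by (simp add: fps_has_deriv_def)

lemma fps_has_deriv_add:
  "fps_has_deriv F F' y \<Longrightarrow> fps_has_deriv G G' y \<Longrightarrow> fps_has_deriv (\<lambda>z. F z + G z) (F' + G') y"
  by (auto simp: fps_has_deriv_def intro!: DERIV_add)

lemma fps_has_deriv_mult:
  assumes "fps_has_deriv F F' y" "fps_has_deriv G G' y"
  shows "fps_has_deriv (\<lambda>z. F z * G z) (F' * G y + F y * G') y"
  unfolding fps_has_deriv_def
proof
  fix n
  show "((\<lambda>z. fps_nth (F z * G z) n) has_real_derivative fps_nth (F' * G y + F y * G') n) (at y)"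
    unfolding fps_mult_nth fps_add_nth sum.distrib[symmetric]
    using assms by (auto intro!: derivative_eq_intros DERIV_sum simp: fps_has_deriv_def algebra_simps)
qed

lemma fps_has_deriv_power:
  assumes "fps_has_deriv F F' y"
  shows "fps_has_deriv (\<lambda>z. F z ^ k) (of_nat k * F' * F y ^ (k - 1)) y"
proof (induction k)
  case 0
  then show ?case using fps_has_deriv_const[of 1 y] by simp
next
  case (Suc k)
  have "F' * F y ^ k + F y * (of_nat k * F' * F y ^ (k - 1)) = of_nat (Suc k) * F' * F y ^ (Suc k - 1)"
    by (cases k) (simp_all add: algebra_simps)
  with fps_has_deriv_mult[OF assms Suc] show ?case by simp
qed

text \<open>The weight is \<open>1 + y\<close> so that derivatives at \<open>y = 0\<close> produce
  factorial moments of the number of components of size \<open>j\<close>.\<close>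

definition mark :: "nat \<Rightarrow> real \<Rightarrow> nat \<Rightarrow> real" where
  "mark j y i = (if i = j then 1 + y else 1)"

lemma mark_0: "mark j 0 = (\<lambda>_. 1)"
  by (simp add: mark_def fun_eq_iff)

lemma has_deriv_mark: "((\<lambda>z. mark j z i) has_real_derivative (if i = j then 1 else 0)) (at y)"
  by (cases "i = j") (auto simp: mark_def intro!: derivative_eq_intros)

text \<open>Coefficient form of dQ/dy = x^j / (2 j) Q, which is what the exponential formula for Q
  predicts; here it is derived from the recursion alone.\<close>

lemma has_deriv_cycle_coeff:
  assumes "j > 0"
  shows "((\<lambda>z. cycle_coeff (mark j z) n) has_real_derivative
    (if j \<le> n then cycle_coeff (mark j y) (n - j) / (2 * real j) else 0)) (at y)"
proof (induction n rule: less_induct)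
  case (less n)
  let ?c = "cycle_coeff (mark j y)"
  show ?case
  proof (cases "n = 0")
    case True
    then show ?thesis using assms by (simp add: cycle_coeff.simps[of _ 0])
  next
    case False
    have "((\<lambda>z. (\<Sum>i<n. mark j z (n - i) * cycle_coeff (mark j z) i) / (2 * real n)) has_real_derivative
      (\<Sum>i<n. (if n - i = j then 1 else 0) * ?c i +
        (if j \<le> i then ?c (i - j) / (2 * real j) else 0) * mark j y (n - i)) / (2 * real n)) (at y)"
      by (rule DERIV_cdivide, rule DERIV_sum, rule DERIV_mult, rule has_deriv_mark, rule less, simp)
    moreover have "(\<Sum>i<n. (if n - i = j then 1 else 0) * ?c i +
        (if j \<le> i then ?c (i - j) / (2 * real j) else 0) * mark j y (n - i)) / (2 * real n)
      = (if j \<le> n then ?c (n - j) / (2 * real j) else 0)"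
    proof (cases "j \<le> n")
      case True
      have "(\<Sum>i<n. (if n - i = j then 1 else 0) * ?c i) = (\<Sum>i<n. if i = n - j then ?c i else 0)"
        using True by (intro sum.cong) auto
      also have "\<dots> = ?c (n - j)" using True assms False by simp
      finally have 1: "(\<Sum>i<n. (if n - i = j then 1 else 0) * ?c i) = ?c (n - j)" .
      have "(\<Sum>i<n. (if j \<le> i then ?c (i - j) / (2 * real j) else 0) * mark j y (n - i))
        = (\<Sum>i\<in>{i. i < n \<and> j \<le> i}. mark j y (n - i) * ?c (i - j) / (2 * real j))"
        by (intro sum.mono_neutral_cong_right) auto
      also have "\<dots> = (\<Sum>l<n - j. mark j y (n - j - l) * ?c l / (2 * real j))"
        by (rule sum.reindex_bij_witness[where i = "\<lambda>l. l + j" and j = "\<lambda>i. i - j"]) auto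
      also have "\<dots> = (\<Sum>l<n - j. mark j y (n - j - l) * ?c l) / (2 * real j)"
        by (simp add: sum_divide_distrib)
      \<comment> \<open>The recursion at index \<open>n - j\<close> is read backwards; for
        \<open>n = j\<close> both sides are zero.\<close>
      also have "(\<Sum>l<n - j. mark j y (n - j - l) * ?c l) = 2 * real (n - j) * ?c (n - j)"
        by (subst (2) cycle_coeff.simps) simp
      finally show ?thesis
        using True assms False unfolding sum.distrib 1 by (simp add: field_simps)
    next
      case False
      then show ?thesis by (auto intro!: sum.neutral)
    qed
    ultimately show ?thesis using False by (subst cycle_coeff.simps) simp
  qed
qed

definition mark_fps :: "nat \<Rightarrow> nat \<Rightarrow> real \<Rightarrow> real fps" where
  "mark_fps j k y = path_fps (mark j y) ^ k * cycle_fps (mark j y)"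

text \<open>Derivative in \<open>y\<close> of \<open>path_fps (mark j y)\<close>. It vanishes for
  \<open>j < 2\<close> because a path contains its two leaves.\<close>

definition mark_fps' :: "nat \<Rightarrow> real fps" where
  "mark_fps' j = (if j \<ge> 2 then fps_X ^ (j - 2) else 0)"

text \<open>A marked component is one of the \<open>k\<close> paths, which leaves
  \<open>k - 1\<close> of them, or a cycle, which contributes \<open>1 / (2 * real j)\<close> and
  x^j.\<close>

lemma fps_has_deriv_mark:
  assumes "j > 0"
  shows "fps_has_deriv (mark_fps j k) (of_nat k * mark_fps' j * mark_fps j (k - 1) y
    + fps_const (1 / (2 * real j)) * fps_X ^ j * mark_fps j k y) y"
proof -
  have "fps_has_deriv (\<lambda>z. path_fps (mark j z)) (mark_fps' j) y"
  proof -
    have "fps_nth (mark_fps' j) n = (if n + 2 = j then 1 else 0)" for n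
      by (auto simp: mark_fps'_def)
    then show ?thesis
      unfolding fps_has_deriv_def path_fps_def fps_nth_Abs_fps using has_deriv_mark by presburger
  qed
  moreover have "fps_has_deriv (\<lambda>z. cycle_fps (mark j z)) (fps_const (1 / (2 * real j)) * fps_X ^ j * cycle_fps (mark j y)) y"
  proof -
    have "fps_nth (fps_const (1 / (2 * real j)) * fps_X ^ j * cycle_fps (mark j y)) n
      = (if j \<le> n then cycle_coeff (mark j y) (n - j) / (2 * real j) else 0)" for n
      by (simp add: fps_X_power_mult_nth mult.assoc cycle_fps_def)
    then show ?thesis
      using has_deriv_cycle_coeff[OF assms, of _ y] by (simp only: fps_has_deriv_def) (simp add: cycle_fps_def)
  qed
  ultimately have "fps_has_deriv (\<lambda>z. path_fps (mark j z) ^ k * cycle_fps (mark j z))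
     ((of_nat k * mark_fps' j * path_fps (mark j y) ^ (k - 1)) * cycle_fps (mark j y)
     + path_fps (mark j y) ^ k * (fps_const (1 / (2 * real j)) * fps_X ^ j * cycle_fps (mark j y))) y"
    by (intro fps_has_deriv_mult fps_has_deriv_power)
  then show ?thesis unfolding mark_fps_def by (simp add: algebra_simps)
qed

lemma finite_components: "finite (components N G)"
  by (simp add: components_def)

lemma expectation_CM_finite:
  fixes f :: "_ \<Rightarrow> real"
  shows "measure_pmf.expectation (CM (2 * k) n) f = (\<Sum>G\<in>set_pmf (CM (2 * k) n). pmf (CM (2 * k) n) G * f G)"
  by (subst integral_measure_pmf[OF finite_set_pmf_CM]) auto

lemma mark_fps_0: "fps_nth (mark_fps j k 0) n = comp_coeff (\<lambda>_. 1) k n"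
  by (simp add: mark_fps_def mark_0 comp_coeff_def)

lemma sum_pmf_mark:
  "(\<Sum>G\<in>set_pmf (CM (2 * k) n). pmf (CM (2 * k) n) G * (1 + y) ^ U (2 * k + n) j G)
    = fps_nth (mark_fps j k y) n / comp_coeff (\<lambda>_. 1) k n"
proof -
  have "(\<Prod>C\<in>components (2 * k + n) G. mark j y (card C)) = (1 + y) ^ U (2 * k + n) j G" for G
    unfolding mark_def U_def
    by (simp add: prod.If_cases[OF finite_components] Collect_conj_eq Int_commute)
  with expectation_CM_prod[of k n "mark j y"] show ?thesis
    by (simp add: expectation_CM_finite mark_fps_def comp_coeff_def)
qed

text \<open>The generating polynomial of the count is known both as a finite expectation and as a
  coefficient; uniqueness of the derivative equates the two derivatives.\<close>

lemma sum_pmf_mark_deriv: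
  assumes "j > 0"
  shows "(\<Sum>G\<in>set_pmf (CM (2 * k) n). pmf (CM (2 * k) n) G * (real (U (2 * k + n) j G) * (1 + y) ^ (U (2 * k + n) j G - 1)))
    = fps_nth (of_nat k * mark_fps' j * mark_fps j (k - 1) y
    + fps_const (1 / (2 * real j)) * fps_X ^ j * mark_fps j k y) n / comp_coeff (\<lambda>_. 1) k n"
proof (rule DERIV_unique)
  show "((\<lambda>y. \<Sum>G\<in>set_pmf (CM (2 * k) n). pmf (CM (2 * k) n) G * (1 + y) ^ U (2 * k + n) j G) has_real_derivative
    (\<Sum>G\<in>set_pmf (CM (2 * k) n). pmf (CM (2 * k) n) G * (real (U (2 * k + n) j G) * (1 + y) ^ (U (2 * k + n) j G - 1)))) (at y)"
    by (auto intro!: derivative_eq_intros sum.cong)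
  show "((\<lambda>y. \<Sum>G\<in>set_pmf (CM (2 * k) n). pmf (CM (2 * k) n) G * (1 + y) ^ U (2 * k + n) j G) has_real_derivative
    fps_nth (of_nat k * mark_fps' j * mark_fps j (k - 1) y
    + fps_const (1 / (2 * real j)) * fps_X ^ j * mark_fps j k y) n / comp_coeff (\<lambda>_. 1) k n) (at y)"
    unfolding sum_pmf_mark by (intro DERIV_cdivide fps_has_derivD fps_has_deriv_mark assms)
qed

lemma sum_pmf_mark_deriv2:
  fixes y :: real
  assumes "j > 0"
  defines "c \<equiv> fps_const (1 / (2 * real j)) * fps_X ^ j"
  shows "(\<Sum>G\<in>set_pmf (CM (2 * k) n). pmf (CM (2 * k) n) G * (real (U (2 * k + n) j G) * (real (U (2 * k + n) j G - 1) * (1 + y) ^ (U (2 * k + n) j G - 1 - 1))))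
    = fps_nth (of_nat (k * (k - 1)) * mark_fps' j ^ 2 * mark_fps j (k - 2) y
       + 2 * of_nat k * mark_fps' j * c * mark_fps j (k - 1) y + c ^ 2 * mark_fps j k y) n / comp_coeff (\<lambda>_. 1) k n"
proof (rule DERIV_unique)
  let ?f = "\<lambda>y. \<Sum>G\<in>set_pmf (CM (2 * k) n). pmf (CM (2 * k) n) G * (real (U (2 * k + n) j G) * (1 + y) ^ (U (2 * k + n) j G - 1))"
  show "(?f has_real_derivative (\<Sum>G\<in>set_pmf (CM (2 * k) n). pmf (CM (2 * k) n) G * (real (U (2 * k + n) j G) * (real (U (2 * k + n) j G - 1) * (1 + y) ^ (U (2 * k + n) j G - 1 - 1))))) (at y)"
    by (auto intro!: derivative_eq_intros sum.cong)
  have "fps_has_deriv (\<lambda>y. of_nat k * mark_fps' j * mark_fps j (k - 1) y + c * mark_fps j k y)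
     ((0 * mark_fps j (k - 1) y + of_nat k * mark_fps' j * (of_nat (k - 1) * mark_fps' j * mark_fps j (k - 1 - 1) y + c * mark_fps j (k - 1) y))
      + (0 * mark_fps j k y + c * (of_nat k * mark_fps' j * mark_fps j (k - 1) y + c * mark_fps j k y))) y"
    unfolding c_def
    by (intro fps_has_deriv_add fps_has_deriv_mult fps_has_deriv_const fps_has_deriv_mark assms)
  moreover have "(0 * X + K * m * (K1 * m * Y + c * X)) + (0 * Z + c * (K * m * X + c * Z))
      = K * K1 * m ^ 2 * Y + 2 * K * m * c * X + c ^ 2 * Z" for K K1 X Y Z m :: "real fps"
    by (simp add: algebra_simps power2_eq_square)
  moreover have "k - 1 - 1 = k - 2" by simp
  ultimately have "fps_has_deriv (\<lambda>y. of_nat k * mark_fps' j * mark_fps j (k - 1) y + c * mark_fps j k y)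
     (of_nat (k * (k - 1)) * mark_fps' j ^ 2 * mark_fps j (k - 2) y
       + 2 * of_nat k * mark_fps' j * c * mark_fps j (k - 1) y + c ^ 2 * mark_fps j k y) y"
    by (simp only: of_nat_mult)
  then show "(?f has_real_derivative fps_nth (of_nat (k * (k - 1)) * mark_fps' j ^ 2 * mark_fps j (k - 2) y
       + 2 * of_nat k * mark_fps' j * c * mark_fps j (k - 1) y + c ^ 2 * mark_fps j k y) n / comp_coeff (\<lambda>_. 1) k n) (at y)"
    unfolding sum_pmf_mark_deriv[OF assms(1)] c_def[symmetric] by (intro DERIV_cdivide fps_has_derivD)
qed

text \<open>The truncated difference \<open>k - l\<close> is harmless: for \<open>k < l\<close> the moment formulas below carry a vanishing factor.\<close>
definition coeff_ratio :: "nat \<Rightarrow> nat \<Rightarrow> nat \<Rightarrow> nat \<Rightarrow> real" where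
  "coeff_ratio k n l i = (if n < i then 0 else comp_coeff (\<lambda>_. 1) (k - l) (n - i)) / comp_coeff (\<lambda>_. 1) k n"

lemma expectation_U:
  assumes "j > 0"
  shows "measure_pmf.expectation (CM (2 * k) n) (\<lambda>G. real (U (2 * k + n) j G))
    = (if j \<ge> 2 then k * coeff_ratio k n 1 (j - 2) else 0) + coeff_ratio k n 0 j * (1 / (2 * real j))"
proof -
  have "fps_nth (of_nat k * fps_X ^ (j - 2) * mark_fps j (k - 1) 0) n
    = (if n < j - 2 then 0 else k * comp_coeff (\<lambda>_. 1) (k - 1) (n - (j - 2)))"
    by (simp add: mult.assoc fps_X_power_mult_nth mark_fps_0 flip: fps_of_nat)
  then show ?thesis
    using sum_pmf_mark_deriv[OF assms, of k n 0]
    by (simp add: expectation_CM_finite mark_fps'_def coeff_ratio_def mult.assoc fps_X_power_mult_nth mark_fps_0 add_divide_distrib)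
qed

text \<open>The terms correspond to ordered pairs of distinct components of size \<open>j\<close>:
  two paths, a path and a cycle in either order, and two cycles.\<close>

lemma expectation_U_falling:
  assumes "j > 0"
  shows "measure_pmf.expectation (CM (2 * k) n) (\<lambda>G. real (U (2 * k + n) j G) * (real (U (2 * k + n) j G) - 1))
    = (if j \<ge> 2 then k * (real k - 1) * coeff_ratio k n 2 (2 * (j - 2)) + k * (coeff_ratio k n 1 (2 * j - 2) * (1 / real j)) else 0)
       + coeff_ratio k n 0 (2 * j) * (1 / (4 * real j ^ 2))"
proof -
  let ?c = "fps_const (1 / (2 * real j)) * fps_X ^ j"
  have 1: "fps_nth (of_nat (k * (k - 1)) * (fps_X ^ (j - 2)) ^ 2 * mark_fps j (k - 2) 0) n / comp_coeff (\<lambda>_. 1) k n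
    = k * (real k - 1) * coeff_ratio k n 2 (2 * (j - 2))"
  proof -
    have "of_nat (k * (k - 1)) = fps_const (real k * (real k - 1))"
      by (cases k) (simp_all add: fps_of_nat[symmetric] del: of_nat_Suc of_nat_mult, simp add: algebra_simps)
    then show ?thesis
      unfolding power_mult[symmetric] coeff_ratio_def mult.commute[of "j - 2" 2]
      by (simp only: mult.assoc fps_mult_left_const_nth fps_X_power_mult_nth mark_fps_0) simp
  qed
  have A: "2 * of_nat k * fps_X ^ (j - 2) * ?c * mark_fps j (k - 1) 0
    = fps_const (k / j) * (fps_X ^ (j - 2 + j) * mark_fps j (k - 1) 0)"
  proof -
    have "2 * of_nat k * fps_const (1 / (2 * real j)) = fps_const (k / j)"
      by (simp add: fps_numeral_fps_const flip: fps_of_nat)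
    moreover have "A * x * (c * y) * M = (A * c) * (x * y * M)" for A x c y M :: "real fps"
      by (simp only: mult_ac)
    ultimately show ?thesis by (simp only: power_add)
  qed
  have 2: "fps_nth (2 * of_nat k * fps_X ^ (j - 2) * ?c * mark_fps j (k - 1) 0) n / comp_coeff (\<lambda>_. 1) k n
    = k * (coeff_ratio k n 1 (2 * j - 2) * (1 / real j))" if "j \<ge> 2"
  proof -
    have e: "j - 2 + j = 2 * j - 2" using that by simp
    show ?thesis
      unfolding A e fps_mult_left_const_nth fps_X_power_mult_nth mark_fps_0 coeff_ratio_def by simp
  qed
  have c2: "?c ^ 2 = fps_const (1 / (4 * real j ^ 2)) * fps_X ^ (2 * j)"
    by (simp add: power_mult_distrib power_mult[symmetric] mult.commute[of 2 j] fps_const_power power_divide)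
  have 3: "fps_nth (?c ^ 2 * mark_fps j k 0) n / comp_coeff (\<lambda>_. 1) k n = coeff_ratio k n 0 (2 * j) * (1 / (4 * real j ^ 2))"
    unfolding c2 mult.assoc fps_mult_left_const_nth fps_X_power_mult_nth mark_fps_0 coeff_ratio_def by simp
  have "real m * (real m - 1) = real m * real (m - 1)" for m by (cases m) auto
  then have "measure_pmf.expectation (CM (2 * k) n) (\<lambda>G. real (U (2 * k + n) j G) * (real (U (2 * k + n) j G) - 1))
    = fps_nth (of_nat (k * (k - 1)) * mark_fps' j ^ 2 * mark_fps j (k - 2) 0
       + 2 * of_nat k * mark_fps' j * ?c * mark_fps j (k - 1) 0 + ?c ^ 2 * mark_fps j k 0) n / comp_coeff (\<lambda>_. 1) k n"
    unfolding sum_pmf_mark_deriv2[OF assms, symmetric]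
    by (simp only: expectation_CM_finite) simp
  also have "\<dots> = fps_nth (of_nat (k * (k - 1)) * mark_fps' j ^ 2 * mark_fps j (k - 2) 0) n / comp_coeff (\<lambda>_. 1) k n
       + fps_nth (2 * of_nat k * mark_fps' j * ?c * mark_fps j (k - 1) 0) n / comp_coeff (\<lambda>_. 1) k n
       + fps_nth (?c ^ 2 * mark_fps j k 0) n / comp_coeff (\<lambda>_. 1) k n"
    by (simp only: fps_add_nth add_divide_distrib)
  finally have E: "measure_pmf.expectation (CM (2 * k) n) (\<lambda>G. real (U (2 * k + n) j G) * (real (U (2 * k + n) j G) - 1)) = \<dots>" .
  show ?thesis
  proof (cases "j \<ge> 2")
    case True
    then have m: "mark_fps' j = fps_X ^ (j - 2)" by (simp add: mark_fps'_def)
    show ?thesis unfolding E 3 m 1 2[OF True] by (simp only: True if_True)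
  next
    case False
    then have m: "mark_fps' j = 0" by (simp add: mark_fps'_def)
    show ?thesis unfolding E 3 m by (simp add: False)
  qed
qed

subsection \<open>Asymptotics of the moments\<close>

text \<open>Partial summation is multiplication by 1/(1-x), so this is (1-x)^(-a) / (1-x) =
  (1-x)^(-a-1) in coefficients.\<close>

lemma sum_pochhammer_fact:
  fixes a :: real
  shows "(\<Sum>i\<le>n. pochhammer a i / fact i) = pochhammer (a + 1) n / fact n"
proof (induction n)
  case (Suc n)
  have "pochhammer (a + 1) n / fact n + pochhammer a (Suc n) / fact (Suc n)
    = (real (Suc n) * pochhammer (a + 1) n + pochhammer a (Suc n)) / fact (Suc n)"
    by (simp add: field_simps del: of_nat_Suc)
  also have "real (Suc n) * pochhammer (a + 1) n + pochhammer a (Suc n) = pochhammer (a + 1) (Suc n)"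
    unfolding pochhammer_rec[of a] pochhammer_rec'[of "a + 1"] by (simp add: algebra_simps)
  finally show ?case using Suc by simp
qed simp

lemma cycle_coeff_1: "cycle_coeff (\<lambda>_. 1 :: real) n = pochhammer (1/2) n / fact n"
proof (induction n rule: less_induct)
  case (less n)
  show ?case
  proof (cases n)
    case (Suc m)
    have "(\<Sum>j<n. cycle_coeff (\<lambda>_. 1 :: real) j) = (\<Sum>j\<le>m. pochhammer (1/2) j / fact j)"
      using less Suc by (simp add: lessThan_Suc_atMost)
    also have "\<dots> = pochhammer (1/2 + 1) m / fact m" by (rule sum_pochhammer_fact)
    finally have S: "(\<Sum>j<n. cycle_coeff (\<lambda>_. 1 :: real) j) = pochhammer (1/2 + 1) m / fact m" .
    have "cycle_coeff (\<lambda>_. 1 :: real) n = (\<Sum>j<n. cycle_coeff (\<lambda>_. 1 :: real) j) / (2 * real n)"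
      by (subst cycle_coeff.simps) (simp add: Suc)
    then show ?thesis
      unfolding S by (simp add: Suc pochhammer_rec field_simps del: of_nat_Suc)
  qed (simp add: cycle_coeff.simps)
qed

text \<open>With unit weights the path series is 1/(1-x), so each further path is one partial
  summation and raises the parameter 1/2 of the cycle series by one.\<close>

lemma comp_coeff_1: "comp_coeff (\<lambda>_. 1 :: real) k n = pochhammer (k + 1/2) n / fact n"
proof (induction k arbitrary: n)
  case 0
  then show ?case by (simp add: comp_coeff_def cycle_fps_def cycle_coeff_1)
next
  case (Suc k)
  have "comp_coeff (\<lambda>_. 1 :: real) (Suc k) n = fps_nth (path_fps (\<lambda>_. 1) * (path_fps (\<lambda>_. 1) ^ k * cycle_fps (\<lambda>_. 1))) n"
    by (simp add: comp_coeff_def mult.assoc)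
  also have "\<dots> = (\<Sum>i\<le>n. comp_coeff (\<lambda>_. 1) k (n - i))"
    unfolding fps_mult_nth[of "path_fps _"] by (simp add: path_fps_def comp_coeff_def atLeast0AtMost)
  also have "\<dots> = (\<Sum>i\<le>n. comp_coeff (\<lambda>_. 1) k i)"
    by (rule sum.reindex_bij_witness[where i = "\<lambda>i. n - i" and j = "\<lambda>i. n - i"]) auto
  finally show ?case by (simp add: Suc sum_pochhammer_fact add_ac)
qed

text \<open>Neighbouring coefficients differ by a rational factor. This step and its companion in
  \<open>k\<close> are iterated to evaluate \<open>coeff_ratio\<close>.\<close>

lemma comp_coeff_1_step_n:
  "comp_coeff (\<lambda>_. 1 :: real) k n = comp_coeff (\<lambda>_. 1) k (Suc n) * (Suc n / (k + n + 1/2))"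
  unfolding comp_coeff_1 pochhammer_rec'[of _ n]
proof -
  have "p / F = x * p / (s * F) * (s / x)" if "x \<noteq> 0" "s \<noteq> 0" "F \<noteq> 0" for p F s x :: real
    using that by (simp add: field_simps)
  from this[of "real k + real n + 1/2" "real (Suc n)" "fact n" "pochhammer (real k + 1/2) n"]
  show "pochhammer (real k + 1/2) n / fact n = (real k + 1/2 + real n) * pochhammer (real k + 1/2) n / fact (Suc n) * (real (Suc n) / (real k + real n + 1/2))"
    by (simp add: add_ac)
qed

lemma comp_coeff_1_step_k:
  "comp_coeff (\<lambda>_. 1 :: real) k n = comp_coeff (\<lambda>_. 1) (Suc k) n * ((k + 1/2) / (k + n + 1/2))"
proof -
  have "pochhammer (real k + 1/2) n * (real k + 1/2 + real n) = (real k + 1/2) * pochhammer (real k + 1/2 + 1) n"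
    using pochhammer_rec[of "real k + 1/2" n] pochhammer_rec'[of "real k + 1/2" n] by (simp add: mult.commute)
  moreover have "real k + 1/2 + real n > 0" by simp
  moreover have "q / F = p / F * (y / x)" if "q * x = y * p" "x \<noteq> 0" for p q F x y :: real
    using that by (cases "F = 0") (simp_all add: field_simps)
  ultimately have "pochhammer (real k + 1/2) n / fact n
    = pochhammer (real k + 1/2 + 1) n / fact n * ((real k + 1/2) / (real k + 1/2 + real n))" by (metis less_irrefl)
  then show ?thesis by (simp add: comp_coeff_1 add_ac)
qed

text \<open>Convergence at rate 1/k. Mere convergence would be too weak for the variance, where a
  difference of two such quantities is multiplied by k^2.\<close>

definition near :: "(nat \<Rightarrow> real) \<Rightarrow> real \<Rightarrow> bool" where
  "near f L \<longleftrightarrow> (\<lambda>k. f k - L) \<in> O(\<lambda>k. 1 / real k)"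

lemma near_const: "near (\<lambda>_. c) c"
  by (simp add: near_def)

lemma near_imp_bounded: "near f L \<Longrightarrow> f \<in> O(\<lambda>_. 1)"
proof -
  assume "near f L"
  then have "(\<lambda>k. f k - L) \<in> O(\<lambda>k. 1 / real k)" by (simp add: near_def)
  also have "(\<lambda>k. 1 / real k) \<in> O(\<lambda>_. 1)" by real_asymp
  finally have "(\<lambda>k. (f k - L) + L) \<in> O(\<lambda>_. 1)" by (rule sum_in_bigo(1)) auto
  then show ?thesis by simp
qed

lemma near_mult:
  assumes "near f L" "near g M"
  shows "near (\<lambda>k. f k * g k) (L * M)"
proof -
  have "(\<lambda>k. f k * (g k - M)) \<in> O(\<lambda>k. 1 * (1 / real k))"
    using assms near_imp_bounded by (intro landau_o.big.mult) (auto simp: near_def)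
  moreover have "(\<lambda>k. M * (f k - L)) \<in> O(\<lambda>k. 1 / real k)"
    using assms by (auto simp: near_def)
  ultimately have "(\<lambda>k. f k * (g k - M) + M * (f k - L)) \<in> O(\<lambda>k. 1 / real k)"
    by (intro sum_in_bigo) auto
  then show ?thesis by (simp add: near_def algebra_simps)
qed

lemma near_cong: "near f L \<Longrightarrow> eventually (\<lambda>k. f k = g k) sequentially \<Longrightarrow> near g L"
  unfolding near_def by (subst landau_o.big.in_cong[of _ "\<lambda>k. f k - L"]) (auto elim: eventually_mono)

lemma nearI:
  assumes "eventually (\<lambda>k. \<bar>f k - L\<bar> \<le> C / real k) sequentially"
  shows "near f L"
  unfolding near_def by (rule bigoI[of _ C]) (use assms in \<open>auto elim!: eventually_mono\<close>)

lemma near_tendsto: "near f L \<Longrightarrow> f \<longlonglongrightarrow> L"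
proof -
  assume "near f L"
  then have "(\<lambda>k. f k - L) \<in> O(\<lambda>k. 1 / real k)" by (simp add: near_def)
  also have "(\<lambda>k. 1 / real k) \<in> o(\<lambda>_. 1)" by real_asymp
  finally have "(\<lambda>k. f k - L) \<longlonglongrightarrow> 0" by (auto dest: smalloD_tendsto)
  then show ?thesis by (simp add: LIM_zero_iff)
qed

lemma variance_CM:
  fixes X :: "nat multiset multiset \<Rightarrow> real"
  shows "measure_pmf.variance (CM (2 * k) n) X = measure_pmf.expectation (CM (2 * k) n) (\<lambda>G. X G * (X G - 1))
     + measure_pmf.expectation (CM (2 * k) n) X - (measure_pmf.expectation (CM (2 * k) n) X)\<^sup>2"
proof -
  have int: "integrable (measure_pmf (CM (2 * k) n)) f" for f :: "nat multiset multiset \<Rightarrow> real"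
    by (rule integrable_measure_pmf_finite[OF finite_set_pmf_CM])
  have "measure_pmf.variance (CM (2 * k) n) X = measure_pmf.expectation (CM (2 * k) n) (\<lambda>G. (X G)\<^sup>2) - (measure_pmf.expectation (CM (2 * k) n) X)\<^sup>2"
    by (intro measure_pmf.variance_eq int)
  also have "measure_pmf.expectation (CM (2 * k) n) (\<lambda>G. (X G)\<^sup>2)
    = measure_pmf.expectation (CM (2 * k) n) (\<lambda>G. X G * (X G - 1) + X G)"
    by (intro Bochner_Integration.integral_cong) (auto simp: power2_eq_square algebra_simps)
  also have "\<dots> = measure_pmf.expectation (CM (2 * k) n) (\<lambda>G. X G * (X G - 1)) + measure_pmf.expectation (CM (2 * k) n) X"
    by (intro Bochner_Integration.integral_add int)
  finally show ?thesis .
qed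

section \<open>Mean and variance along the prescribed ratio of degrees\<close>

context
  fixes \<alpha> :: real and n2 :: "nat \<Rightarrow> nat"
  assumes \<alpha>: "\<alpha> > 0"
  defines "n2 \<equiv> \<lambda>k. nat \<lfloor>\<alpha> * real k\<rfloor>"
begin

lemma n2_bounds: "real (n2 k) \<le> \<alpha> * k" "\<alpha> * k - 1 \<le> real (n2 k)"
proof -
  have "\<alpha> * k \<ge> 0" using \<alpha> by simp
  then have "real (n2 k) = of_int \<lfloor>\<alpha> * k\<rfloor>" unfolding n2_def by (simp add: of_nat_nat)
  then show "real (n2 k) \<le> \<alpha> * k" "\<alpha> * k - 1 \<le> real (n2 k)" by linarith+
qed

lemma filterlim_n2: "filterlim n2 at_top sequentially"
proof -
  have "filterlim (\<lambda>k. \<alpha> * real k - 1) at_top sequentially" using \<alpha> by real_asymp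
  then have "\<forall>\<^sub>F k in sequentially. real Z \<le> \<alpha> * real k - 1" for Z by (simp add: filterlim_at_top)
  then have "\<forall>\<^sub>F k in sequentially. Z \<le> n2 k" for Z
    by (rule eventually_mono) (use n2_bounds(2) order_trans of_nat_le_iff in blast)
  then show ?thesis by (simp add: filterlim_at_top)
qed

text \<open>Covers both step factors: the coefficients of \<open>n2 k\<close> and \<open>k\<close>
  are 0 and 1 when \<open>k\<close> is lowered, 1 and 0 when \<open>n\<close> is lowered. Over a
  common denominator the terms linear in \<open>k\<close> cancel, and the rounding error
  \<open>e\<close> of the floor is at most 1, so the numerator stays bounded.\<close>

lemma near_quotient:
  fixes a b c1 c2 :: real
  assumes "c1 + c2 = 1"
  shows "near (\<lambda>k. (c1 * n2 k + c2 * k + a) / (real k + real (n2 k) + b)) ((c1 * \<alpha> + c2) / (1 + \<alpha>))"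
proof (rule nearI)
  define C where "C = \<bar>c1\<bar> * (1 + \<alpha>) + \<bar>c1 * \<alpha> + c2\<bar> + \<bar>a\<bar> * (1 + \<alpha>) + \<bar>b\<bar> * \<bar>c1 * \<alpha> + c2\<bar>"
  have "eventually (\<lambda>k. real k > 2 * \<bar>b\<bar>) sequentially" by real_asymp
  then show "\<forall>\<^sub>F k in sequentially. \<bar>(c1 * n2 k + c2 * k + a) / (real k + real (n2 k) + b) - (c1 * \<alpha> + c2) / (1 + \<alpha>)\<bar> \<le> 2 * C / real k"
  proof eventually_elim
    case (elim k)
    define e where "e = n2 k - \<alpha> * k"
    have e: "\<bar>e\<bar> \<le> 1" using n2_bounds[of k] by (auto simp: e_def)
    have k: "real k > 0" using elim by (meson abs_ge_zero le_less_trans mult_nonneg_nonneg zero_le_numeral)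
    have d: "real k + real (n2 k) + b \<ge> k / 2" "real k + real (n2 k) + b > 0" using elim k by auto
    have n: "real (n2 k) = \<alpha> * k + e" by (simp add: e_def)
    have "(c1 * n2 k + c2 * k + a) / (real k + real (n2 k) + b) - (c1 * \<alpha> + c2) / (1 + \<alpha>)
      = ((c1 * real (n2 k) + c2 * real k + a) * (1 + \<alpha>) - (c1 * \<alpha> + c2) * (real k + real (n2 k) + b)) / ((real k + real (n2 k) + b) * (1 + \<alpha>))"
      using d(2) \<alpha> by (subst diff_frac_eq) auto
    also have "(c1 * n2 k + c2 * k + a) * (1 + \<alpha>) - (c1 * \<alpha> + c2) * (real k + real (n2 k) + b)
      = c1 * e * (1 + \<alpha>) - (c1 * \<alpha> + c2) * e + a * (1 + \<alpha>) - b * (c1 * \<alpha> + c2)"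
      unfolding n by (simp add: algebra_simps)
    finally have eq: "(c1 * n2 k + c2 * k + a) / (real k + real (n2 k) + b) - (c1 * \<alpha> + c2) / (1 + \<alpha>)
      = (c1 * e * (1 + \<alpha>) - (c1 * \<alpha> + c2) * e + a * (1 + \<alpha>) - b * (c1 * \<alpha> + c2)) / ((real k + real (n2 k) + b) * (1 + \<alpha>))" .
    have "\<bar>c1 * e * (1 + \<alpha>) - (c1 * \<alpha> + c2) * e + a * (1 + \<alpha>) - b * (c1 * \<alpha> + c2)\<bar>
      \<le> \<bar>c1 * e * (1 + \<alpha>)\<bar> + \<bar>(c1 * \<alpha> + c2) * e\<bar> + \<bar>a * (1 + \<alpha>)\<bar> + \<bar>b * (c1 * \<alpha> + c2)\<bar>"
      by linarith
    also have "\<dots> \<le> C"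
    proof -
      have "\<bar>c1\<bar> * \<bar>e\<bar> * (1 + \<alpha>) \<le> \<bar>c1\<bar> * 1 * (1 + \<alpha>)" using e \<alpha> by (intro mult_right_mono mult_left_mono) auto
      moreover have "\<bar>c1 * \<alpha> + c2\<bar> * \<bar>e\<bar> \<le> \<bar>c1 * \<alpha> + c2\<bar> * 1" using e by (intro mult_left_mono) auto
      ultimately show ?thesis using \<alpha> unfolding C_def by (simp add: abs_mult)
    qed
    finally have num: "\<bar>c1 * e * (1 + \<alpha>) - (c1 * \<alpha> + c2) * e + a * (1 + \<alpha>) - b * (c1 * \<alpha> + c2)\<bar> \<le> C" .
    have "(k / 2) * 1 \<le> (real k + real (n2 k) + b) * (1 + \<alpha>)" using d k \<alpha> by (intro mult_mono) auto
    then have "\<bar>(c1 * n2 k + c2 * k + a) / (real k + real (n2 k) + b) - (c1 * \<alpha> + c2) / (1 + \<alpha>)\<bar> \<le> C / (k / 2)"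
      unfolding eq abs_divide using num d k \<alpha> by (intro frac_le) auto
    then show ?case by (simp add: mult.commute)
  qed
qed

text \<open>Each removed path costs a factor 1/(1+\<alpha>) in the limit and each removed vertex of
  degree two a factor \<alpha>/(1+\<alpha>). The outer induction removes vertices, the inner one
  paths.\<close>

lemma near_coeff_ratio: "near (\<lambda>k. coeff_ratio k (n2 k) l i) (\<alpha> ^ i / (1 + \<alpha>) ^ (l + i))"
proof (induction i)
  case 0
  show ?case
  proof (induction l)
    case 0
    have "comp_coeff (\<lambda>_. 1 :: real) k (n2 k) \<noteq> 0" for k using comp_coeff_pos less_imp_neq by metis
    then show ?case by (simp add: coeff_ratio_def near_const)
  next
    case (Suc l)
    have "near (\<lambda>k. coeff_ratio k (n2 k) l 0 * (((0::real) * real (n2 k) + 1 * real k + (- real l - 1/2)) / (real k + real (n2 k) + (- real l - 1/2))))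
      (\<alpha> ^ 0 / (1 + \<alpha>) ^ (l + 0) * ((0 * \<alpha> + 1) / (1 + \<alpha>)))"
      by (intro near_mult Suc near_quotient) auto
    \<comment> \<open>The step identity needs \<open>k - Suc l\<close> to be a genuine difference,
      so it holds only for large \<open>k\<close>.\<close>
    moreover have "eventually (\<lambda>k. coeff_ratio k (n2 k) l 0 * (((0::real) * real (n2 k) + 1 * real k + (- real l - 1/2)) / (real k + real (n2 k) + (- real l - 1/2)))
      = coeff_ratio k (n2 k) (Suc l) 0) sequentially"
      using eventually_ge_at_top[of "Suc l"]
    proof eventually_elim
      case (elim k)
      then have "Suc (k - Suc l) = k - l" by simp
      with elim comp_coeff_1_step_k[of "k - Suc l" "n2 k"] show ?case
        by (simp add: coeff_ratio_def of_nat_diff algebra_simps)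
    qed
    ultimately show ?case by (auto dest: near_cong simp: mult.commute)
  qed
next
  case (Suc i)
  have "near (\<lambda>k. coeff_ratio k (n2 k) l i * (((1::real) * real (n2 k) + 0 * real k + (- real i)) / (real k + real (n2 k) + (- real l - real i - 1/2))))
    (\<alpha> ^ i / (1 + \<alpha>) ^ (l + i) * ((1 * \<alpha> + 0) / (1 + \<alpha>)))"
    by (intro near_mult Suc near_quotient) auto
  moreover have "eventually (\<lambda>k. coeff_ratio k (n2 k) l i * (((1::real) * real (n2 k) + 0 * real k + (- real i)) / (real k + real (n2 k) + (- real l - real i - 1/2)))
      = coeff_ratio k (n2 k) l (Suc i)) sequentially"
    using eventually_ge_at_top[of l] filterlim_n2[unfolded filterlim_at_top, rule_format, of "Suc i"]
  proof eventually_elim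
    case (elim k)
    then have "Suc (n2 k - Suc i) = n2 k - i" by simp
    with elim comp_coeff_1_step_n[of "k - l" "n2 k - Suc i"] show ?case
      by (simp add: coeff_ratio_def of_nat_diff algebra_simps)
  qed
  ultimately show ?case by (auto dest: near_cong simp: mult.commute)
qed

text \<open>The error is kept at O(1), not o(k), so that centring at the limit value instead of the
  mean is harmless on the scale sqrt k.\<close>

lemma mean_U_near:
  assumes "j \<ge> 2"
  shows "(\<lambda>k. measure_pmf.expectation (CM (2 * k) (n2 k)) (\<lambda>G. real (U (2 * k + n2 k) j G))
      - \<alpha> ^ (j - 2) / (1 + \<alpha>) ^ (j - 1) * k) \<in> O(\<lambda>_. 1)"
proof -
  have e: "1 + (j - 2) = j - 1" using assms by simp
  have "(\<lambda>k. real k * (coeff_ratio k (n2 k) 1 (j - 2) - \<alpha> ^ (j - 2) / (1 + \<alpha>) ^ (j - 1))) \<in> O(\<lambda>k. real k * (1 / real k))"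
    using near_coeff_ratio[of 1 "j - 2"] unfolding near_def e by (intro landau_o.big.mult) auto
  also have "(\<lambda>k. real k * (1 / real k)) \<in> O(\<lambda>_. 1)" by real_asymp
  finally have "(\<lambda>k. real k * (coeff_ratio k (n2 k) 1 (j - 2) - \<alpha> ^ (j - 2) / (1 + \<alpha>) ^ (j - 1))
      + coeff_ratio k (n2 k) 0 j * (1 / (2 * real j))) \<in> O(\<lambda>_. 1)"
    by (rule sum_in_bigo(1)) (intro landau_o.big.mult_in_1 near_imp_bounded[OF near_coeff_ratio], simp)
  moreover have "measure_pmf.expectation (CM (2 * k) (n2 k)) (\<lambda>G. real (U (2 * k + n2 k) j G))
      - \<alpha> ^ (j - 2) / (1 + \<alpha>) ^ (j - 1) * k = real k * (coeff_ratio k (n2 k) 1 (j - 2) - \<alpha> ^ (j - 2) / (1 + \<alpha>) ^ (j - 1))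
      + coeff_ratio k (n2 k) 0 j * (1 / (2 * real j))" for k
  proof -
    have j: "j > 0" using assms by simp
    show ?thesis unfolding expectation_U[OF j] using assms by (simp add: right_diff_distrib)
  qed
  ultimately show ?thesis by presburger
qed

lemma mean_U:
  assumes "j \<ge> 2"
  shows "(\<lambda>k. measure_pmf.expectation (CM (2 * k) (n2 k)) (\<lambda>G. real (U (2 * k + n2 k) j G)))
    \<sim>[at_top] (\<lambda>k. \<alpha> ^ (j - 2) / (1 + \<alpha>) ^ (j - 1) * k)"
proof (rule smallo_imp_asymp_equiv)
  have "\<alpha> ^ (j - 2) / (1 + \<alpha>) ^ (j - 1) > 0" using \<alpha> by simp
  moreover have "(\<lambda>_. 1) \<in> o(\<lambda>k. c * real k)" if "c > 0" for c using that by real_asymp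
  ultimately have "(\<lambda>_. 1) \<in> o(\<lambda>k. \<alpha> ^ (j - 2) / (1 + \<alpha>) ^ (j - 1) * real k)" by blast
  with mean_U_near[OF assms] show "(\<lambda>k. measure_pmf.expectation (CM (2 * k) (n2 k)) (\<lambda>G. real (U (2 * k + n2 k) j G))
      - \<alpha> ^ (j - 2) / (1 + \<alpha>) ^ (j - 1) * k) \<in> o(\<lambda>k. \<alpha> ^ (j - 2) / (1 + \<alpha>) ^ (j - 1) * k)"
    using landau_o.big_small_trans by blast
qed

text \<open>The second factorial moment and the squared mean have leading terms k^2 times ratios
  with the same limit \<open>L * L\<close>. Both ratios are within O(1/k) of it, so the difference
  contributes only O(k).\<close>

lemma variance_U:
  assumes "j \<ge> 2"
  shows "(\<lambda>k. measure_pmf.variance (CM (2 * k) (n2 k)) (\<lambda>G. real (U (2 * k + n2 k) j G))) \<in> O(\<lambda>k. real k)"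
proof -
  define r where "r l i k = coeff_ratio k (n2 k) l i" for l i k
  define L where "L = \<alpha> ^ (j - 2) / (1 + \<alpha>) ^ (j - 1)"
  have near_r: "near (r l i) (\<alpha> ^ i / (1 + \<alpha>) ^ (l + i))" for l i
    unfolding r_def by (rule near_coeff_ratio)
  have bd: "r l i \<in> O(\<lambda>_. 1)" for l i by (rule near_imp_bounded[OF near_r])
  have "1 + (j - 2) = j - 1" "2 + 2 * (j - 2) = 2 * (j - 1)" using assms by auto
  moreover have "L * L = \<alpha> ^ (2 * (j - 2)) / (1 + \<alpha>) ^ (2 * (j - 1))"
    unfolding L_def mult.commute[of 2] power_mult by (simp add: power2_eq_square)
  ultimately have "near (r 2 (2 * (j - 2))) (L * L)" "near (\<lambda>k. r 1 (j - 2) k * r 1 (j - 2) k) (L * L)"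
    using near_r[of 2 "2 * (j - 2)"] near_mult[OF near_r near_r, of 1 "j - 2" 1 "j - 2"]
    by (simp_all only: L_def)
  then have "(\<lambda>k. (r 2 (2 * (j - 2)) k - L * L) - (r 1 (j - 2) k * r 1 (j - 2) k - L * L)) \<in> O(\<lambda>k. 1 / real k)"
    unfolding near_def by (rule sum_in_bigo)
  then have d: "(\<lambda>k. (real k * real k) * (r 2 (2 * (j - 2)) k - r 1 (j - 2) k * r 1 (j - 2) k)) \<in> O(\<lambda>k. (real k * real k) * (1 / real k))"
    by (intro landau_o.big.mult) auto
  have kk: "(\<lambda>k. (real k * real k) * (1 / real k)) \<in> O(\<lambda>k. real k)" by real_asymp
  have one: "(\<lambda>_. 1) \<in> O(\<lambda>k. real k)" by real_asymp
  have lin: "(\<lambda>k. real k * f k) \<in> O(\<lambda>k. real k)" if "f \<in> O(\<lambda>_. 1)" for f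
    using landau_o.big.mult[OF landau_o.big_refl[of "\<lambda>k. real k"] that] by simp
  have cst: "f \<in> O(\<lambda>k. real k)" if "f \<in> O(\<lambda>_. 1)" for f :: "nat \<Rightarrow> real"
    using that one landau_o.big_trans by blast
  have prod: "(\<lambda>k. f k * g k) \<in> O(\<lambda>_. 1)" if "f \<in> O(\<lambda>_. 1)" "g \<in> O(\<lambda>_. 1)" for f g :: "nat \<Rightarrow> real"
    using landau_o.big.mult[OF that] by simp
  \<comment> \<open>The variance, sorted by the explicit powers k^2, k and 1 in front of bounded
    ratios.\<close>
  have "(\<lambda>k. (real k * real k) * (r 2 (2 * (j - 2)) k - r 1 (j - 2) k * r 1 (j - 2) k)
     + (real k * (- r 2 (2 * (j - 2)) k + r 1 (2 * j - 2) k * (1 / real j) + r 1 (j - 2) k - r 1 (j - 2) k * (2 * (r 0 j k * (1 / (2 * real j)))))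
     + (r 0 (2 * j) k * (1 / (4 * real j ^ 2)) + r 0 j k * (1 / (2 * real j)) - (r 0 j k * (1 / (2 * real j))) * (r 0 j k * (1 / (2 * real j)))))) \<in> O(\<lambda>k. real k)"
  proof (rule sum_in_bigo(1)[OF landau_o.big_trans[OF d kk] sum_in_bigo(1)[OF lin cst]])
    have "(\<lambda>_. c) \<in> O(\<lambda>_. 1)" for c :: real by simp
    note intros = sum_in_bigo prod bd this landau_o.big.uminus_in_iff[THEN iffD2]
    show "(\<lambda>k. - r 2 (2 * (j - 2)) k + r 1 (2 * j - 2) k * (1 / real j) + r 1 (j - 2) k - r 1 (j - 2) k * (2 * (r 0 j k * (1 / (2 * real j))))) \<in> O(\<lambda>_. 1)"
      by (intro intros)
    show "(\<lambda>k. r 0 (2 * j) k * (1 / (4 * real j ^ 2)) + r 0 j k * (1 / (2 * real j)) - (r 0 j k * (1 / (2 * real j))) * (r 0 j k * (1 / (2 * real j)))) \<in> O(\<lambda>_. 1)"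
      by (intro intros)
  qed
  moreover have "measure_pmf.variance (CM (2 * k) (n2 k)) (\<lambda>G. real (U (2 * k + n2 k) j G))
    = (real k * real k) * (r 2 (2 * (j - 2)) k - r 1 (j - 2) k * r 1 (j - 2) k)
     + (real k * (- r 2 (2 * (j - 2)) k + r 1 (2 * j - 2) k * (1 / real j) + r 1 (j - 2) k - r 1 (j - 2) k * (2 * (r 0 j k * (1 / (2 * real j)))))
     + (r 0 (2 * j) k * (1 / (4 * real j ^ 2)) + r 0 j k * (1 / (2 * real j)) - (r 0 j k * (1 / (2 * real j))) * (r 0 j k * (1 / (2 * real j)))))" for k
  proof -
    have j: "j > 0" using assms by simp
    have "(K * (K - 1) * r2 + K * q + w) + (K * r1 + m) - (K * r1 + m)\<^sup>2
      = (K * K) * (r2 - r1 * r1) + (K * (- r2 + q + r1 - r1 * (2 * m)) + (w + m - m * m))" for K r1 r2 q w m :: real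
      by (simp add: algebra_simps power2_eq_square)
    then show ?thesis
      unfolding variance_CM unfolding expectation_U[OF j] expectation_U_falling[OF j] r_def[symmetric]
      by (simp only: if_True assms)
  qed
  ultimately show ?thesis by simp
qed

lemma mean_U_1:
  "(\<lambda>k. measure_pmf.expectation (CM (2 * k) (n2 k)) (\<lambda>G. real (U (2 * k + n2 k) 1 G))) \<longlonglongrightarrow> 1 / 2 * (\<alpha> / (1 + \<alpha>))"
proof -
  have "(\<lambda>k. coeff_ratio k (n2 k) 0 1 / 2) \<longlonglongrightarrow> \<alpha> ^ 1 / (1 + \<alpha>) ^ (0 + 1) / 2"
    by (intro tendsto_intros near_tendsto near_coeff_ratio) auto
  moreover have "measure_pmf.expectation (CM (2 * k) (n2 k)) (\<lambda>G. real (U (2 * k + n2 k) 1 G)) = coeff_ratio k (n2 k) 0 1 / 2" for k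
    by (subst expectation_U) auto
  moreover have "\<alpha> ^ 1 / (1 + \<alpha>) ^ (0 + 1) / 2 = 1 / 2 * (\<alpha> / (1 + \<alpha>))" by simp
  ultimately show ?thesis by (simp only:)
qed

text \<open>A one-vertex component is a loop, so only the cycle terms occur. The second factorial
  moment tends to the square of the limiting mean, which leaves variance equal to mean, as for a
  Poisson law.\<close>

lemma variance_U_1:
  "(\<lambda>k. measure_pmf.variance (CM (2 * k) (n2 k)) (\<lambda>G. real (U (2 * k + n2 k) 1 G))) \<longlonglongrightarrow> 1 / 2 * (\<alpha> / (1 + \<alpha>))"
proof -
  have "(\<lambda>k. coeff_ratio k (n2 k) 0 2 / 4) \<longlonglongrightarrow> \<alpha> ^ 2 / (1 + \<alpha>) ^ (0 + 2) / 4"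
    by (intro tendsto_intros near_tendsto near_coeff_ratio) auto
  moreover have "measure_pmf.expectation (CM (2 * k) (n2 k)) (\<lambda>G. real (U (2 * k + n2 k) 1 G) * (real (U (2 * k + n2 k) 1 G) - 1))
    = coeff_ratio k (n2 k) 0 2 / 4" for k
    by (subst expectation_U_falling) auto
  moreover have "\<alpha> ^ 2 / (1 + \<alpha>) ^ (0 + 2) / 4 = (1 / 2 * (\<alpha> / (1 + \<alpha>)))\<^sup>2"
    unfolding power_mult_distrib power_divide by (simp add: power2_eq_square)
  ultimately have "(\<lambda>k. measure_pmf.expectation (CM (2 * k) (n2 k)) (\<lambda>G. real (U (2 * k + n2 k) 1 G) * (real (U (2 * k + n2 k) 1 G) - 1)))
    \<longlonglongrightarrow> (1 / 2 * (\<alpha> / (1 + \<alpha>)))\<^sup>2"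
    by (simp only:)
  from tendsto_diff[OF tendsto_add[OF this mean_U_1] tendsto_power[OF mean_U_1, of 2]]
  show ?thesis unfolding variance_CM by simp
qed

end

subsection \<open>Fourier inversion of the coefficients\<close>

lemma integral_cis_period:
  fixes k :: int
  shows "(LINT x:{-pi..pi}|lborel. cis (of_int k * x)) = (if k = 0 then of_real (2 * pi) else 0)"
proof (cases "k = 0")
  case True
  then show ?thesis
    by (simp add: set_lebesgue_integral_def scaleR_conv_of_real)
next
  case False
  let ?F = "\<lambda>x. cis (of_int k * x) / (\<i> * of_int k)"
  have "((\<lambda>x. cis (of_int k * x)) has_integral (?F pi - ?F (-pi))) {-pi..pi}"
  proof (rule fundamental_theorem_of_calculus)
    show "(?F has_vector_derivative cis (of_int k * x)) (at x within {-pi..pi})" for x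
      unfolding cis_conv_exp using False
      by (auto intro!: derivative_eq_intros has_vector_derivative_real_field simp: field_simps)
  qed simp
  moreover have "cis (of_int k * (-pi)) = cis (of_int k * pi)"
    by (simp add: complex_eq_iff)
       (metis mult.commute sin_integer_2pi sin_int_2pin sin_zero_iff_int2 mult.assoc neg_equal_0_iff_equal add.inverse_neutral)
  ultimately have "integral {-pi..pi} (\<lambda>x. cis (of_int k * x)) = 0"
    by (intro integral_unique) simp
  moreover have "set_integrable lborel {-pi..pi} (\<lambda>x. cis (of_int k * x))"
    by (rule borel_integrable_atLeastAtMost') (auto intro!: continuous_intros)
  ultimately show ?thesis using False by (simp add: set_borel_integral_eq_integral(2))
qed

text \<open>Cauchy's formula by termwise integration: on the circle the series converges absolutely,
  and orthogonality of the exponentials leaves only the term \<open>m = n\<close>.\<close>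

lemma fps_nth_fourier:
  fixes F :: "complex fps"
  assumes "r > 0" "ereal r < fps_conv_radius F"
  shows "of_real (2 * pi * r ^ n) * fps_nth F n =
    (LINT x:{-pi..pi}|lborel. eval_fps F (of_real r * cis x) * cis (- (real n * x)))"
proof -
  let ?f = "\<lambda>m x. indicator {-pi..pi} x *\<^sub>R (fps_nth F m * (of_real r * cis x) ^ m * cis (- (real n * x)))"
  have norm: "norm (fps_nth F m * (of_real r * cis x) ^ m * cis (- (real n * x))) = norm (fps_nth F m * of_real r ^ m)" for m x
    using assms by (simp add: norm_mult norm_power)
  have sum: "summable (\<lambda>m. norm (fps_nth F m * of_real r ^ m))"
    by (rule norm_summable_fps) (use assms in simp)
  have int: "integrable lborel (?f m)" for m
    unfolding set_integrable_def[symmetric]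
    by (rule borel_integrable_atLeastAtMost') (auto simp: cis_conv_exp intro!: continuous_intros)
  have eval: "indicator {-pi..pi} x *\<^sub>R (eval_fps F (of_real r * cis x) * cis (- (real n * x))) = (\<Sum>m. ?f m x)" for x
  proof -
    have "summable (\<lambda>m. fps_nth F m * (of_real r * cis x) ^ m)"
      by (rule summable_fps) (use assms in \<open>simp add: norm_mult\<close>)
    then show ?thesis unfolding eval_fps_def
      by (cases "x \<in> {-pi..pi}") (auto simp: suminf_mult2)
  qed
  have val: "integral\<^sup>L lborel (?f m) = (if m = n then of_real (2 * pi * r ^ n) * fps_nth F n else 0)" for m
  proof -
    have fx: "?f m x = (fps_nth F m * of_real r ^ m) * (indicator {-pi..pi} x *\<^sub>R cis (of_int (int m - int n) * x))" for x
      by (simp add: power_mult_distrib Complex.DeMoivre cis_mult algebra_simps)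
    have "integral\<^sup>L lborel (?f m) = (fps_nth F m * of_real r ^ m) * (LINT x:{-pi..pi}|lborel. cis (of_int (int m - int n) * x))"
      unfolding fx set_lebesgue_integral_def by (rule integral_mult_right_zero)
    then show ?thesis unfolding integral_cis_period by simp
  qed
  have "(LINT x:{-pi..pi}|lborel. eval_fps F (of_real r * cis x) * cis (- (real n * x))) = (LINT x|lborel. (\<Sum>m. ?f m x))"
    unfolding set_lebesgue_integral_def eval ..
  also have "\<dots> = (\<Sum>m. integral\<^sup>L lborel (?f m))"
  proof (rule integral_suminf)
    have *: "norm (?f m x) = indicator {-pi..pi} x * norm (fps_nth F m * of_real r ^ m)" for m x
      using norm[of m x] by (simp add: indicator_def)
    show "AE x in lborel. summable (\<lambda>m. norm (?f m x))"
      unfolding * using sum by (intro AE_I2 summable_mult)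
    show "summable (\<lambda>m. LINT x|lborel. norm (?f m x))"
      unfolding * using sum by (simp add: summable_mult)
  qed (rule int)
  also have "\<dots> = of_real (2 * pi * r ^ n) * fps_nth F n"
    unfolding val by (subst suminf_finite[of "{n}"]) auto
  finally show ?thesis ..
qed

lemma fps_conv_radius_bounded:
  fixes F :: "complex fps"
  assumes "\<And>n. norm (fps_nth F n) \<le> 1"
  shows "fps_conv_radius F \<ge> 1"
  unfolding fps_conv_radius_def
proof (rule conv_radius_geI_ex)
  fix r :: real assume r: "0 < r" "ereal r < 1"
  then have "summable (\<lambda>n. r ^ n)" by (intro summable_geometric) auto
  then have "summable (\<lambda>n. fps_nth F n * of_real r ^ n)"
    by (rule summable_comparison_test[rotated]) (use assms r in \<open>auto intro!: exI[of _ 0] mult_left_le_one_le simp: norm_mult norm_power\<close>)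
  then show "\<exists>z. norm z = r \<and> summable (\<lambda>n. fps_nth F n * z ^ n)" using r by (intro exI[of _ "of_real r"]) auto
qed

lemma ereal_norm_less_conv_radius: "fps_conv_radius F \<ge> 1 \<Longrightarrow> norm z < 1 \<Longrightarrow> ereal (norm z) < fps_conv_radius F"
  by (rule less_le_trans[of _ 1]) (simp_all add: one_ereal_def)

lemma norm_eval_fps_bounded:
  fixes F :: "complex fps"
  assumes "\<And>n. norm (fps_nth F n) \<le> 1" "norm z < 1"
  shows "norm (eval_fps F z) \<le> 1 / (1 - norm z)"
proof -
  have "norm (eval_fps F z) \<le> (\<Sum>n. norm z ^ n)"
    unfolding eval_fps_def
    by (rule norm_suminf_le) (use assms in \<open>auto intro!: mult_left_le_one_le summable_geometric simp: norm_mult norm_power\<close>)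
  then show ?thesis using suminf_geometric[of "norm z"] assms by simp
qed

text \<open>The recursion divides a sum of \<open>n\<close> terms of norm at most one by
  \<open>2 * n\<close>. The bound is uniform in \<open>u\<close>, so the cycle factor can later be
  dominated for all \<open>k\<close> at once.\<close>

lemma norm_cycle_coeff_le:
  fixes u :: "nat \<Rightarrow> complex"
  assumes "\<And>j. norm (u j) \<le> 1"
  shows "norm (cycle_coeff u n) \<le> 1"
proof (induction n rule: less_induct)
  case (less n)
  show ?case
  proof (cases "n = 0")
    case False
    have "norm (\<Sum>j<n. u (n - j) * cycle_coeff u j) \<le> (\<Sum>j<n. 1)"
      by (rule sum_norm_le) (use assms less in \<open>auto simp: norm_mult intro!: mult_le_one\<close>)
    with False show ?thesis by (subst cycle_coeff.simps) (simp add: norm_divide norm_mult)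
  qed (simp add: cycle_coeff.simps)
qed

text \<open>Twice the logarithm of the cycle series. The constant coefficient is 0 because division
  by zero yields 0.\<close>

definition log_fps :: "(nat \<Rightarrow> complex) \<Rightarrow> complex fps" where
  "log_fps u = Abs_fps (\<lambda>j. u j / of_nat j)"

text \<open>The recursion of \<open>cycle_coeff\<close> read as the differential equation Q' =
  (L'/2) Q, which identifies Q with exp (L/2) in \<open>eval_fps_cycle\<close>.\<close>

lemma fps_deriv_cycle: "fps_deriv (cycle_fps u) = fps_const (1/2) * fps_deriv (log_fps u) * cycle_fps u"
proof (rule fps_ext)
  fix n
  have "of_nat (Suc n) * cycle_coeff u (Suc n) = (\<Sum>j<Suc n. u (Suc n - j) * cycle_coeff u j) / 2"
    by (subst cycle_coeff.simps) (simp add: field_simps del: of_nat_Suc sum.lessThan_Suc)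
  also have "(\<Sum>j<Suc n. u (Suc n - j) * cycle_coeff u j) = (\<Sum>i\<le>n. u (Suc i) * cycle_coeff u (n - i))"
    by (rule sum.reindex_bij_witness[where i = "\<lambda>j. n - j" and j = "\<lambda>i. n - i"]) (auto simp: Suc_diff_le)
  also have "\<dots> = (\<Sum>i\<le>n. fps_nth (fps_deriv (log_fps u)) i * fps_nth (cycle_fps u) (n - i))"
    by (simp add: log_fps_def cycle_fps_def del: of_nat_Suc)
  finally show "fps_nth (fps_deriv (cycle_fps u)) n = fps_nth (fps_const (1/2) * fps_deriv (log_fps u) * cycle_fps u) n"
    by (simp only: mult.assoc fps_mult_left_const_nth fps_mult_nth[of "fps_deriv _"] atLeast0AtMost)
       (simp add: cycle_fps_def algebra_simps)
qed

lemma fps_conv_radius_log: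
  assumes "\<And>j. norm (u j) \<le> 1"
  shows "fps_conv_radius (log_fps u) \<ge> 1"
proof (rule fps_conv_radius_bounded)
  fix n
  show "norm (fps_nth (log_fps u) n) \<le> 1"
    using assms[of n] by (cases "n = 0") (auto simp: log_fps_def norm_divide divide_le_eq)
qed

text \<open>By \<open>fps_deriv_cycle\<close> the product of Q and exp (-L/2) has zero derivative on
  the open unit disc, and it equals 1 at the origin.\<close>

lemma eval_fps_cycle:
  fixes u :: "nat \<Rightarrow> complex"
  assumes u: "\<And>j. norm (u j) \<le> 1" and z: "norm z < 1"
  shows "eval_fps (cycle_fps u) z = exp (eval_fps (log_fps u) z / 2)"
proof -
  have R: "fps_conv_radius (cycle_fps u) \<ge> 1" "fps_conv_radius (log_fps u) \<ge> 1"
    using norm_cycle_coeff_le[OF u] fps_conv_radius_log[OF u] by (auto intro!: fps_conv_radius_bounded simp: cycle_fps_def)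
  have dom: "ereal (norm x) < fps_conv_radius (cycle_fps u)" "ereal (norm x) < fps_conv_radius (log_fps u)" if "norm x < 1" for x :: complex
    using R that by (auto intro!: ereal_norm_less_conv_radius)
  define h where "h x = eval_fps (cycle_fps u) x * exp (- (eval_fps (log_fps u) x / 2))" for x
  have "\<exists>c. \<forall>x\<in>ball 0 1. h x = c"
  proof (rule has_field_derivative_zero_constant)
    fix x :: complex assume "x \<in> ball 0 1"
    then have x: "norm x < 1" by simp
    have d: "(eval_fps (cycle_fps u) has_field_derivative eval_fps (fps_deriv (cycle_fps u)) x) (at x within ball 0 1)"
      "(eval_fps (log_fps u) has_field_derivative eval_fps (fps_deriv (log_fps u)) x) (at x within ball 0 1)"
      using dom[OF x] by (auto intro!: has_field_derivative_eval_fps)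
    have "ereal (norm x) < fps_conv_radius (fps_deriv (log_fps u))"
      using dom[OF x] fps_conv_radius_deriv less_le_trans by blast
    then have e: "eval_fps (fps_deriv (cycle_fps u)) x = 1/2 * eval_fps (fps_deriv (log_fps u)) x * eval_fps (cycle_fps u) x"
      unfolding fps_deriv_cycle using dom[OF x]
      by (subst eval_fps_mult; (subst eval_fps_mult)?)
         (auto intro!: less_le_trans[OF _ fps_conv_radius_mult])
    show "(h has_field_derivative 0) (at x within ball 0 1)"
      unfolding h_def using d by (auto intro!: derivative_eq_intros simp: e)
  qed simp
  then obtain c where c: "h x = c" if "norm x < 1" for x by auto
  have "c = 1" using c[of 0] by (simp add: h_def eval_fps_at_0 cycle_fps_def cycle_coeff.simps log_fps_def)
  then have "eval_fps (cycle_fps u) z * exp (- (eval_fps (log_fps u) z / 2)) = 1" using c[OF z] by (simp add: h_def)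
  then show ?thesis by (simp add: exp_minus field_simps)
qed

text \<open>Only finitely many weights differ from 1, so the perturbation of the logarithm is a
  polynomial in \<open>z\<close>, and its limit can be taken term by term.\<close>

lemma eval_fps_log_diff:
  fixes u :: "nat \<Rightarrow> complex"
  assumes u: "\<And>j. norm (u j) \<le> 1" and z: "norm z < 1" and q: "\<And>j. j > q \<Longrightarrow> u j = 1"
  shows "eval_fps (log_fps u) z = eval_fps (log_fps (\<lambda>_. 1)) z + (\<Sum>j=1..q. (u j - 1) * z ^ j / of_nat j)"
proof -
  have dom: "ereal (norm z) < fps_conv_radius (log_fps v)" if "\<And>j. norm (v j) \<le> 1" for v
    by (intro ereal_norm_less_conv_radius fps_conv_radius_log that z)
  have "(\<lambda>j. fps_nth (log_fps u) j * z ^ j - fps_nth (log_fps (\<lambda>_. 1)) j * z ^ j) sums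
    (eval_fps (log_fps u) z - eval_fps (log_fps (\<lambda>_. 1)) z)"
    by (intro sums_diff sums_eval_fps dom) (use u in auto)
  moreover have "(\<lambda>j. fps_nth (log_fps u) j * z ^ j - fps_nth (log_fps (\<lambda>_. 1)) j * z ^ j) sums
    (\<Sum>j=1..q. fps_nth (log_fps u) j * z ^ j - fps_nth (log_fps (\<lambda>_. 1)) j * z ^ j)"
    by (rule sums_finite) (use q in \<open>auto simp: log_fps_def Suc_le_eq\<close>)
  ultimately have "eval_fps (log_fps u) z - eval_fps (log_fps (\<lambda>_. 1)) z = (\<Sum>j=1..q. fps_nth (log_fps u) j * z ^ j - fps_nth (log_fps (\<lambda>_. 1)) j * z ^ j)"
    by (rule sums_unique2)
  also have "\<dots> = (\<Sum>j=1..q. (u j - 1) * z ^ j / of_nat j)"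
    by (intro sum.cong) (auto simp: log_fps_def field_simps)
  finally show ?thesis by (simp add: algebra_simps)
qed

lemma comp_coeff_fourier:
  fixes u :: "nat \<Rightarrow> complex"
  assumes u: "\<And>j. norm (u j) \<le> 1" and r: "0 < r" "r < 1"
  shows "of_real (2 * pi * r ^ n) * comp_coeff u k n =
    (LINT x:{-pi..pi}|lborel. eval_fps (path_fps u) (of_real r * cis x) ^ k *
       eval_fps (cycle_fps u) (of_real r * cis x) * cis (- (real n * x)))"
proof -
  have R: "fps_conv_radius (path_fps u) \<ge> 1" "fps_conv_radius (cycle_fps u) \<ge> 1"
    using norm_cycle_coeff_le[OF u] u by (auto intro!: fps_conv_radius_bounded simp: cycle_fps_def path_fps_def)
  have r1: "ereal r < 1" using r by simp
  have dom: "ereal r < fps_conv_radius (path_fps u)" "ereal r < fps_conv_radius (path_fps u ^ k)" "ereal r < fps_conv_radius (cycle_fps u)"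
    using R r1 fps_conv_radius_power[of "path_fps u" k] by (meson less_le_trans)+
  then have "ereal r < fps_conv_radius (path_fps u ^ k * cycle_fps u)"
    by (intro less_le_trans[OF _ fps_conv_radius_mult]) simp
  note fourier = fps_nth_fourier[OF r(1) this, of n]
  have "norm (of_real r * cis x) = r" for x using r by (simp add: norm_mult)
  then have "eval_fps (path_fps u ^ k * cycle_fps u) (of_real r * cis x)
    = eval_fps (path_fps u) (of_real r * cis x) ^ k * eval_fps (cycle_fps u) (of_real r * cis x)" for x
    using dom by (simp only: eval_fps_mult eval_fps_power)
  then show ?thesis
    using fourier unfolding comp_coeff_def by (simp only:)
qed

subsection \<open>Geometric path lengths\<close>

lemma nat_pmf_expectation:
  fixes f :: "nat \<Rightarrow> 'a :: {banach, second_countable_topology}"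
  assumes "summable (\<lambda>n. pmf p n * norm (f n))"
  shows "integrable (measure_pmf p) f" "measure_pmf.expectation p f = (\<Sum>n. pmf p n *\<^sub>R f n)"
proof -
  have i: "integrable (count_space UNIV) (\<lambda>n. pmf p n *\<^sub>R f n)"
    unfolding integrable_count_space_nat_iff using assms by simp
  then show "integrable (measure_pmf p) f"
    unfolding measure_pmf_eq_density by (subst integrable_density) auto
  show "measure_pmf.expectation p f = (\<Sum>n. pmf p n *\<^sub>R f n)"
    unfolding measure_pmf_eq_density using integral_count_space_nat[OF i] by (subst integral_density) auto
qed

text \<open>At t = 1/sqrt k the characteristic function differs from 1 - v/(2k) by O(k^(-3/2)),
  thanks to the third moment, and a k-th power of numbers of norm at most one magnifies the error at
  most \<open>k\<close> times. The variance may be zero.\<close>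

lemma clt_char_pmf:
  fixes X :: "nat \<Rightarrow> real"
  assumes int: "integrable (measure_pmf p) X" "integrable (measure_pmf p) (\<lambda>g. X g ^ 2)" "integrable (measure_pmf p) (\<lambda>g. \<bar>X g\<bar> ^ 3)"
    and mean: "measure_pmf.expectation p X = 0" and var: "measure_pmf.expectation p (\<lambda>g. X g ^ 2) = v"
  shows "(\<lambda>k. measure_pmf.expectation p (\<lambda>g. cis (X g / sqrt (real k))) ^ k) \<longlonglongrightarrow> of_real (exp (- v / 2))"
proof -
  define \<phi> where "\<phi> t = measure_pmf.expectation p (\<lambda>g. cis (t * X g))" for t
  define C where "C = measure_pmf.expectation p (\<lambda>g. \<bar>X g\<bar> ^ 3)"
  have v: "v \<ge> 0" unfolding var[symmetric] by simp
  have \<phi>: "\<phi> t = char (distr (measure_pmf p) borel X) t" for t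
    unfolding char_def \<phi>_def by (subst integral_distr) (auto simp: cis_conv_exp)
  have approx: "norm (\<phi> t - (1 - t\<^sup>2 * v / 2)) \<le> t\<^sup>2 / 6 * (\<bar>t\<bar> * C)" for t
  proof -
    have "norm (\<phi> t - (1 - t\<^sup>2 * v / 2)) \<le> t\<^sup>2 / 6 * measure_pmf.expectation p (\<lambda>g. min (6 * (X g)\<^sup>2) (\<bar>t\<bar> * \<bar>X g\<bar> ^ 3))"
      unfolding \<phi> using prob_space.char_approx3'[OF measure_pmf.prob_space_axioms, of X p v, OF _ int(1,2) mean _ refl, of t] var mean by simp
    also have "\<dots> \<le> t\<^sup>2 / 6 * measure_pmf.expectation p (\<lambda>g. \<bar>t\<bar> * \<bar>X g\<bar> ^ 3)"
      using int by (intro mult_left_mono integral_mono integrable_min) auto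
    finally show ?thesis by (simp add: C_def)
  qed
  have norm_\<phi>: "norm (\<phi> t) \<le> 1" for t
    unfolding \<phi>_def
    by (intro order_trans[OF integral_norm_bound]) simp
  \<comment> \<open>The second condition keeps 1 - v/(2k) in [-1, 1], as
    \<open>norm_power_diff\<close> requires.\<close>
  have ev: "eventually (\<lambda>k. real k > 0 \<and> v \<le> 4 * real k) sequentially"
    by (intro eventually_conj; real_asymp)
  have "(\<lambda>k. \<phi> (1 / sqrt (real k)) ^ k - of_real ((1 + (- v / 2) / real k) ^ k)) \<longlonglongrightarrow> 0"
  proof (rule Lim_null_comparison)
    show "\<forall>\<^sub>F k in sequentially. norm (\<phi> (1 / sqrt (real k)) ^ k - of_real ((1 + (- v / 2) / real k) ^ k)) \<le> C / 6 * (1 / sqrt (real k))"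
      using ev
    proof eventually_elim
      case (elim k)
      let ?t = "1 / sqrt (real k)"
      have t2: "?t\<^sup>2 = 1 / real k" by (simp add: power_divide)
      have "\<bar>1 + (- v / 2) / real k\<bar> \<le> 1" using elim v by (auto simp: abs_le_iff field_simps)
      then have n: "norm (complex_of_real (1 + (- v / 2) / real k)) \<le> 1" by (simp only: norm_of_real)
      have "norm (\<phi> ?t ^ k - of_real (1 + (- v / 2) / real k) ^ k) \<le> k * norm (\<phi> ?t - of_real (1 + (- v / 2) / real k))"
        by (rule norm_power_diff[OF norm_\<phi> n])
      also have "\<dots> \<le> k * (?t\<^sup>2 / 6 * (\<bar>?t\<bar> * C))"
        using approx[of ?t] unfolding t2 by (intro mult_left_mono) (simp_all add: mult.commute)
      also have "k * (?t\<^sup>2 / 6 * (\<bar>?t\<bar> * C)) = C / 6 * (1 / sqrt (real k))"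
        unfolding t2 using elim by simp
      finally show ?case by simp
    qed
    show "(\<lambda>k. C / 6 * (1 / sqrt (real k))) \<longlonglongrightarrow> 0" by real_asymp
  qed
  moreover have "(\<lambda>k. complex_of_real ((1 + (- v / 2) / real k) ^ k)) \<longlonglongrightarrow> of_real (exp (- v / 2))"
    by (intro tendsto_of_real tendsto_exp_limit_sequentially)
  ultimately have "(\<lambda>k. \<phi> (1 / sqrt (real k)) ^ k) \<longlonglongrightarrow> of_real (exp (- v / 2))"
    by (rule Lim_transform[rotated])
  then show ?thesis by (simp add: \<phi>_def)
qed

text \<open>From 1 - cos x = 2 sin(x/2)^2 and sin y \<ge> y/3 on [0, pi/2], hence 2 (x/6)^2 =
  x^2/18. The slope 1/3 is 1 - 2^2/6, by the cubic Taylor bound and pi/2 < 2.\<close>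

lemma one_minus_cos_ge:
  assumes "\<bar>x\<bar> \<le> pi"
  shows "1 - cos x \<ge> x\<^sup>2 / 18"
proof -
  have *: "sin y \<ge> y / 3" if y: "0 < y" "y \<le> pi / 2" for y
  proof -
    obtain t where e: "sin y = (\<Sum>m<3. sin_coeff m * y ^ m) + sin (t + 1/2 * real 3 * pi) / fact 3 * y ^ 3"
      using Maclaurin_sin_expansion3[of 3 y] y by auto
    have "- 1 / 6 * y ^ 3 \<le> sin (t + 1/2 * real 3 * pi) / fact 3 * y ^ 3"
      using y by (intro mult_right_mono) (auto simp: fact_numeral)
    moreover have "(\<Sum>m<3. sin_coeff m * y ^ m) = y" by (simp add: sin_coeff_def numeral_eq_Suc)
    ultimately have "sin y \<ge> y - y ^ 3 / 6" using e by linarith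
    moreover have "y * y\<^sup>2 \<le> y * 2\<^sup>2" using y pi_less_4 by (intro mult_left_mono power_mono) auto
    ultimately show ?thesis by (simp add: power3_eq_cube power2_eq_square)
  qed
  have "\<bar>sin (x / 2)\<bar> \<ge> \<bar>x / 2\<bar> / 3"
    using *[of "x / 2"] *[of "- (x / 2)"] assms by (cases x "0 :: real" rule: linorder_cases) auto
  then have "(\<bar>x / 2\<bar> / 3)\<^sup>2 \<le> (\<bar>sin (x / 2)\<bar>)\<^sup>2" by (intro power_mono) auto
  moreover have "cos x = 1 - 2 * (sin (x / 2))\<^sup>2" using cos_double_sin[of "x / 2"] by simp
  ultimately show ?thesis by (simp add: power_divide)
qed

text \<open>The two atoms on which the perturbation \<open>w\<close> is trivial already force Gaussian decay.\<close>
lemma norm_char_pmf_le: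
  fixes w :: "nat \<Rightarrow> complex"
  assumes w: "\<And>g. norm (w g) = 1" "w a = 1" "w (Suc a) = 1" and x: "\<bar>x\<bar> \<le> pi"
  shows "norm (measure_pmf.expectation p (\<lambda>g. w g * cis (real g * x))) \<le> exp (- (pmf p a * pmf p (Suc a) / 18) * x\<^sup>2)"
proof -
  let ?f = "\<lambda>g. w g * cis (real g * x)"
  let ?I = "indicator {a, Suc a} :: nat \<Rightarrow> real"
  define A where "A = pmf p a"
  define B where "B = pmf p (Suc a)"
  have nn: "A \<ge> 0" "B \<ge> 0" by (simp_all add: A_def B_def)
  have AB: "A + B = measure_pmf.prob p {a, Suc a}" by (simp add: A_def B_def measure_measure_pmf_finite)
  then have AB1: "A + B \<le> 1" by simp
  have bnd: "integrable (measure_pmf p) (\<lambda>g. h g *\<^sub>R ?f g)" if "\<And>g. \<bar>h g\<bar> \<le> 1" for h :: "nat \<Rightarrow> real"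
    by (rule measure_pmf.integrable_const_bound[where B = 1]) (use that in \<open>auto simp: norm_mult w\<close>)
  have "measure_pmf.expectation p ?f = measure_pmf.expectation p (\<lambda>g. ?I g *\<^sub>R ?f g + (1 - ?I g) *\<^sub>R ?f g)"
    by (intro Bochner_Integration.integral_cong) (auto simp: indicator_def)
  also have "\<dots> = measure_pmf.expectation p (\<lambda>g. ?I g *\<^sub>R ?f g) + measure_pmf.expectation p (\<lambda>g. (1 - ?I g) *\<^sub>R ?f g)"
    by (intro Bochner_Integration.integral_add bnd) (auto simp: indicator_def)
  also have "measure_pmf.expectation p (\<lambda>g. ?I g *\<^sub>R ?f g) = (\<Sum>g\<in>{a, Suc a}. pmf p g *\<^sub>R (?I g *\<^sub>R ?f g))"
    by (rule integral_measure_pmf) (auto simp: indicator_def split: if_splits)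
  also have "\<dots> = cis (real a * x) * (of_real A + of_real B * cis x)"
    by (simp add: w A_def B_def scaleR_conv_of_real algebra_simps cis_mult)
  finally have "norm (measure_pmf.expectation p ?f) \<le> norm (cis (real a * x) * (of_real A + of_real B * cis x))
      + norm (measure_pmf.expectation p (\<lambda>g. (1 - ?I g) *\<^sub>R ?f g))"
    by (simp only: norm_triangle_ineq)
  also have "norm (measure_pmf.expectation p (\<lambda>g. (1 - ?I g) *\<^sub>R ?f g)) \<le> measure_pmf.expectation p (\<lambda>g. 1 - ?I g)"
    by (rule order_trans[OF integral_norm_bound], rule integral_mono')
       (auto simp: norm_mult w indicator_def intro!: measure_pmf.integrable_const_bound[where B = 1])
  also have "measure_pmf.expectation p (\<lambda>g. 1 - ?I g) = 1 - (A + B)"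
    unfolding AB by (subst Bochner_Integration.integral_diff) (auto intro!: measure_pmf.integrable_const_bound[where B = 1])
  also have "norm (cis (real a * x) * (of_real A + of_real B * cis x)) \<le> A + B - A * B * x\<^sup>2 / 18"
  proof -
    have "(norm (of_real A + of_real B * cis x))\<^sup>2 = (A + B * cos x)\<^sup>2 + (B * sin x)\<^sup>2"
      by (simp add: cmod_power2)
    also have "\<dots> = A\<^sup>2 + 2 * (A * B) * cos x + B\<^sup>2 * ((sin x)\<^sup>2 + (cos x)\<^sup>2)"
      by (simp only: power2_eq_square algebra_simps)
    also have "\<dots> = (A + B)\<^sup>2 - 2 * (A * B) * (1 - cos x)"
      unfolding sin_cos_squared_add by (simp add: power2_eq_square algebra_simps)
    also have "\<dots> \<le> (A + B)\<^sup>2 - 2 * (A * B) * (x\<^sup>2 / 18)"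
      using one_minus_cos_ge[OF x] nn by (intro diff_left_mono mult_left_mono) auto
    \<comment> \<open>Since \<open>A + B\<close> is at most 1, the subtracted term may be shrunk to
      the cross term of a square.\<close>
    also have "\<dots> \<le> (A + B)\<^sup>2 - 2 * (A + B) * (A * B * x\<^sup>2 / 18)"
      using mult_right_mono[OF AB1, of "A * B * x\<^sup>2"] nn by (simp add: algebra_simps)
    also have "\<dots> \<le> (A + B - A * B * x\<^sup>2 / 18)\<^sup>2"
      by (simp add: power2_diff)
    finally have le: "(norm (of_real A + of_real B * cis x))\<^sup>2 \<le> (A + B - A * B * x\<^sup>2 / 18)\<^sup>2" .
    \<comment> \<open>The base of the square must be nonnegative before roots are taken; the crude
      bound pi < 4 suffices, as 16 < 18.\<close>
    have "A * B * x\<^sup>2 / 18 \<le> A + B"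
    proof -
      have "x\<^sup>2 \<le> 4\<^sup>2" using x pi_less_4 by (intro power2_le_iff_abs_le[THEN iffD2]) linarith+
      then have "A * B * x\<^sup>2 \<le> A * B * 18" using nn by (intro mult_left_mono) auto
      moreover have "A * B \<le> A * 1" using nn AB1 by (intro mult_left_mono) auto
      ultimately show ?thesis using nn by linarith
    qed
    then have "norm (of_real A + of_real B * cis x) \<le> A + B - A * B * x\<^sup>2 / 18"
      by (intro power2_le_imp_le[OF le]) linarith
    then show ?thesis by (simp only: norm_mult norm_cis mult_1)
  qed
  also have "A + B - A * B * x\<^sup>2 / 18 + (1 - (A + B)) = 1 + (- (A * B / 18) * x\<^sup>2)" by simp
  also have "\<dots> \<le> exp (- (A * B / 18) * x\<^sup>2)" by (rule exp_ge_add_one_self)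
  finally show ?thesis by (simp add: A_def B_def)
qed

text \<open>Completing the square in \<open>s\<close>. When \<open>V\<close> is the variance of the
  marks, \<open>K\<close> their covariance with the length and the square of \<sigma> the variance
  of the length, the exponent that remains is the variance of the marks conditioned on the
  length.\<close>

lemma gaussian_integral:
  fixes \<sigma> K V :: real
  assumes "\<sigma> > 0"
  shows "integrable lborel (\<lambda>s. exp (- (V + 2 * s * K + s\<^sup>2 * \<sigma>\<^sup>2) / 2))"
    and "(LINT s|lborel. exp (- (V + 2 * s * K + s\<^sup>2 * \<sigma>\<^sup>2) / 2)) = exp (- (V - K\<^sup>2 / \<sigma>\<^sup>2) / 2) * sqrt (2 * pi / \<sigma>\<^sup>2)"
proof -
  let ?c = "exp (- (V - K\<^sup>2 / \<sigma>\<^sup>2) / 2) * sqrt (2 * pi / \<sigma>\<^sup>2)"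
  have eq: "exp (- (V + 2 * s * K + s\<^sup>2 * \<sigma>\<^sup>2) / 2) = ?c * normal_density (- K / \<sigma>\<^sup>2) (1 / \<sigma>) s" for s
  proof -
    have "- (V + 2 * s * K + s\<^sup>2 * \<sigma>\<^sup>2) / 2 = - (V - K\<^sup>2 / \<sigma>\<^sup>2) / 2 + - ((s - (- K / \<sigma>\<^sup>2))\<^sup>2 / (2 * (1 / \<sigma>)\<^sup>2))"
      using assms by (simp add: field_simps power2_eq_square)
    then have "exp (- (V + 2 * s * K + s\<^sup>2 * \<sigma>\<^sup>2) / 2) = exp (- (V - K\<^sup>2 / \<sigma>\<^sup>2) / 2) * exp (- ((s - (- K / \<sigma>\<^sup>2))\<^sup>2 / (2 * (1 / \<sigma>)\<^sup>2)))"
      by (simp only: exp_add)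
    moreover have "sqrt (2 * pi / \<sigma>\<^sup>2) * (1 / sqrt (2 * pi * (1 / \<sigma>)\<^sup>2)) = 1"
      using assms by (simp add: power_divide real_sqrt_divide)
    ultimately show ?thesis by (simp add: normal_density_def)
  qed
  show "integrable lborel (\<lambda>s. exp (- (V + 2 * s * K + s\<^sup>2 * \<sigma>\<^sup>2) / 2))"
    unfolding eq by (intro integrable_mult_right integrable_normal_density) (use assms in auto)
  show "(LINT s|lborel. exp (- (V + 2 * s * K + s\<^sup>2 * \<sigma>\<^sup>2) / 2)) = ?c"
    unfolding eq using assms by simp
qed

text \<open>Termwise differentiation preserves summability inside the disc, and \<open>diffs\<close>
  turns n^m into (n+1)^(m+1), which dominates n^(m+1).\<close>

lemma summable_power_mult_geometric:
  fixes x :: real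
  assumes "norm x < 1"
  shows "summable (\<lambda>n. real n ^ m * x ^ n)"
  using assms
proof (induction m arbitrary: x)
  case (Suc m)
  have "norm \<bar>x\<bar> < 1" using Suc.prems by simp
  then have "summable (\<lambda>n. diffs (\<lambda>n. real n ^ m) n * \<bar>x\<bar> ^ n)"
    by (rule termdiff_converges) (rule Suc.IH)
  then show ?case
    by (rule summable_comparison_test[rotated])
       (auto intro!: exI[of _ 0] mult_right_mono power_mono simp: diffs_def abs_mult power_abs simp flip: power_Suc)
qed (simp add: summable_geometric)

text \<open>The law of the number of inner vertices of a path. Its success probability is chosen to
  make the mean \<alpha>, the number of vertices of degree two per path.\<close>

abbreviation (input) "geo \<alpha> \<equiv> geometric_pmf (1 / (1 + \<alpha>))"

context
  fixes \<alpha> :: real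
  assumes \<alpha>: "\<alpha> > 0"
begin

lemma pmf_geo: "pmf (geo \<alpha>) n = (\<alpha> / (1 + \<alpha>)) ^ n / (1 + \<alpha>)"
proof -
  have "1 - 1 / (1 + \<alpha>) = (\<alpha> / (1 + \<alpha>))" using \<alpha> by (simp add: field_simps)
  then show ?thesis using \<alpha> by (subst pmf_geometric) auto
qed

lemma rho_bounds: "0 < (\<alpha> / (1 + \<alpha>))" "(\<alpha> / (1 + \<alpha>)) < 1"
  using \<alpha> by auto

lemma geo_moment_summable: "summable (\<lambda>n. pmf (geo \<alpha>) n * real n ^ m)"
proof -
  have "norm (\<alpha> / (1 + \<alpha>)) < 1" using rho_bounds by (simp only: real_norm_def abs_of_pos)
  then have "summable (\<lambda>n. real n ^ m * (\<alpha> / (1 + \<alpha>)) ^ n)" by (rule summable_power_mult_geometric)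
  then show ?thesis unfolding pmf_geo using summable_divide[of _ "1 + \<alpha>"] by (simp add: mult.commute)
qed

lemma integrable_geo_power: "integrable (measure_pmf (geo \<alpha>)) (\<lambda>g. real g ^ m)"
  by (rule nat_pmf_expectation) (use geo_moment_summable in simp)

lemma geo_mean: "measure_pmf.expectation (geo \<alpha>) real = \<alpha>"
  using \<alpha> by (subst expectation_geometric_pmf) (auto simp: field_simps)

text \<open>Shifting the index multiplies the mass by \<alpha>/(1+\<alpha>), which gives a linear
  equation for the second moment in terms of the lower ones.\<close>

lemma geo_second_moment: "measure_pmf.expectation (geo \<alpha>) (\<lambda>g. real g ^ 2) = \<alpha> * (2 * \<alpha> + 1)"
proof -
  define S where "S m = (\<Sum>n. pmf (geo \<alpha>) n * real n ^ m)" for m :: nat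
  have E: "measure_pmf.expectation (geo \<alpha>) (\<lambda>g. real g ^ m) = S m" for m
    unfolding S_def by (subst nat_pmf_expectation) (use geo_moment_summable in auto)
  have S0: "S 0 = 1" using E[of 0] by simp
  have S1: "S 1 = \<alpha>" using E[of 1] geo_mean by simp
  have sh: "pmf (geo \<alpha>) (Suc n) * real (Suc n) ^ 2 = (\<alpha> / (1 + \<alpha>)) * (pmf (geo \<alpha>) n * real n ^ 2 + 2 * (pmf (geo \<alpha>) n * real n ^ 1) + pmf (geo \<alpha>) n * real n ^ 0)" for n
  proof -
    have "pmf (geo \<alpha>) (Suc n) = (\<alpha> / (1 + \<alpha>)) * pmf (geo \<alpha>) n" by (simp add: pmf_geo)
    moreover have "r * P * (1 + N) ^ 2 = r * (P * N ^ 2 + 2 * (P * N ^ 1) + P * N ^ 0)" for r P N :: real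
      by (simp add: algebra_simps power2_eq_square)
    ultimately show ?thesis by (simp only: of_nat_Suc)
  qed
  have "S 2 = (\<Sum>n. pmf (geo \<alpha>) (Suc n) * real (Suc n) ^ 2)"
    unfolding S_def by (subst suminf_split_head[OF geo_moment_summable]) simp
  also have "\<dots> = (\<alpha> / (1 + \<alpha>)) * (S 2 + 2 * S 1 + S 0)"
    unfolding sh S_def
    by (intro sums_unique[symmetric] sums_mult sums_add summable_sums geo_moment_summable)
  finally have "(1 + \<alpha>) * S 2 = (1 + \<alpha>) * ((\<alpha> / (1 + \<alpha>)) * (S 2 + 2 * S 1 + S 0))" by simp
  then have "(1 + \<alpha>) * S 2 = \<alpha> * (S 2 + 2 * \<alpha> + 1)" using \<alpha> unfolding S0 S1 by simp
  then show ?thesis unfolding E by (simp add: algebra_simps)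
qed

text \<open>Powers of the radius are \<open>1 + \<alpha>\<close> times the masses of
  \<open>geo \<alpha>\<close>, so on this circle the path series is a characteristic function
  perturbed by \<open>u\<close>.\<close>

lemma eval_path_fps:
  fixes u :: "nat \<Rightarrow> complex"
  assumes u: "\<And>j. norm (u j) \<le> 1"
  shows "eval_fps (path_fps u) (of_real (\<alpha> / (1 + \<alpha>)) * cis x)
    = of_real (1 + \<alpha>) * measure_pmf.expectation (geo \<alpha>) (\<lambda>g. u (g + 2) * cis (real g * x))"
proof -
  let ?f = "\<lambda>g. u (g + 2) * cis (real g * x)"
  have s0: "summable (pmf (geo \<alpha>))" using geo_moment_summable[of 0] by simp
  have s: "summable (\<lambda>n. pmf (geo \<alpha>) n * norm (?f n))"
    by (rule summable_comparison_test[OF _ s0]) (use u in \<open>auto intro!: exI[of _ 0] mult_right_le_one_le simp: norm_mult\<close>)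
  have "of_real (1 + \<alpha>) * measure_pmf.expectation (geo \<alpha>) ?f = (\<Sum>n. of_real (1 + \<alpha>) * (pmf (geo \<alpha>) n *\<^sub>R ?f n))"
    unfolding nat_pmf_expectation(2)[OF s]
    by (rule suminf_mult[symmetric]) (rule summable_norm_cancel, use s in simp)
  also have "(\<lambda>n. of_real (1 + \<alpha>) * (pmf (geo \<alpha>) n *\<^sub>R ?f n)) = (\<lambda>n. u (n + 2) * (of_real (\<alpha> / (1 + \<alpha>)) * cis x) ^ n)"
  proof
    fix n
    have "(1 + \<alpha>) * pmf (geo \<alpha>) n = (\<alpha> / (1 + \<alpha>)) ^ n" using \<alpha> unfolding pmf_geo by simp
    then have "of_real (1 + \<alpha>) * (pmf (geo \<alpha>) n *\<^sub>R ?f n) = of_real ((\<alpha> / (1 + \<alpha>)) ^ n) * ?f n"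
      by (metis mult.assoc of_real_mult scaleR_conv_of_real)
    moreover have "(of_real r * cis x) ^ n = of_real (r ^ n) * cis (real n * x)" for r
      by (simp add: power_mult_distrib Complex.DeMoivre)
    ultimately show "of_real (1 + \<alpha>) * (pmf (geo \<alpha>) n *\<^sub>R ?f n) = u (n + 2) * (of_real (\<alpha> / (1 + \<alpha>)) * cis x) ^ n"
      by (simp only: mult_ac)
  qed
  finally show ?thesis by (simp add: eval_fps_def path_fps_def)
qed

end

subsection \<open>Local limit theorem for the generating function\<close>

lemma cis_sum: "finite A \<Longrightarrow> cis (\<Sum>x\<in>A. f x) = (\<Prod>x\<in>A. cis (f x))"
  by (induction A rule: finite_induct) (simp_all add: cis_mult[symmetric])

lemma continuous_on_eval_circle:
  fixes F :: "complex fps"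
  assumes "fps_conv_radius F \<ge> 1" "0 \<le> r" "r < 1"
  shows "continuous_on UNIV (\<lambda>x. eval_fps F (of_real r * cis (x * b)))"
proof (rule continuous_on_eval_fps')
  show "continuous_on UNIV (\<lambda>x. of_real r * cis (x * b))"
    unfolding cis_conv_exp by (intro continuous_intros)
  show "(\<lambda>x. of_real r * cis (x * b)) ` UNIV \<subseteq> eball 0 (fps_conv_radius F)"
    using assms ereal_norm_less_conv_radius[OF assms(1), of "of_real r :: complex"] by (auto simp: in_eball_iff norm_mult)
qed

lemma integral_rescale:
  fixes f :: "real \<Rightarrow> complex"
  assumes "b > 0"
  shows "of_real b * (LINT x:{-pi..pi}|lborel. f x) = (LINT s|lborel. indicator {-pi * b..pi * b} s *\<^sub>R f (s * (1 / b)))"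
proof -
  have "(LINT x:{-pi..pi}|lborel. f x) = \<bar>1 / b\<bar> *\<^sub>R (LINT s|lborel. indicator {-pi..pi} (0 + (1 / b) * s) *\<^sub>R f (0 + (1 / b) * s))"
    unfolding set_lebesgue_integral_def using assms by (intro lborel_integral_real_affine) simp
  moreover have "indicator {-pi..pi} (0 + (1 / b) * s) = (indicator {-pi * b..pi * b} s :: real)" for s
    using assms by (auto simp: indicator_def field_simps)
  ultimately show ?thesis using assms by (simp add: scaleR_conv_of_real mult.commute)
qed

lemma Suc_Suc_diff_2: "2 \<le> j \<Longrightarrow> Suc (Suc (j - 2)) = j"
  by simp

lemma tendsto_cis: "(f \<longlongrightarrow> a) F \<Longrightarrow> ((\<lambda>x. cis (f x)) \<longlongrightarrow> cis a) F"
  unfolding cis_conv_exp by (intro tendsto_intros)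

context
  fixes \<alpha> :: real and q :: nat and t :: "nat \<Rightarrow> real" and \<tau> :: real and N :: "nat \<Rightarrow> nat"
  assumes \<alpha>: "\<alpha> > 0" and q: "q \<ge> 1"
  defines "N \<equiv> \<lambda>k. nat \<lfloor>\<alpha> * real k\<rfloor>"
begin

text \<open>The mass of \<open>geo \<alpha>\<close> at \<open>j - 2\<close>, that is the limiting
  proportion of paths with \<open>j\<close> vertices.\<close>

definition path_weight :: "nat \<Rightarrow> real" where
  "path_weight j = \<alpha> ^ (j - 2) / (1 + \<alpha>) ^ (j - 1)"

text \<open>One-vertex components are bounded in mean and keep the fixed frequency \<tau>; the sizes
  from 2 to \<open>q\<close> fluctuate on the scale sqrt k and have their frequencies scaled
  accordingly. Larger components are unmarked.\<close>

definition char_wt :: "nat \<Rightarrow> nat \<Rightarrow> complex" where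
  "char_wt k j = (if j = 1 then cis \<tau> else if 2 \<le> j \<and> j \<le> q then cis (t j / sqrt k) else 1)"

definition tfun :: "nat \<Rightarrow> real" where
  "tfun g = (if g + 2 \<le> q then t (g + 2) else 0)"

text \<open>Under \<open>geo \<alpha>\<close> these three are the mean and variance of the mark
  \<open>tfun\<close> and its covariance with the length.\<close>

definition tmean :: real where "tmean = (\<Sum>j=2..q. t j * path_weight j)"
definition tvar :: real where "tvar = (\<Sum>j=2..q. (t j)\<^sup>2 * path_weight j) - tmean\<^sup>2"
definition tcov :: real where "tcov = (\<Sum>j=2..q. t j * path_weight j * (real j - 2 - \<alpha>))"

lemma char_wt_shift: "char_wt k (g + 2) = cis (tfun g / sqrt k)"
  by (simp add: char_wt_def tfun_def)

lemma norm_char_wt: "norm (char_wt k j) = 1"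
  by (simp add: char_wt_def)

lemma norm_radius: "norm (complex_of_real (\<alpha> / (1 + \<alpha>)) * cis x) = \<alpha> / (1 + \<alpha>)"
  using rho_bounds[OF \<alpha>] by (simp only: norm_mult norm_cis norm_of_real abs_of_pos mult_1_right)

lemma pmf_geo_weight: "j \<ge> 2 \<Longrightarrow> pmf (geo \<alpha>) (j - 2) = path_weight j"
  unfolding pmf_geo[OF \<alpha>] path_weight_def
  by (cases j rule: nat.exhaust; cases "j - 1") (auto simp: power_divide)

lemma expectation_tfun:
  fixes h :: "nat \<Rightarrow> real"
  shows "measure_pmf.expectation (geo \<alpha>) (\<lambda>g. (if g + 2 \<le> q then h g else 0)) = (\<Sum>j=2..q. path_weight j * h (j - 2))"
proof -
  have "measure_pmf.expectation (geo \<alpha>) (\<lambda>g. (if g + 2 \<le> q then h g else 0))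
    = (\<Sum>g\<in>{g. g + 2 \<le> q}. pmf (geo \<alpha>) g *\<^sub>R (if g + 2 \<le> q then h g else 0))"
    by (rule integral_measure_pmf) (auto intro: finite_subset[of _ "{..q}"] split: if_splits)
  also have "\<dots> = (\<Sum>j=2..q. path_weight j * h (j - 2))"
    by (rule sum.reindex_bij_witness[where i = "\<lambda>j. j - 2" and j = "\<lambda>g. g + 2"])
       (auto simp: pmf_geo_weight[symmetric])
  finally show ?thesis .
qed

text \<open>The centred mark plus \<open>s\<close> times the centred length. The variable
  \<open>s\<close> is the rescaled angle of Cauchy's formula, dual to the total length that is being
  fixed.\<close>

definition Xfun :: "real \<Rightarrow> nat \<Rightarrow> real" where
  "Xfun s g = tfun g - tmean + s * (real g - \<alpha>)"

lemma tfun_bounded: "\<exists>B. \<forall>g. \<bar>tfun g\<bar> \<le> B"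
proof (intro exI allI)
  fix g
  show "\<bar>tfun g\<bar> \<le> (\<Sum>j\<in>{2..q}. \<bar>t j\<bar>)"
    using member_le_sum[of "g + 2" "{2..q}" "\<lambda>j. \<bar>t j\<bar>"] by (auto simp: tfun_def intro!: sum_nonneg)
qed

lemma integrable_tfun_pow: "integrable (measure_pmf (geo \<alpha>)) (\<lambda>g. tfun g ^ i * real g ^ m)"
proof -
  obtain B where B: "\<And>g. \<bar>tfun g\<bar> \<le> B" using tfun_bounded by blast
  show ?thesis
  proof (rule Bochner_Integration.integrable_bound)
    show "integrable (measure_pmf (geo \<alpha>)) (\<lambda>g. B ^ i * real g ^ m)"
      by (intro integrable_mult_right integrable_geo_power \<alpha>)
    have "B \<ge> 0" using B[of 0] by linarith
    then show "AE g in measure_pmf (geo \<alpha>). norm (tfun g ^ i * real g ^ m) \<le> norm (B ^ i * real g ^ m)"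
      using B by (intro AE_I2) (auto simp: abs_mult power_abs intro!: mult_right_mono power_mono)
  qed simp
qed

lemma integrable_Xfun: "integrable (measure_pmf (geo \<alpha>)) (\<lambda>g. \<bar>Xfun s g\<bar> ^ 3)"
proof -
  obtain B where B: "\<And>g. \<bar>tfun g\<bar> \<le> B" using tfun_bounded by blast
  define C where "C = B + \<bar>tmean\<bar> + \<bar>s\<bar> * (1 + \<alpha>)"
  have B0: "B \<ge> 0" using B[of 0] by linarith
  have C0: "C \<ge> 0" using \<alpha> B0 by (simp add: C_def)
  have bd: "\<bar>Xfun s g\<bar> \<le> C * (1 + real g)" for g
  proof -
    have "\<bar>Xfun s g\<bar> \<le> \<bar>tfun g\<bar> + \<bar>tmean\<bar> + \<bar>s * (real g - \<alpha>)\<bar>" unfolding Xfun_def by linarith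
    also have "\<bar>s * (real g - \<alpha>)\<bar> \<le> \<bar>s\<bar> * ((1 + \<alpha>) * (1 + real g))"
      unfolding abs_mult using \<alpha> by (intro mult_left_mono) (auto simp: abs_le_iff algebra_simps)
    also have "\<bar>tfun g\<bar> + \<bar>tmean\<bar> + \<bar>s\<bar> * ((1 + \<alpha>) * (1 + real g)) \<le> (B + \<bar>tmean\<bar>) * (1 + real g) + \<bar>s\<bar> * ((1 + \<alpha>) * (1 + real g))"
    proof -
      have "(B + \<bar>tmean\<bar>) * 1 \<le> (B + \<bar>tmean\<bar>) * (1 + real g)" using B0 by (intro mult_left_mono) auto
      then have "\<bar>tfun g\<bar> + \<bar>tmean\<bar> \<le> (B + \<bar>tmean\<bar>) * (1 + real g)"
        using B[of g] unfolding mult_1_right by (meson add_right_mono order_trans)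
      then show ?thesis by (rule add_right_mono)
    qed
    finally show ?thesis by (simp add: C_def algebra_simps)
  qed
  show ?thesis
  proof (rule Bochner_Integration.integrable_bound)
    have "(1 + real g) ^ 3 = real g ^ 3 + 3 * real g ^ 2 + 3 * real g ^ 1 + real g ^ 0" for g
      by (simp add: power3_eq_cube power2_eq_square algebra_simps)
    then show "integrable (measure_pmf (geo \<alpha>)) (\<lambda>g. C ^ 3 * (1 + real g) ^ 3)"
      by (simp only:) (intro integrable_mult_right Bochner_Integration.integrable_add integrable_geo_power \<alpha>)
    show "AE g in measure_pmf (geo \<alpha>). norm (\<bar>Xfun s g\<bar> ^ 3) \<le> norm (C ^ 3 * (1 + real g) ^ 3)"
      using bd C0 by (intro AE_I2) (auto simp: abs_mult power_abs simp flip: power_mult_distrib intro!: power_mono)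
  qed simp
qed

lemma Xfun_1: "integrable (measure_pmf (geo \<alpha>)) (Xfun s)" "measure_pmf.expectation (geo \<alpha>) (Xfun s) = 0"
proof -
  have X: "Xfun s = (\<lambda>g. tfun g ^ 1 * real g ^ 0 + (s * real g ^ 1 - (tmean + s * \<alpha>)))"
    by (auto simp: Xfun_def fun_eq_iff algebra_simps)
  note int = integrable_tfun_pow[of 1 0] integrable_mult_right[OF integrable_geo_power[OF \<alpha>, of 1], of s]
  show "integrable (measure_pmf (geo \<alpha>)) (Xfun s)"
    unfolding X by (intro Bochner_Integration.integrable_add Bochner_Integration.integrable_diff int) auto
  have "measure_pmf.expectation (geo \<alpha>) tfun = tmean"
    unfolding tfun_def tmean_def by (subst expectation_tfun) (auto intro!: sum.cong simp: Suc_Suc_diff_2)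
  then have "measure_pmf.expectation (geo \<alpha>) (\<lambda>g. tfun g ^ 1 * real g ^ 0) = tmean" by simp
  moreover have "measure_pmf.expectation (geo \<alpha>) (\<lambda>g. s * real g ^ 1) = s * \<alpha>" using geo_mean[OF \<alpha>] by simp
  ultimately show "measure_pmf.expectation (geo \<alpha>) (Xfun s) = 0"
    unfolding X using int by (subst Bochner_Integration.integral_add) (auto simp: Bochner_Integration.integral_diff)
qed

text \<open>As a quadratic polynomial in \<open>s\<close> the variance supplies the constants of
  \<open>gaussian_integral\<close>; \<alpha> (1+\<alpha>) is the variance of a geometric
  length.\<close>

lemma Xfun_2: "integrable (measure_pmf (geo \<alpha>)) (\<lambda>g. Xfun s g ^ 2)"
  "measure_pmf.expectation (geo \<alpha>) (\<lambda>g. Xfun s g ^ 2) = tvar + 2 * s * tcov + s\<^sup>2 * (\<alpha> * (1 + \<alpha>))"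
proof -
  let ?a = "tmean + s * \<alpha>"
  have X: "(\<lambda>g. Xfun s g ^ 2) = (\<lambda>g. tfun g ^ 2 * real g ^ 0 + (s\<^sup>2 * real g ^ 2 + (2 * s * (tfun g ^ 1 * real g ^ 1)
     + ((- 2 * ?a) * (tfun g ^ 1 * real g ^ 0) + ((- 2 * ?a * s) * real g ^ 1 + ?a\<^sup>2)))))"
    by (auto simp: Xfun_def fun_eq_iff algebra_simps power2_eq_square)
  note int = integrable_tfun_pow integrable_mult_right[OF integrable_tfun_pow] integrable_mult_right[OF integrable_geo_power[OF \<alpha>]]
  show "integrable (measure_pmf (geo \<alpha>)) (\<lambda>g. Xfun s g ^ 2)"
    unfolding X by (intro Bochner_Integration.integrable_add int) auto
  have 1: "measure_pmf.expectation (geo \<alpha>) (\<lambda>g. tfun g ^ 1 * real g ^ 0) = tmean"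
  proof -
    have "measure_pmf.expectation (geo \<alpha>) tfun = tmean"
      unfolding tfun_def tmean_def by (subst expectation_tfun) (auto intro!: sum.cong simp: Suc_Suc_diff_2)
    then show ?thesis by simp
  qed
  have 2: "measure_pmf.expectation (geo \<alpha>) (\<lambda>g. tfun g ^ 2 * real g ^ 0) = (\<Sum>j=2..q. (t j)\<^sup>2 * path_weight j)"
  proof -
    have "(\<lambda>g. tfun g ^ 2 * real g ^ 0) = (\<lambda>g. if g + 2 \<le> q then (t (g + 2))\<^sup>2 else 0)" by (auto simp: tfun_def)
    then show ?thesis by (simp only:) (subst expectation_tfun, auto intro!: sum.cong simp: Suc_Suc_diff_2)
  qed
  have 3: "measure_pmf.expectation (geo \<alpha>) (\<lambda>g. tfun g ^ 1 * real g ^ 1) = tcov + \<alpha> * tmean"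
  proof -
    have "(\<lambda>g. tfun g ^ 1 * real g ^ 1) = (\<lambda>g. if g + 2 \<le> q then t (g + 2) * real g else 0)" by (auto simp: tfun_def)
    then have "measure_pmf.expectation (geo \<alpha>) (\<lambda>g. tfun g ^ 1 * real g ^ 1) = (\<Sum>j=2..q. path_weight j * (t j * (real j - 2)))"
      by (simp only:) (subst expectation_tfun, auto intro!: sum.cong simp: of_nat_diff Suc_Suc_diff_2)
    also have "\<dots> = (\<Sum>j=2..q. t j * path_weight j * (real j - 2 - \<alpha>) + \<alpha> * (t j * path_weight j))"
      by (intro sum.cong) (auto simp: algebra_simps)
    finally show ?thesis by (simp add: tcov_def tmean_def sum.distrib sum_distrib_left)
  qed
  have 4: "measure_pmf.expectation (geo \<alpha>) (\<lambda>g. real g ^ 1) = \<alpha>" using geo_mean[OF \<alpha>] by simp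
  have "measure_pmf.expectation (geo \<alpha>) (\<lambda>g. Xfun s g ^ 2) = measure_pmf.expectation (geo \<alpha>) (\<lambda>g. tfun g ^ 2 * real g ^ 0)
     + (s\<^sup>2 * measure_pmf.expectation (geo \<alpha>) (\<lambda>g. real g ^ 2) + (2 * s * measure_pmf.expectation (geo \<alpha>) (\<lambda>g. tfun g ^ 1 * real g ^ 1)
     + ((- 2 * ?a) * measure_pmf.expectation (geo \<alpha>) (\<lambda>g. tfun g ^ 1 * real g ^ 0) + ((- 2 * ?a * s) * measure_pmf.expectation (geo \<alpha>) (\<lambda>g. real g ^ 1) + ?a\<^sup>2))))"
  proof -
    have c: "measure_pmf.expectation (geo \<alpha>) (\<lambda>_. ?a\<^sup>2) = ?a\<^sup>2" by simp
    have i: "integrable (measure_pmf (geo \<alpha>)) (\<lambda>_. ?a\<^sup>2)" by simp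
    show ?thesis
      unfolding X by (simp only: Bochner_Integration.integral_add int i c Bochner_Integration.integrable_add integral_mult_right_zero)
  qed
  also have "\<dots> = tvar + 2 * s * tcov + s\<^sup>2 * (\<alpha> * (1 + \<alpha>))"
    unfolding 1 2 3 4 geo_second_moment[OF \<alpha>] by (simp add: tvar_def algebra_simps power2_eq_square)
  finally show "measure_pmf.expectation (geo \<alpha>) (\<lambda>g. Xfun s g ^ 2) = tvar + 2 * s * tcov + s\<^sup>2 * (\<alpha> * (1 + \<alpha>))" .
qed

text \<open>Cauchy's integrand at the angle \<open>s / sqrt k\<close>, with the factor 1+\<alpha> of
  the path series removed. The last factor centres the marks.\<close>

definition char_integrand :: "nat \<Rightarrow> real \<Rightarrow> complex" where
  "char_integrand k s = measure_pmf.expectation (geo \<alpha>) (\<lambda>g. char_wt k (g + 2) * cis (real g * (s * (1 / sqrt k)))) ^ k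
     * eval_fps (cycle_fps (char_wt k)) (of_real (\<alpha> / (1 + \<alpha>)) * cis (s * (1 / sqrt k)))
     * cis (- (real (N k) * (s * (1 / sqrt k)))) * cis (- (sqrt k * tmean))"

text \<open>Collects the Cauchy prefactor, the Jacobian sqrt k and the powers of 1+\<alpha> taken
  out of the path series. It is free of \<open>t\<close> and \<tau> and therefore cancels in the
  quotient.\<close>

definition scaling :: "nat \<Rightarrow> real" where
  "scaling k = 2 * pi * (\<alpha> / (1 + \<alpha>)) ^ N k * sqrt k / (1 + \<alpha>) ^ k"

lemma scaling_pos: "k > 0 \<Longrightarrow> scaling k > 0"
  using \<alpha> by (simp add: scaling_def)

lemma comp_coeff_integral:
  assumes "k > 0"
  shows "of_real (scaling k) * comp_coeff (char_wt k) k (N k) * cis (- (sqrt k * tmean))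
    = (LINT s|lborel. indicator {-pi * sqrt k..pi * sqrt k} s *\<^sub>R char_integrand k s)"
proof -
  let ?r = "\<alpha> / (1 + \<alpha>)"
  let ?E = "\<lambda>x. measure_pmf.expectation (geo \<alpha>) (\<lambda>g. char_wt k (g + 2) * cis (real g * x))"
  let ?Q = "\<lambda>x. eval_fps (cycle_fps (char_wt k)) (of_real ?r * cis x)"
  have u: "norm (char_wt k j) \<le> 1" for j by (simp add: norm_char_wt)
  have "of_real (2 * pi * ?r ^ N k) * comp_coeff (char_wt k) k (N k)
    = (LINT x:{-pi..pi}|lborel. (of_real (1 + \<alpha>) * ?E x) ^ k * ?Q x * cis (- (real (N k) * x)))"
    using comp_coeff_fourier[OF u rho_bounds[OF \<alpha>]] unfolding eval_path_fps[OF \<alpha> u] .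
  also have "\<dots> = (LINT x:{-pi..pi}|lborel. of_real ((1 + \<alpha>) ^ k) * (?E x ^ k * ?Q x * cis (- (real (N k) * x))))"
    by (simp add: power_mult_distrib mult.assoc)
  also have "\<dots> = of_real ((1 + \<alpha>) ^ k) * (LINT x:{-pi..pi}|lborel. ?E x ^ k * ?Q x * cis (- (real (N k) * x)))"
    by (rule set_integral_mult_right)
  finally have 1: "of_real (2 * pi * ?r ^ N k) * comp_coeff (char_wt k) k (N k)
    = of_real ((1 + \<alpha>) ^ k) * (LINT x:{-pi..pi}|lborel. ?E x ^ k * ?Q x * cis (- (real (N k) * x)))" .
  have "(1 + \<alpha>) ^ k \<noteq> 0" using \<alpha> by simp
  then have "of_real (scaling k) * comp_coeff (char_wt k) k (N k)
    = of_real (sqrt k) * (LINT x:{-pi..pi}|lborel. ?E x ^ k * ?Q x * cis (- (real (N k) * x)))"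
  proof -
    have "of_real (scaling k) = of_real (2 * pi * ?r ^ N k) * (of_real (sqrt k / (1 + \<alpha>) ^ k) :: complex)"
      by (simp add: scaling_def)
    then have "of_real (scaling k) * comp_coeff (char_wt k) k (N k)
      = of_real (sqrt k / (1 + \<alpha>) ^ k) * (of_real (2 * pi * ?r ^ N k) * comp_coeff (char_wt k) k (N k))"
      by (simp only: mult_ac)
    also have "\<dots> = of_real (sqrt k / (1 + \<alpha>) ^ k * (1 + \<alpha>) ^ k) * (LINT x:{-pi..pi}|lborel. ?E x ^ k * ?Q x * cis (- (real (N k) * x)))"
      unfolding 1 by (simp only: mult.assoc of_real_mult)
    finally show ?thesis using \<open>(1 + \<alpha>) ^ k \<noteq> 0\<close> by simp
  qed
  also have "\<dots> = (LINT s|lborel. indicator {-pi * sqrt k..pi * sqrt k} s *\<^sub>R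
     (?E (s * (1 / sqrt k)) ^ k * ?Q (s * (1 / sqrt k)) * cis (- (real (N k) * (s * (1 / sqrt k))))))"
    using assms by (intro integral_rescale) simp
  finally have "of_real (scaling k) * comp_coeff (char_wt k) k (N k) * cis (- (sqrt k * tmean))
    = (LINT s|lborel. indicator {-pi * sqrt k..pi * sqrt k} s *\<^sub>R
     (?E (s * (1 / sqrt k)) ^ k * ?Q (s * (1 / sqrt k)) * cis (- (real (N k) * (s * (1 / sqrt k)))))) * cis (- (sqrt k * tmean))"
    by (simp only:)
  also have "\<dots> = (LINT s|lborel. indicator {-pi * sqrt k..pi * sqrt k} s *\<^sub>R
     (?E (s * (1 / sqrt k)) ^ k * ?Q (s * (1 / sqrt k)) * cis (- (real (N k) * (s * (1 / sqrt k))))) * cis (- (sqrt k * tmean)))"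
    by (rule integral_mult_left_zero[symmetric])
  finally show ?thesis by (simp only: char_integrand_def scaleR_left.add mult_scaleR_left)
qed

text \<open>By continuity: the expectation is written back as a power series evaluated on a circle
  inside its disc of convergence.\<close>

lemma char_integrand_measurable: "char_integrand k \<in> borel_measurable borel"
proof -
  let ?r = "\<alpha> / (1 + \<alpha>)"
  have u: "norm (char_wt k j) \<le> 1" for j by (simp add: norm_char_wt)
  have R: "fps_conv_radius (path_fps (char_wt k)) \<ge> 1" "fps_conv_radius (cycle_fps (char_wt k)) \<ge> 1"
    using norm_cycle_coeff_le[OF u] u by (auto intro!: fps_conv_radius_bounded simp: cycle_fps_def path_fps_def)
  have r: "0 \<le> ?r" "?r < 1" using rho_bounds[OF \<alpha>] by auto
  have c: "complex_of_real (1 + \<alpha>) \<noteq> 0" unfolding of_real_eq_0_iff using \<alpha> by linarith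
  have E: "measure_pmf.expectation (geo \<alpha>) (\<lambda>g. char_wt k (g + 2) * cis (real g * x))
    = eval_fps (path_fps (char_wt k)) (of_real ?r * cis x) / of_real (1 + \<alpha>)" for x
    unfolding eval_path_fps[OF \<alpha> u] using c by (rule nonzero_mult_div_cancel_left[symmetric])
  have cis: "continuous_on UNIV (\<lambda>s. cis (- (a * (s * b))))" for a b :: real
    unfolding cis_conv_exp by (intro continuous_intros)
  have "continuous_on UNIV (char_integrand k)"
    unfolding char_integrand_def E using c
    by (intro continuous_on_mult continuous_on_power continuous_on_divide continuous_on_eval_circle R r continuous_on_const cis ballI)
  then show ?thesis by (rule borel_measurable_continuous_onI)
qed

text \<open>The atoms \<open>q\<close> and \<open>Suc q\<close> stand for paths of
  \<open>q + 2\<close> and \<open>q + 3\<close> vertices, which \<open>char_wt\<close> leaves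
  unmarked; hence the rate depends neither on \<open>k\<close> nor on the frequencies.\<close>

definition decay :: real where
  "decay = pmf (geo \<alpha>) q * pmf (geo \<alpha>) (Suc q) / 18"

lemma decay_pos: "decay > 0"
  using \<alpha> by (simp add: decay_def pmf_geo)

text \<open>At angle \<open>s / sqrt k\<close> each of the \<open>k\<close> path factors is at most
  exp (- \<open>decay\<close> s^2 / k), so the power gives a Gaussian majorant free of
  \<open>k\<close>. The constant 1+\<alpha> is the geometric bound for the cycle factor.\<close>

lemma norm_char_integrand:
  assumes "s \<in> {-pi * sqrt k..pi * sqrt k}"
  shows "norm (char_integrand k s) \<le> (1 + \<alpha>) * exp (- decay * s\<^sup>2)"
proof -
  let ?r = "\<alpha> / (1 + \<alpha>)"
  let ?x = "s * (1 / sqrt k)"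
  have u: "norm (char_wt k j) \<le> 1" for j by (simp add: norm_char_wt)
  have x: "\<bar>?x\<bar> \<le> pi" using assms by (cases "k = 0") (auto simp: abs_le_iff field_simps)
  have "norm (measure_pmf.expectation (geo \<alpha>) (\<lambda>g. char_wt k (g + 2) * cis (real g * ?x))) \<le> exp (- decay * ?x\<^sup>2)"
    unfolding decay_def
    by (rule norm_char_pmf_le) (use x in \<open>auto simp: norm_char_wt char_wt_def\<close>)
  then have "norm (measure_pmf.expectation (geo \<alpha>) (\<lambda>g. char_wt k (g + 2) * cis (real g * ?x)) ^ k) \<le> exp (- decay * ?x\<^sup>2) ^ k"
    unfolding norm_power by (intro power_mono) auto
  also have "\<dots> = exp (- decay * s\<^sup>2)"
    using assms by (cases "k = 0") (auto simp: exp_of_nat_mult[symmetric] power_mult_distrib power_divide)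
  finally have 1: "norm (measure_pmf.expectation (geo \<alpha>) (\<lambda>g. char_wt k (g + 2) * cis (real g * ?x)) ^ k) \<le> exp (- decay * s\<^sup>2)" .
  have "norm (eval_fps (cycle_fps (char_wt k)) (of_real ?r * cis ?x)) \<le> 1 / (1 - norm (of_real ?r * cis ?x))"
    using norm_cycle_coeff_le[OF u] rho_bounds[OF \<alpha>]
    by (intro norm_eval_fps_bounded) (simp_all only: cycle_fps_def fps_nth_Abs_fps norm_radius)
  also have "\<dots> = 1 + \<alpha>"
    unfolding norm_radius using \<alpha> by (simp add: field_simps)
  finally have 2: "norm (eval_fps (cycle_fps (char_wt k)) (of_real ?r * cis ?x)) \<le> 1 + \<alpha>" .
  have "norm (measure_pmf.expectation (geo \<alpha>) (\<lambda>g. char_wt k (g + 2) * cis (real g * ?x)) ^ k)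
    * norm (eval_fps (cycle_fps (char_wt k)) (of_real ?r * cis ?x)) \<le> exp (- decay * s\<^sup>2) * (1 + \<alpha>)"
    by (intro mult_mono 1 2) auto
  then show ?thesis
    unfolding char_integrand_def norm_mult norm_cis by (simp only: mult_1_right mult.commute[of "1 + \<alpha>"])
qed

text \<open>The cycle series with unit weights at the saddle point. As an exponential it is visibly
  nonzero, so it can be cancelled in the final quotient.\<close>

definition cycle_limit :: complex where
  "cycle_limit = exp (eval_fps (log_fps (\<lambda>_. 1)) (of_real (\<alpha> / (1 + \<alpha>))) / 2)"

text \<open>All marks of size at least 2 tend to 1 and the argument tends to the radius, so in the
  logarithm only the loop term survives. It is the exponent of a Poisson characteristic
  function.\<close>

lemma cycle_eval_tendsto:
  "(\<lambda>k. eval_fps (cycle_fps (char_wt k)) (of_real (\<alpha> / (1 + \<alpha>)) * cis (s * (1 / sqrt (real k)))))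
    \<longlonglongrightarrow> cycle_limit * exp (of_real (\<alpha> / (1 + \<alpha>)) * (cis \<tau> - 1) / 2)"
proof -
  let ?r = "\<alpha> / (1 + \<alpha>)"
  define z where "z k = of_real ?r * cis (s * (1 / sqrt (real k)))" for k
  have u: "norm (char_wt k j) \<le> 1" for k j by (simp add: norm_char_wt)
  have norm_z: "norm (z k) < 1" for k
    using rho_bounds[OF \<alpha>] by (simp only: z_def norm_radius)
  have "(\<lambda>k. s * (1 / sqrt (real k))) \<longlonglongrightarrow> 0" by real_asymp
  from tendsto_mult[OF tendsto_const tendsto_cis[OF this]]
  have z: "z \<longlonglongrightarrow> of_real ?r" unfolding z_def by (simp only: cis_zero mult_1_right)
  have "isCont (eval_fps (log_fps (\<lambda>_. 1))) (of_real ?r)"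
  proof (rule continuous_on_interior)
    show "continuous_on (ball 0 1) (eval_fps (log_fps (\<lambda>_. 1)))"
      by (rule continuous_on_eval_fps'[of _ "\<lambda>x. x", OF continuous_on_id])
         (auto simp: in_eball_iff intro!: ereal_norm_less_conv_radius fps_conv_radius_log)
    show "complex_of_real ?r \<in> interior (ball 0 1)"
      using norm_radius[of 0] rho_bounds[OF \<alpha>] by (simp del: of_real_divide)
  qed
  then have L: "(\<lambda>k. eval_fps (log_fps (\<lambda>_. 1)) (z k)) \<longlonglongrightarrow> eval_fps (log_fps (\<lambda>_. 1)) (of_real ?r)"
    using z by (rule isCont_tendsto_compose)
  have "(\<lambda>k. char_wt k j) \<longlonglongrightarrow> (if j = 1 then cis \<tau> else 1)" for j
  proof -
    have "(\<lambda>k. t j / sqrt (real k)) \<longlonglongrightarrow> 0" by real_asymp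
    then have "(\<lambda>k. cis (t j / sqrt (real k))) \<longlonglongrightarrow> 1" by (auto dest: tendsto_cis)
    then show ?thesis by (cases "2 \<le> j \<and> j \<le> q") (auto simp: char_wt_def)
  qed
  then have "(\<lambda>k. \<Sum>j=1..q. (char_wt k j - 1) * z k ^ j / of_nat j) \<longlonglongrightarrow>
    (\<Sum>j=1..q. ((if j = 1 then cis \<tau> else 1) - 1) * of_real ?r ^ j / of_nat j)"
    using z by (intro tendsto_intros) auto
  also have "(\<Sum>j=1..q. ((if j = 1 then cis \<tau> else 1) - 1) * of_real ?r ^ j / of_nat j)
    = (\<Sum>j=1..q. if j = 1 then (cis \<tau> - 1) * of_real ?r else 0)"
    by (intro sum.cong) auto
  also have "\<dots> = of_real ?r * (cis \<tau> - 1)" using q by simp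
  finally have S: "(\<lambda>k. \<Sum>j=1..q. (char_wt k j - 1) * z k ^ j / of_nat j) \<longlonglongrightarrow> of_real ?r * (cis \<tau> - 1)" .
  have "eval_fps (cycle_fps (char_wt k)) (z k)
    = exp ((eval_fps (log_fps (\<lambda>_. 1)) (z k) + (\<Sum>j=1..q. (char_wt k j - 1) * z k ^ j / of_nat j)) / 2)" for k
    unfolding eval_fps_cycle[OF u norm_z]
    using q by (subst eval_fps_log_diff[OF u norm_z, of q]) (auto simp: char_wt_def)
  moreover have "(\<lambda>k. exp ((eval_fps (log_fps (\<lambda>_. 1)) (z k) + (\<Sum>j=1..q. (char_wt k j - 1) * z k ^ j / of_nat j)) / 2))
    \<longlonglongrightarrow> exp ((eval_fps (log_fps (\<lambda>_. 1)) (of_real ?r) + of_real ?r * (cis \<tau> - 1)) / 2)"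
    by (intro tendsto_intros L S) simp
  ultimately show ?thesis
    unfolding z_def cycle_limit_def by (simp add: add_divide_distrib exp_add)
qed

text \<open>The k-th power splits into that of the centred variable \<open>Xfun s\<close> and a
  deterministic phase. This phase cancels the two \<open>cis\<close> factors up to s (\<alpha> k - N
  k)/sqrt k, which vanishes because the floor loses at most 1.\<close>

lemma char_integrand_tendsto:
  "(\<lambda>k. char_integrand k s) \<longlonglongrightarrow> cycle_limit * exp (of_real (\<alpha> / (1 + \<alpha>)) * (cis \<tau> - 1) / 2)
     * of_real (exp (- (tvar + 2 * s * tcov + s\<^sup>2 * (\<alpha> * (1 + \<alpha>))) / 2))"
proof -
  define \<phi> where "\<phi> k = measure_pmf.expectation (geo \<alpha>) (\<lambda>g. cis (Xfun s g / sqrt (real k)))" for k :: nat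
  have \<phi>: "(\<lambda>k. \<phi> k ^ k) \<longlonglongrightarrow> of_real (exp (- (tvar + 2 * s * tcov + s\<^sup>2 * (\<alpha> * (1 + \<alpha>))) / 2))"
    unfolding \<phi>_def by (rule clt_char_pmf) (rule Xfun_1 Xfun_2 integrable_Xfun)+
  have split: "char_integrand k s = \<phi> k ^ k * eval_fps (cycle_fps (char_wt k)) (of_real (\<alpha> / (1 + \<alpha>)) * cis (s * (1 / sqrt k)))
     * cis (s * (\<alpha> * k - N k) * (1 / sqrt k))" for k
  proof -
    let ?E = "measure_pmf.expectation (geo \<alpha>) (\<lambda>g. char_wt k (g + 2) * cis (real g * (s * (1 / sqrt k))))"
    have "cis (Xfun s g / sqrt (real k)) = cis (- ((tmean + s * \<alpha>) / sqrt k)) * (char_wt k (g + 2) * cis (real g * (s * (1 / sqrt k))))" for g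
      unfolding char_wt_shift cis_mult by (rule arg_cong[where f = cis]) (simp add: Xfun_def diff_divide_distrib add_divide_distrib algebra_simps)
    then have "\<phi> k = cis (- ((tmean + s * \<alpha>) / sqrt k)) * ?E"
      unfolding \<phi>_def by (simp only: integral_mult_right_zero)
    then have "?E = cis ((tmean + s * \<alpha>) / sqrt k) * \<phi> k"
      by (simp add: mult.assoc[symmetric] cis_mult)
    then have E: "?E ^ k = cis (real k * ((tmean + s * \<alpha>) / sqrt k)) * \<phi> k ^ k"
      by (simp add: power_mult_distrib Complex.DeMoivre)
    have kk: "real k / sqrt k = sqrt k" by (rule real_div_sqrt) simp
    have "real k * ((tmean + s * \<alpha>) / sqrt k) + - (real (N k) * (s * (1 / sqrt k))) + - (sqrt k * tmean)
      = (real k / sqrt k) * tmean + s * \<alpha> * real k * (1 / sqrt k) - real (N k) * s * (1 / sqrt k) - sqrt k * tmean"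
      by (simp add: add_divide_distrib algebra_simps)
    also have "\<dots> = s * (\<alpha> * k - N k) * (1 / sqrt k)" unfolding kk by (simp add: algebra_simps diff_divide_distrib)
    finally have ang: "cis (real k * ((tmean + s * \<alpha>) / sqrt k)) * cis (- (real (N k) * (s * (1 / sqrt k)))) * cis (- (sqrt k * tmean))
      = cis (s * (\<alpha> * k - N k) * (1 / sqrt k))" by (simp only: cis_mult)
    show ?thesis unfolding char_integrand_def E ang[symmetric] by (simp only: mult_ac)
  qed
  have "(\<lambda>k. s * (\<alpha> * k - N k) * (1 / sqrt (real k))) \<longlonglongrightarrow> 0"
  proof (rule Lim_null_comparison)
    show "\<forall>\<^sub>F k in sequentially. norm (s * (\<alpha> * k - N k) * (1 / sqrt (real k))) \<le> \<bar>s\<bar> * (1 / sqrt (real k))"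
    proof (intro always_eventually allI)
      fix k
      have "\<bar>\<alpha> * k - N k\<bar> \<le> 1" using n2_bounds[OF \<alpha>, of k] unfolding N_def by linarith
      then have "\<bar>s\<bar> * \<bar>\<alpha> * k - N k\<bar> * (1 / sqrt (real k)) \<le> \<bar>s\<bar> * 1 * (1 / sqrt (real k))"
        by (intro mult_right_mono mult_left_mono) auto
      then show "norm (s * (\<alpha> * k - N k) * (1 / sqrt (real k))) \<le> \<bar>s\<bar> * (1 / sqrt (real k))"
        by (simp add: abs_mult)
    qed
    show "(\<lambda>k. \<bar>s\<bar> * (1 / sqrt (real k))) \<longlonglongrightarrow> 0" by real_asymp
  qed
  then have "(\<lambda>k. cis (s * (\<alpha> * k - N k) * (1 / sqrt (real k)))) \<longlonglongrightarrow> 1" by (auto dest: tendsto_cis)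
  from tendsto_mult[OF tendsto_mult[OF \<phi> cycle_eval_tendsto[of s]] this]
  show ?thesis unfolding split by (simp add: mult_ac)
qed

text \<open>Dominated convergence with the majorant of \<open>norm_char_integrand\<close>; the
  limiting integral over \<open>s\<close> is Gaussian, and evaluating it lowers \<open>tvar\<close>
  by the part explained by the total length.\<close>

lemma comp_coeff_limit:
  "(\<lambda>k. of_real (scaling k) * comp_coeff (char_wt k) k (N k) * cis (- (sqrt (real k) * tmean)))
    \<longlonglongrightarrow> cycle_limit * exp (of_real (\<alpha> / (1 + \<alpha>)) * (cis \<tau> - 1) / 2)
      * of_real (exp (- (tvar - tcov\<^sup>2 / (\<alpha> * (1 + \<alpha>))) / 2) * sqrt (2 * pi / (\<alpha> * (1 + \<alpha>))))"
proof -
  define \<sigma> where "\<sigma> = sqrt (\<alpha> * (1 + \<alpha>))"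
  have \<sigma>: "\<sigma> > 0" "\<sigma>\<^sup>2 = \<alpha> * (1 + \<alpha>)" using \<alpha> by (auto simp: \<sigma>_def)
  let ?c = "cycle_limit * exp (of_real (\<alpha> / (1 + \<alpha>)) * (cis \<tau> - 1) / 2)"
  let ?g = "\<lambda>s. exp (- (tvar + 2 * s * tcov + s\<^sup>2 * \<sigma>\<^sup>2) / 2)"
  let ?h = "\<lambda>k s. indicator {-pi * sqrt (real k)..pi * sqrt (real k)} s *\<^sub>R char_integrand k s"
  have "(\<lambda>k. LINT s|lborel. ?h k s) \<longlonglongrightarrow> (LINT s|lborel. ?c * of_real (?g s))"
  proof (rule integral_dominated_convergence)
    show "(\<lambda>s. ?c * of_real (?g s)) \<in> borel_measurable lborel" by measurable
    show "?h k \<in> borel_measurable lborel" for k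
      using char_integrand_measurable[of k] by measurable
    show "integrable lborel (\<lambda>s. (1 + \<alpha>) * exp (- decay * s\<^sup>2))"
    proof (rule integrable_mult_right)
      have "(\<lambda>s. exp (- decay * s\<^sup>2)) = (\<lambda>s. exp (- (0 + 2 * s * 0 + s\<^sup>2 * (sqrt (2 * decay))\<^sup>2) / 2))"
        using decay_pos by (simp add: mult.commute)
      then show "integrable lborel (\<lambda>s. exp (- decay * s\<^sup>2))"
        using decay_pos by (simp only:) (intro gaussian_integral, simp)
    qed
    show "AE s in lborel. norm (?h k s) \<le> (1 + \<alpha>) * exp (- decay * s\<^sup>2)" for k
    proof (intro AE_I2)
      fix s
      show "norm (?h k s) \<le> (1 + \<alpha>) * exp (- decay * s\<^sup>2)"
        using norm_char_integrand[of s k] \<alpha> by (cases "s \<in> {-pi * sqrt (real k)..pi * sqrt (real k)}") (auto simp: indicator_def)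
    qed
    show "AE s in lborel. (\<lambda>k. ?h k s) \<longlonglongrightarrow> ?c * of_real (?g s)"
    proof (intro AE_I2)
      fix s
      have "eventually (\<lambda>k. pi * sqrt (real k) > \<bar>s\<bar>) sequentially" by real_asymp
      then have "eventually (\<lambda>k. char_integrand k s = ?h k s) sequentially"
        by eventually_elim (auto simp: indicator_def)
      with char_integrand_tendsto[of s] show "(\<lambda>k. ?h k s) \<longlonglongrightarrow> ?c * of_real (?g s)"
        unfolding \<sigma>(2) by (rule Lim_transform_eventually)
    qed
  qed
  also have "(LINT s|lborel. ?c * of_real (?g s)) = ?c * of_real (LINT s|lborel. ?g s)"
    by (simp only: integral_mult_right_zero integral_complex_of_real)
  also have "(LINT s|lborel. ?g s) = exp (- (tvar - tcov\<^sup>2 / (\<alpha> * (1 + \<alpha>))) / 2) * sqrt (2 * pi / (\<alpha> * (1 + \<alpha>)))"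
    using gaussian_integral(2)[OF \<sigma>(1), of tvar tcov] unfolding \<sigma>(2) .
  finally show ?thesis
  proof (rule Lim_transform_eventually)
    show "\<forall>\<^sub>F k in sequentially. (LINT s|lborel. ?h k s) = of_real (scaling k) * comp_coeff (char_wt k) k (N k) * cis (- (sqrt (real k) * tmean))"
      using eventually_gt_at_top[of 0] by eventually_elim (rule comp_coeff_integral[symmetric])
  qed
qed

end

text \<open>Read off from the expectation of the constant 1 under \<open>CM\<close>, in place of a
  transfer of the recursion between the two fields.\<close>

lemma comp_coeff_1_complex: "comp_coeff (\<lambda>_. 1 :: complex) k n = of_real (comp_coeff (\<lambda>_. 1) k n)"
proof -
  have "comp_coeff (\<lambda>_. 1 :: complex) k n / of_real (comp_coeff (\<lambda>_. 1) k n) = 1"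
    using expectation_CM_prod[of k n "\<lambda>_. 1 :: complex"] by simp
  moreover have "complex_of_real (comp_coeff (\<lambda>_. 1) k n) \<noteq> 0"
    using comp_coeff_pos[of k n] by simp
  ultimately show ?thesis by (simp add: divide_eq_1_iff)
qed

lemma prod_components_cis:
  "(\<Prod>C\<in>components M G. if card C \<in> {1..q} then cis (a (card C)) else 1) = cis (\<Sum>j=1..q. a j * real (U M j G))"
proof -
  let ?S = "{C \<in> components M G. card C \<in> {1..q}}"
  have "(\<Prod>C\<in>components M G. if card C \<in> {1..q} then cis (a (card C)) else 1) = (\<Prod>C\<in>?S. cis (a (card C)))"
    by (simp add: prod.If_cases[OF finite_components] Collect_conj_eq Int_commute)
  also have "\<dots> = (\<Prod>j\<in>{1..q}. \<Prod>C\<in>{C \<in> ?S. card C = j}. cis (a (card C)))"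
    by (rule prod.group[symmetric]) (auto simp: finite_components)
  also have "\<dots> = (\<Prod>j\<in>{1..q}. cis (a j * real (U M j G)))"
  proof (rule prod.cong[OF refl])
    fix j assume "j \<in> {1..q}"
    then have "{C \<in> ?S. card C = j} = {C \<in> components M G. card C = j}" by auto
    then show "(\<Prod>C\<in>{C \<in> ?S. card C = j}. cis (a (card C))) = cis (a j * real (U M j G))"
      by (simp add: U_def Complex.DeMoivre mult.commute)
  qed
  finally show ?thesis by (simp add: cis_sum)
qed

text \<open>With c = \<open>path_weight\<close> and b j = j - 2 - \<alpha>, \<open>Hmat\<close> is
  diag(c) - c c^T - (bc)(bc)^T / (\<alpha> (1+\<alpha>)). The first two terms are the multinomial
  covariance of independent path lengths; the third comes from fixing their sum.\<close>

lemma quadratic_form_Hmat: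
  assumes "\<alpha> > 0" "q \<ge> 1"
  shows "tvar \<alpha> q t - (tcov \<alpha> q t)\<^sup>2 / (\<alpha> * (1 + \<alpha>)) = (\<Sum>i=2..q. \<Sum>j=2..q. t i * Hmat \<alpha> i j * t j)"
proof -
  define c where "c j = path_weight \<alpha> j" for j
  define b where "b j = real j - 2 - \<alpha>" for j :: nat
  have H: "t i * Hmat \<alpha> i j * t j = - ((t i * c i) * (t j * c j)) - ((t i * c i * b i) * (t j * c j * b j)) / (\<alpha> * (1 + \<alpha>))
    + (if i = j then (t i)\<^sup>2 * c i else 0)" if "i \<in> {2..q}" "j \<in> {2..q}" for i j
  proof -
    have e: "i + j - 4 = (i - 2) + (j - 2)" "i + j - 2 = (i - 1) + (j - 1)" "i - 1 = Suc (i - 2)" using that by auto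
    have cc: "\<alpha> ^ (i + j - 4) / (1 + \<alpha>) ^ (i + j - 2) = c i * c j"
      unfolding c_def path_weight_def[OF assms] e(1,2) by (simp add: power_add)
    have ci: "1 / (1 + \<alpha>) * (\<alpha> / (1 + \<alpha>)) ^ (i - 2) = c i"
      unfolding c_def path_weight_def[OF assms] e(3) by (simp add: power_divide)
    show ?thesis
      unfolding Hmat_def cc ci b_def by (simp add: algebra_simps power2_eq_square divide_inverse)
  qed
  have "(\<Sum>i=2..q. \<Sum>j=2..q. t i * Hmat \<alpha> i j * t j)
    = (\<Sum>i=2..q. \<Sum>j=2..q. - ((t i * c i) * (t j * c j)) - ((t i * c i * b i) * (t j * c j * b j)) / (\<alpha> * (1 + \<alpha>))
    + (if i = j then (t i)\<^sup>2 * c i else 0))"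
    by (intro sum.cong refl H)
  also have "\<dots> = - (\<Sum>i=2..q. \<Sum>j=2..q. (t i * c i) * (t j * c j))
    - (\<Sum>i=2..q. \<Sum>j=2..q. (t i * c i * b i) * (t j * c j * b j)) / (\<alpha> * (1 + \<alpha>)) + (\<Sum>i=2..q. (t i)\<^sup>2 * c i)"
    by (simp only: sum.distrib sum_subtractf sum_negf sum_divide_distrib) (simp add: sum.delta)
  also have "\<dots> = - (\<Sum>i=2..q. t i * c i)\<^sup>2 - (\<Sum>i=2..q. t i * c i * b i)\<^sup>2 / (\<alpha> * (1 + \<alpha>)) + (\<Sum>i=2..q. (t i)\<^sup>2 * c i)"
    by (simp only: sum_product[symmetric] power2_eq_square)
  finally show ?thesis
    by (simp add: tvar_def[OF assms] tcov_def[OF assms] tmean_def[OF assms] c_def b_def)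
qed

text \<open>A quotient of two instances of \<open>comp_coeff_limit\<close>. The joint limit
  factorises, with the loops in the cycle factor and the paths in the Gaussian factor; both limit
  laws are specialisations.\<close>

theorem char_U_limit:
  fixes \<alpha> \<tau> :: real and t :: "nat \<Rightarrow> real"
  assumes \<alpha>: "\<alpha> > 0" and q: "q \<ge> 1"
  shows "(\<lambda>k. measure_pmf.expectation (CM (2 * k) (nat \<lfloor>\<alpha> * real k\<rfloor>)) (\<lambda>G.
      cis (\<tau> * real (U (2 * k + nat \<lfloor>\<alpha> * real k\<rfloor>) 1 G) + (\<Sum>j=2..q. t j *
        ((real (U (2 * k + nat \<lfloor>\<alpha> * real k\<rfloor>) j G) - \<alpha> ^ (j - 2) / (1 + \<alpha>) ^ (j - 1) * real k) / sqrt (real k))))))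
    \<longlonglongrightarrow> exp (of_real (\<alpha> / (1 + \<alpha>)) * (cis \<tau> - 1) / 2) *
      of_real (exp (- (\<Sum>i=2..q. \<Sum>j=2..q. t i * Hmat \<alpha> i j * t j) / 2))"
proof -
  define N where "N k = nat \<lfloor>\<alpha> * real k\<rfloor>" for k
  let ?m = "tmean \<alpha> q t" and ?s = "scaling \<alpha>"
  let ?E = "\<lambda>k. measure_pmf.expectation (CM (2 * k) (N k)) (\<lambda>G. cis (\<tau> * real (U (2 * k + N k) 1 G) +
    (\<Sum>j=2..q. t j * ((real (U (2 * k + N k) j G) - \<alpha> ^ (j - 2) / (1 + \<alpha>) ^ (j - 1) * real k) / sqrt (real k)))))"
  let ?num = "\<lambda>k. of_real (?s k) * comp_coeff (char_wt q t \<tau> k) k (N k) * cis (- (sqrt (real k) * ?m))"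
  let ?den = "\<lambda>k. of_real (?s k) * of_real (comp_coeff (\<lambda>_. 1) k (N k)) :: complex"
  \<comment> \<open>Zero frequencies give the constant weight, so the denominator is the same
    asymptotic statement.\<close>
  have wt0: "char_wt q (\<lambda>_. 0) 0 k = (\<lambda>_. 1)" for k by (auto simp: char_wt_def[OF \<alpha> q] fun_eq_iff)
  have zero: "tvar \<alpha> q (\<lambda>_. 0) = 0" "tcov \<alpha> q (\<lambda>_. 0) = 0" "tmean \<alpha> q (\<lambda>_. 0) = 0"
    by (simp_all add: tvar_def[OF \<alpha> q] tcov_def[OF \<alpha> q] tmean_def[OF \<alpha> q])
  have E: "?E k = ?num k / ?den k" if k: "k > 0" for k
  proof -
    define a where "a j = (if j = 1 then \<tau> else t j / sqrt (real k))" for j :: nat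
    have wt: "char_wt q t \<tau> k j = (if j \<in> {1..q} then cis (a j) else 1)" for j
      using q by (auto simp: char_wt_def[OF \<alpha> q] a_def)
    have kk: "real k / sqrt (real k) = sqrt (real k)" by (rule real_div_sqrt) simp
    have "\<tau> * real (U (2 * k + N k) 1 G) + (\<Sum>j=2..q. t j * ((real (U (2 * k + N k) j G) - \<alpha> ^ (j - 2) / (1 + \<alpha>) ^ (j - 1) * real k) / sqrt (real k)))
      = - (sqrt (real k) * ?m) + (\<Sum>j=1..q. a j * real (U (2 * k + N k) j G))" for G
    proof -
      have "(\<Sum>j=1..q. a j * real (U (2 * k + N k) j G)) = a 1 * real (U (2 * k + N k) 1 G) + (\<Sum>j=2..q. a j * real (U (2 * k + N k) j G))"
        using q by (simp add: sum.atLeast_Suc_atMost numeral_2_eq_2)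
      moreover have "(\<Sum>j=2..q. t j * ((real (U (2 * k + N k) j G) - \<alpha> ^ (j - 2) / (1 + \<alpha>) ^ (j - 1) * real k) / sqrt (real k)))
        = (\<Sum>j=2..q. a j * real (U (2 * k + N k) j G) - (real k / sqrt (real k)) * (t j * path_weight \<alpha> j))"
        by (intro sum.cong) (auto simp: a_def path_weight_def[OF \<alpha> q] diff_divide_distrib algebra_simps)
      ultimately show ?thesis
        unfolding kk by (simp add: sum_subtractf sum_distrib_left tmean_def[OF \<alpha> q] a_def)
    qed
    then have "?E k = measure_pmf.expectation (CM (2 * k) (N k)) (\<lambda>G. cis (- (sqrt (real k) * ?m)) * (\<Prod>C\<in>components (2 * k + N k) G. char_wt q t \<tau> k (card C)))"
      unfolding wt prod_components_cis by (simp only: cis_mult)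
    also have "\<dots> = cis (- (sqrt (real k) * ?m)) * (comp_coeff (char_wt q t \<tau> k) k (N k) / of_real (comp_coeff (\<lambda>_. 1) k (N k)))"
      unfolding expectation_CM_prod[symmetric] by (rule integral_mult_right_zero)
    also have "\<dots> = ?num k / ?den k"
      using scaling_pos[OF \<alpha> q k] by simp
    finally show ?thesis .
  qed
  let ?L = "cycle_limit \<alpha> * exp (of_real (\<alpha> / (1 + \<alpha>)) * (cis \<tau> - 1) / 2)
      * of_real (exp (- (tvar \<alpha> q t - (tcov \<alpha> q t)\<^sup>2 / (\<alpha> * (1 + \<alpha>))) / 2) * sqrt (2 * pi / (\<alpha> * (1 + \<alpha>))))"
  let ?J = "cycle_limit \<alpha> * of_real (sqrt (2 * pi / (\<alpha> * (1 + \<alpha>))))"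
  have "?num \<longlonglongrightarrow> ?L"
    using comp_coeff_limit[OF \<alpha> q, of t \<tau>] unfolding N_def .
  moreover have "?den \<longlonglongrightarrow> ?J"
    using comp_coeff_limit[OF \<alpha> q, of "\<lambda>_. 0" 0] unfolding N_def wt0 zero comp_coeff_1_complex by simp
  moreover have "sqrt (2 * pi / (\<alpha> * (1 + \<alpha>))) \<noteq> 0" using \<alpha> by simp
  then have "complex_of_real (sqrt (2 * pi / (\<alpha> * (1 + \<alpha>)))) \<noteq> 0" by (simp only: of_real_eq_0_iff not_False_eq_True)
  then have nz: "?J \<noteq> 0" by (simp only: mult_eq_0_iff cycle_limit_def[OF \<alpha> q] exp_not_eq_zero simp_thms)
  ultimately have "(\<lambda>k. ?num k / ?den k) \<longlonglongrightarrow> ?L / ?J" by (rule tendsto_divide)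
  then have "?E \<longlonglongrightarrow> ?L / ?J"
    by (rule Lim_transform_eventually) (use E in \<open>auto intro!: eventually_mono[OF eventually_gt_at_top[of 0]]\<close>)
  also have "?L / ?J = exp (of_real (\<alpha> / (1 + \<alpha>)) * (cis \<tau> - 1) / 2) *
      of_real (exp (- (tvar \<alpha> q t - (tcov \<alpha> q t)\<^sup>2 / (\<alpha> * (1 + \<alpha>))) / 2))"
    using nz by (simp add: field_simps)
  finally show ?thesis unfolding quadratic_form_Hmat[OF \<alpha> q] N_def .
qed

subsection \<open>Weak convergence from characteristic functions\<close>

text \<open>Real trigonometric polynomials in the coordinates of \<open>I\<close>. The free phase
  \<open>b\<close> lets one kind of generator cover sines, cosines and constants.\<close>

inductive_set trig :: "nat set \<Rightarrow> ((nat \<Rightarrow> real) \<Rightarrow> real) set" for I where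
  trig_cos: "(\<lambda>x. a * cos ((\<Sum>i\<in>I. t i * x i) + b)) \<in> trig I"
| trig_add: "f \<in> trig I \<Longrightarrow> g \<in> trig I \<Longrightarrow> (\<lambda>x. f x + g x) \<in> trig I"

lemma trig_const: "(\<lambda>_. c) \<in> trig I"
  using trig_cos[where a = c and t = "\<lambda>_. 0" and b = 0] by simp

lemma trig_mult_cos: "f \<in> trig I \<Longrightarrow> (\<lambda>x. (a * cos ((\<Sum>i\<in>I. t i * x i) + b)) * f x) \<in> trig I"
proof (induction rule: trig.induct)
  case (trig_cos a' t' b')
  let ?A = "\<lambda>x. (\<Sum>i\<in>I. t i * x i) + b" and ?B = "\<lambda>x. (\<Sum>i\<in>I. t' i * x i) + b'"
  have "(\<lambda>x. (a * a' / 2) * cos ((\<Sum>i\<in>I. (t i - t' i) * x i) + (b - b')) + (a * a' / 2) * cos ((\<Sum>i\<in>I. (t i + t' i) * x i) + (b + b'))) \<in> trig I"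
    by (intro trig.intros)
  moreover have "(\<Sum>i\<in>I. (t i - t' i) * x i) + (b - b') = ?A x - ?B x" "(\<Sum>i\<in>I. (t i + t' i) * x i) + (b + b') = ?A x + ?B x" for x
    by (simp_all add: algebra_simps sum.distrib sum_subtractf)
  moreover have "(a * a' / 2) * cos (u - v) + (a * a' / 2) * cos (u + v) = (a * cos u) * (a' * cos v)" for u v
    by (simp add: cos_add cos_diff algebra_simps)
  ultimately show ?case by (simp only:)
next
  case (trig_add f g)
  then show ?case using trig.trig_add by (simp add: distrib_left)
qed

lemma trig_mult: "f \<in> trig I \<Longrightarrow> g \<in> trig I \<Longrightarrow> (\<lambda>x. f x * g x) \<in> trig I"
proof (induction rule: trig.induct)
  case (trig_cos a t b)
  then show ?case by (rule trig_mult_cos)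
next
  case (trig_add f f')
  then show ?case using trig.trig_add by (simp add: distrib_right)
qed

lemma trig_bounded: "f \<in> trig I \<Longrightarrow> \<exists>B. \<forall>x. \<bar>f x\<bar> \<le> B"
proof (induction rule: trig.induct)
  case (trig_cos a t b)
  have "\<bar>a * cos y\<bar> \<le> \<bar>a\<bar>" for y by (simp add: abs_mult mult_left_le)
  then show ?case by blast
next
  case (trig_add f g)
  then obtain B C where "\<forall>x. \<bar>f x\<bar> \<le> B" "\<forall>x. \<bar>g x\<bar> \<le> C" by blast
  then have "\<bar>f x + g x\<bar> \<le> B + C" for x by (meson abs_triangle_ineq add_mono order_trans)
  then show ?case by blast
qed

lemma trig_continuous: "f \<in> trig I \<Longrightarrow> continuous_on S f"
  by (induction rule: trig.induct)
     (auto intro!: continuous_intros continuous_on_subset[OF continuous_on_product_coordinates])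

lemma trig_polynomial:
  assumes "real_polynomial_function h" "f \<in> trig I"
  shows "(\<lambda>x. h (f x)) \<in> trig I"
  using assms(1)
proof (induction rule: real_polynomial_function.induct)
  case (linear h)
  have "h y = h 1 * y" for y :: real
    using linear_scale[OF bounded_linear.linear[OF linear], of y 1] by simp
  then have "(\<lambda>x. h (f x)) = (\<lambda>x. h 1 * f x)" by blast
  with trig_mult[OF trig_const assms(2)] show ?case by simp
qed (auto intro: trig_const trig_add trig_mult)

text \<open>Extensional functions are frozen at \<open>undefined\<close> outside \<open>I\<close>,
  so the box is a full product of compact sets and Tychonoff's theorem applies.\<close>

lemma compact_box: "compact (PiE I (\<lambda>_. {-L..L}) :: (nat \<Rightarrow> real) set)"
proof -
  have "PiE I (\<lambda>_. {-L..L}) = PiE UNIV (\<lambda>i. if i \<in> I then {-L..L} else {undefined})"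
    by (auto simp: PiE_def Pi_def extensional_def split: if_splits)
  moreover have "compactin (product_topology (\<lambda>_. euclidean) UNIV) (PiE UNIV (\<lambda>i. if i \<in> I then {-L..L} else {undefined}))"
    unfolding compactin_PiE by auto
  ultimately show ?thesis by (simp add: euclidean_product_topology)
qed

text \<open>The scale \<open>d\<close> maps the side of the box into [-1, 1], where the sine is
  injective; the phase - pi/2 turns the cosine into this sine.\<close>

lemma trig_separates:
  assumes "finite I" "x \<in> PiE I (\<lambda>_. {-L..L})" "y \<in> PiE I (\<lambda>_. {-L..L})" "x \<noteq> y"
  shows "\<exists>f\<in>trig I. f x \<noteq> f y"
proof -
  obtain i where i: "i \<in> I" "x i \<noteq> y i" using assms PiE_ext by metis
  have L: "\<bar>x i\<bar> \<le> L" "\<bar>y i\<bar> \<le> L" using assms i by (auto simp: abs_le_iff PiE_iff)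
  define d where "d = 1 / (1 + L)"
  have d: "d > 0" using L by (auto simp: d_def)
  have le: "\<bar>d * z\<bar> \<le> 1" if "\<bar>z\<bar> \<le> L" for z
    using that d L by (auto simp: d_def abs_mult divide_le_eq)
  have "(\<lambda>z. 1 * cos ((\<Sum>j\<in>I. (if j = i then d else 0) * z j) + - (pi / 2))) \<in> trig I"
    by (rule trig_cos)
  moreover have "(\<Sum>j\<in>I. (if j = i then d else 0) * z j) = d * z i" for z :: "nat \<Rightarrow> real"
  proof -
    have "(\<Sum>j\<in>I. (if j = i then d else 0) * z j) = (\<Sum>j\<in>I. if j = i then d * z j else 0)"
      by (intro sum.cong) auto
    then show ?thesis using i assms(1) by simp
  qed
  moreover have "cos (y - pi / 2) = sin y" for y :: real by (simp add: cos_diff)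
  ultimately have "(\<lambda>z. sin (d * z i)) \<in> trig I" by simp
  moreover have "sin (d * x i) \<noteq> sin (d * y i)"
  proof
    assume eq: "sin (d * x i) = sin (d * y i)"
    have b: "- (pi / 2) \<le> d * z" "d * z \<le> pi / 2" if "\<bar>z\<bar> \<le> L" for z
      using le[OF that] pi_ge_two by linarith+
    have "d * x i = d * y i" by (rule sin_inj_pi[OF b[OF L(1)] b[OF L(2)] eq])
    with d i show False by simp
  qed
  ultimately show ?thesis by (intro bexI[of _ "\<lambda>z. sin (d * z i)"])
qed

lemma trig_approx:
  assumes "finite I" "continuous_on (PiE I (\<lambda>_. {-L..L})) f" "e > 0"
  shows "\<exists>g\<in>trig I. \<forall>x\<in>PiE I (\<lambda>_. {-L..L}). \<bar>f x - g x\<bar> < e"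
proof -
  interpret function_ring_on "trig I" "PiE I (\<lambda>_. {-L..L})"
  proof
    show "compact (PiE I (\<lambda>_. {-L..L}) :: (nat \<Rightarrow> real) set)" by (rule compact_box)
  qed (rule trig_continuous trig_add trig_mult trig_const trig_separates[OF assms(1)]; assumption)+
  show ?thesis by (rule Stone_Weierstrass_basic[OF assms(2,3)])
qed

text \<open>The approximating trigonometric polynomial is truncated at height \<open>B\<close> by composing it with a
  polynomial approximation of the truncation map, so that it stays bounded off the box.\<close>
lemma trig_approx_bounded:
  assumes "finite I" "continuous_on (PiE I (\<lambda>_. {-L..L})) f" "e > 0"
    and f: "\<And>x. x \<in> PiE I (\<lambda>_. {-L..L}) \<Longrightarrow> \<bar>f x\<bar> \<le> B"
  shows "\<exists>F\<in>trig I. (\<forall>x. \<bar>F x\<bar> \<le> \<bar>B\<bar> + e) \<and> (\<forall>x\<in>PiE I (\<lambda>_. {-L..L}). \<bar>f x - F x\<bar> \<le> 2 * e)"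
proof -
  obtain g where g: "g \<in> trig I" "\<And>x. x \<in> PiE I (\<lambda>_. {-L..L}) \<Longrightarrow> \<bar>f x - g x\<bar> < e"
    using trig_approx[OF assms(1-3)] by blast
  obtain R where R: "\<And>x. \<bar>g x\<bar> \<le> R" using trig_bounded[OF g(1)] by blast
  define clamp where "clamp y = max (- \<bar>B\<bar>) (min \<bar>B\<bar> y)" for y :: real
  have "continuous_on {-R..R} clamp" unfolding clamp_def by (intro continuous_intros)
  then obtain h where h: "real_polynomial_function h" "\<And>y. y \<in> {-R..R} \<Longrightarrow> \<bar>clamp y - h y\<bar> < e"
    using Stone_Weierstrass_real_polynomial_function[OF compact_Icc _ assms(3)] by metis
  have hg: "\<bar>clamp (g x) - h (g x)\<bar> < e" for x using R[of x] by (intro h(2)) (auto simp: abs_le_iff)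
  show ?thesis
  proof (intro bexI[of _ "\<lambda>x. h (g x)"] conjI allI ballI)
    fix x
    have "\<bar>clamp (g x)\<bar> \<le> \<bar>B\<bar>" by (auto simp: clamp_def)
    then show "\<bar>h (g x)\<bar> \<le> \<bar>B\<bar> + e" using hg[of x] by linarith
  next
    fix x assume x: "x \<in> PiE I (\<lambda>_. {-L..L})"
    \<comment> \<open>Clamping to an interval that contains \<open>f x\<close> cannot move
      \<open>g x\<close> away from it.\<close>
    have "\<bar>f x - clamp (g x)\<bar> \<le> \<bar>f x - g x\<bar>" using f[OF x] by (auto simp: clamp_def)
    then show "\<bar>f x - h (g x)\<bar> \<le> 2 * e" using hg[of x] g(2)[OF x] by linarith
  qed (rule trig_polynomial[OF h(1) g(1)])
qed

text \<open>Composition with restriction to \<open>I\<close> is continuous on all functions, hence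
  measurable for the full product, whose sets are the Borel sets. The inclusion of the product over
  \<open>I\<close> is measurable since the other coordinates are constant.\<close>

lemma measurable_PiM_continuous_on:
  fixes f :: "(nat \<Rightarrow> real) \<Rightarrow> real"
  assumes f: "continuous_on (PiE I (\<lambda>_. UNIV)) f"
  shows "f \<in> borel_measurable (PiM I (\<lambda>_. borel))"
proof -
  have "continuous_on UNIV (\<lambda>x::nat \<Rightarrow> real. restrict x I)"
  proof (rule continuous_on_coordinatewise_then_product)
    show "continuous_on UNIV (\<lambda>x::nat \<Rightarrow> real. restrict x I i)" for i
      by (cases "i \<in> I") auto
  qed
  then have "continuous_on UNIV (\<lambda>x. f (restrict x I))"
    by (rule continuous_on_compose2[OF f]) auto
  then have m: "(\<lambda>x. f (restrict x I)) \<in> borel_measurable (PiM UNIV (\<lambda>_. borel))"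
    unfolding measurable_cong_sets[OF sets_PiM_equal_borel refl] by (rule borel_measurable_continuous_onI)
  have "(\<lambda>x. x) \<in> PiM I (\<lambda>_. borel :: real measure) \<rightarrow>\<^sub>M PiM UNIV (\<lambda>_::nat. borel)"
  proof (rule measurable_PiM_single')
    fix i :: nat
    show "(\<lambda>x. x i) \<in> PiM I (\<lambda>_. borel :: real measure) \<rightarrow>\<^sub>M borel"
    proof (cases "i \<in> I")
      case False
      then have "(\<lambda>x. x i) \<in> PiM I (\<lambda>_. borel :: real measure) \<rightarrow>\<^sub>M borel \<longleftrightarrow>
          (\<lambda>x. undefined :: real) \<in> PiM I (\<lambda>_. borel :: real measure) \<rightarrow>\<^sub>M borel"
        by (intro measurable_cong) (auto simp: space_PiM PiE_def extensional_def)
      then show ?thesis by simp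
    qed measurable
  qed auto
  from measurable_compose[OF this m]
  have "(\<lambda>x. f (restrict x I)) \<in> borel_measurable (PiM I (\<lambda>_. borel))" .
  moreover have "f x = f (restrict x I)" if "x \<in> space (PiM I (\<lambda>_. borel :: real measure))" for x
    using that by (simp add: space_PiM PiE_restrict)
  ultimately show ?thesis by (subst measurable_cong)
qed

lemma trig_measurable: "f \<in> trig I \<Longrightarrow> f \<in> borel_measurable (PiM I (\<lambda>_. borel))"
  by (intro measurable_PiM_continuous_on trig_continuous)

lemma measurable_cis: "f \<in> borel_measurable M \<Longrightarrow> (\<lambda>x. cis (f x)) \<in> borel_measurable M"
  unfolding cis_conv_exp by measurable

lemma trig_integral_tendsto:
  fixes p :: "nat \<Rightarrow> (nat \<Rightarrow> real) pmf"
  assumes "prob_space \<mu>" "sets \<mu> = sets (PiM I (\<lambda>_. borel))"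
    and cf: "\<And>t. (\<lambda>k. measure_pmf.expectation (p k) (\<lambda>x. cis (\<Sum>i\<in>I. t i * x i))) \<longlonglongrightarrow> (\<integral>x. cis (\<Sum>i\<in>I. t i * x i) \<partial>\<mu>)"
    and f: "f \<in> trig I"
  shows "(\<lambda>k. measure_pmf.expectation (p k) f) \<longlonglongrightarrow> (\<integral>x. f x \<partial>\<mu>)"
  using f
proof (induction rule: trig.induct)
  case (trig_cos a t b)
  interpret prob_space \<mu> by fact
  let ?c = "of_real a * cis b"
  have eq: "a * cos (y + b) = Re (?c * cis y)" for y by (simp add: cos_add algebra_simps)
  have m: "(\<lambda>x. cis (\<Sum>i\<in>I. t i * x i)) \<in> borel_measurable \<mu>"
    unfolding measurable_cong_sets[OF assms(2) refl] by (intro measurable_cis) measurable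
  have i: "integrable \<mu> (\<lambda>x. cis (\<Sum>i\<in>I. t i * x i))"
    by (rule integrable_const_bound[of _ 1]) (use m in auto)
  have ip: "integrable (measure_pmf (p k)) (\<lambda>x. cis (\<Sum>i\<in>I. t i * x i))" for k
    by (rule measure_pmf.integrable_const_bound[where B = 1]) auto
  have 1: "(\<integral>x. a * cos ((\<Sum>i\<in>I. t i * x i) + b) \<partial>\<mu>) = Re (?c * (\<integral>x. cis (\<Sum>i\<in>I. t i * x i) \<partial>\<mu>))"
    unfolding eq integral_mult_right_zero[symmetric] by (intro integral_Re integrable_mult_right i)
  have 2: "measure_pmf.expectation (p k) (\<lambda>x. a * cos ((\<Sum>i\<in>I. t i * x i) + b)) = Re (?c * measure_pmf.expectation (p k) (\<lambda>x. cis (\<Sum>i\<in>I. t i * x i)))" for k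
    unfolding eq integral_mult_right_zero[symmetric] by (intro integral_Re integrable_mult_right ip)
  show ?case unfolding 1 2 by (intro tendsto_intros cf)
next
  case (trig_add f g)
  interpret prob_space \<mu> by fact
  have i: "integrable \<mu> h" if h: "h \<in> trig I" for h
  proof -
    obtain B where "\<And>x. \<bar>h x\<bar> \<le> B" using trig_bounded[OF h] by blast
    then show ?thesis
      using trig_measurable[OF h] by (intro integrable_const_bound[of _ B]) (auto simp: measurable_cong_sets[OF assms(2) refl])
  qed
  have ip: "integrable (measure_pmf (p k)) h" if h: "h \<in> trig I" for h k
  proof -
    obtain B where "\<And>x. \<bar>h x\<bar> \<le> B" using trig_bounded[OF h] by blast
    then show ?thesis by (intro measure_pmf.integrable_const_bound[where B = B]) auto
  qed
  show ?case using trig_add by (simp add: i ip tendsto_add)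
qed

lemma integral_diff_le_tail:
  fixes f F :: "'a \<Rightarrow> real"
  assumes "prob_space M" "S \<in> sets M" "f \<in> borel_measurable M" "F \<in> borel_measurable M"
    and "AE x in M. \<bar>f x\<bar> \<le> B" "AE x in M. \<bar>F x\<bar> \<le> C" "\<And>x. x \<in> S \<Longrightarrow> \<bar>f x - F x\<bar> \<le> e" "0 \<le> e"
  shows "\<bar>(\<integral>x. f x \<partial>M) - (\<integral>x. F x \<partial>M)\<bar> \<le> e + (B + C) * measure M (space M - S)"
proof -
  interpret prob_space M by fact
  have i: "integrable M f" "integrable M F"
    by (rule integrable_const_bound, use assms(5) in simp, rule assms(3))
       (rule integrable_const_bound, use assms(6) in simp, rule assms(4))
  have int_bd: "integrable M (\<lambda>x. e + (B + C) * indicator (space M - S) x)"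
    using assms(2) by (intro Bochner_Integration.integrable_add integrable_mult_right) (auto simp: integrable_indicator_iff emeasure_eq_measure)
  have "\<bar>(\<integral>x. f x \<partial>M) - (\<integral>x. F x \<partial>M)\<bar> = \<bar>\<integral>x. f x - F x \<partial>M\<bar>"
    using i by simp
  also have "\<dots> \<le> (\<integral>x. \<bar>f x - F x\<bar> \<partial>M)" by (rule integral_abs_bound)
  also have "\<dots> \<le> (\<integral>x. e + (B + C) * indicator (space M - S) x \<partial>M)"
  proof (rule integral_mono_AE)
    show "AE x in M. \<bar>f x - F x\<bar> \<le> e + (B + C) * indicator (space M - S) x"
      using assms(5,6) AE_space
    proof eventually_elim
      case (elim x)
      then show ?case using assms(7)[of x] assms(8) by (cases "x \<in> S") auto
    qed
  qed (use i int_bd in auto)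
  also have "\<dots> = e + (B + C) * measure M (space M - S)"
    using assms(2) prob_space by (subst Bochner_Integration.integral_add) (auto simp: integrable_indicator_iff emeasure_eq_measure)
  finally show ?thesis .
qed

text \<open>On a large box \<open>f\<close> is replaced by a bounded trigonometric polynomial, for
  which the hypothesis \<open>cf\<close> suffices. Outside it the functions are bounded and the mass
  is small: under the limit by continuity of measure, under \<open>p k\<close> by Chebyshev's
  inequality.\<close>

theorem weak_conv_vecI:
  fixes p :: "nat \<Rightarrow> (nat \<Rightarrow> real) pmf"
  assumes I: "finite I" and mu: "prob_space \<mu>" "sets \<mu> = sets (PiM I (\<lambda>_. borel))"
    and supp: "\<And>k. set_pmf (p k) \<subseteq> PiE I (\<lambda>_. UNIV)"
    and cf: "\<And>t. (\<lambda>k. measure_pmf.expectation (p k) (\<lambda>x. cis (\<Sum>i\<in>I. t i * x i))) \<longlonglongrightarrow> (\<integral>x. cis (\<Sum>i\<in>I. t i * x i) \<partial>\<mu>)"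
    and int: "\<And>k i. i \<in> I \<Longrightarrow> integrable (measure_pmf (p k)) (\<lambda>x. (x i)\<^sup>2)"
    and tight: "eventually (\<lambda>k. \<forall>i\<in>I. measure_pmf.expectation (p k) (\<lambda>x. (x i)\<^sup>2) \<le> C) sequentially"
  shows "weak_conv_vec I (\<lambda>k. measure_pmf (p k)) \<mu>"
  unfolding weak_conv_vec_def
proof (intro allI impI, elim conjE)
  fix f :: "(nat \<Rightarrow> real) \<Rightarrow> real"
  let ?E = "PiE I (\<lambda>_. UNIV) :: (nat \<Rightarrow> real) set"
  let ?S = "\<lambda>L::real. PiE I (\<lambda>_. {-L..L})"
  assume f: "continuous_on ?E f" and "bounded (f ` ?E)"
  then obtain B where B: "\<And>x. x \<in> ?E \<Longrightarrow> \<bar>f x\<bar> \<le> B" "B > 0"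
    by (auto simp: bounded_pos)
  interpret mu: prob_space \<mu> by fact
  have space: "space \<mu> = ?E" using sets_eq_imp_space_eq[OF mu(2)] by (simp add: space_PiM)
  have S_sets: "?S L \<in> sets \<mu>" for L unfolding mu(2) by (intro sets_PiM_I_finite I) auto
  have fm: "f \<in> borel_measurable \<mu>"
    unfolding measurable_cong_sets[OF mu(2) refl] by (rule measurable_PiM_continuous_on[OF f])
  show "(\<lambda>k. \<integral>x. f x \<partial>measure_pmf (p k)) \<longlonglongrightarrow> (\<integral>x. f x \<partial>\<mu>)"
  proof (rule tendstoI)
    fix \<eta> :: real assume "\<eta> > 0"
    \<comment> \<open>The comparison costs 3 e for each measure and e for the polynomial, 7 e in
      all. The constant \<open>d\<close> makes the tails cost at most e, where e \<le> 1 bounds 2 B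
      + e by 2 B + 1.\<close>
    define e where "e = min 1 (\<eta> / 8)"
    define d where "d = e / (2 * B + 1)"
    have e: "0 < e" "e \<le> 1" "8 * e \<le> \<eta>" using \<open>\<eta> > 0\<close> by (auto simp: e_def)
    have d: "d > 0" "(2 * B + 1) * d = e" using e B by (auto simp: d_def)
    have "(\<lambda>n. measure \<mu> (?S (real n))) \<longlonglongrightarrow> measure \<mu> (\<Union>n. ?S (real n))"
    proof (rule mu.finite_Lim_measure_incseq)
      show "range (\<lambda>n. ?S (real n)) \<subseteq> sets \<mu>" using S_sets by auto
      show "incseq (\<lambda>n. ?S (real n))" by (intro incseq_SucI PiE_mono) auto
    qed
    also have "(\<Union>n. ?S (real n)) = ?E"
    proof (intro equalityI subsetI)
      fix x assume x: "x \<in> ?E"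
      obtain n where n: "(\<Sum>i\<in>I. \<bar>x i\<bar>) \<le> real n" using real_arch_simple by blast
      have "\<bar>x i\<bar> \<le> real n" if "i \<in> I" for i
        using member_le_sum[of i I "\<lambda>i. \<bar>x i\<bar>"] that I n by auto
      then have "x \<in> ?S (real n)" using x by (auto simp: PiE_iff abs_le_iff minus_le_iff)
      then show "x \<in> (\<Union>n. ?S (real n))" by blast
    qed (auto simp: PiE_iff)
    finally have "(\<lambda>n. measure \<mu> (?S (real n))) \<longlonglongrightarrow> 1" using mu.prob_space space by simp
    then have "eventually (\<lambda>n. measure \<mu> (?S (real n)) > 1 - d) sequentially"
      using d by (intro order_tendstoD(1)) auto
    \<comment> \<open>Chebyshev's bound, summed over the coordinates, for the mass of
      \<open>p k\<close> outside the box of half-width \<open>n\<close>.\<close>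
    moreover have "eventually (\<lambda>n. real (card I) * C / (real n)\<^sup>2 < d) sequentially"
      using d(1) by real_asymp
    ultimately have "eventually (\<lambda>n. measure \<mu> (?S (real n)) > 1 - d \<and> real (card I) * C / (real n)\<^sup>2 < d \<and> n > 0) sequentially"
      using eventually_gt_at_top[of 0] by eventually_elim auto
    then obtain n where n: "measure \<mu> (?S (real n)) > 1 - d" "real (card I) * C / (real n)\<^sup>2 < d" "n > 0"
      by (auto simp: eventually_sequentially)
    define L where "L = real n"
    have SE: "?S L \<subseteq> ?E" by (auto simp: PiE_iff)
    have "continuous_on (?S L) f" by (rule continuous_on_subset[OF f SE])
    moreover have "\<bar>f x\<bar> \<le> B" if "x \<in> ?S L" for x using that B(1) SE by blast
    ultimately obtain F where F: "F \<in> trig I" "\<And>x. \<bar>F x\<bar> \<le> B + e" "\<And>x. x \<in> ?S L \<Longrightarrow> \<bar>f x - F x\<bar> \<le> 2 * e"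
      using trig_approx_bounded[OF I _ e(1), of L f B] B(2) unfolding abs_of_pos[OF B(2)] by blast
    have Fm: "F \<in> borel_measurable \<mu>"
      unfolding measurable_cong_sets[OF mu(2) refl] by (rule trig_measurable[OF F(1)])
    have bound: "2 * e + (B + (B + e)) * m \<le> 3 * e" if "0 \<le> m" "m \<le> d" for m
    proof -
      have "(B + (B + e)) * m \<le> (2 * B + 1) * d" using that e B by (intro mult_mono) auto
      then show ?thesis using d(2) by simp
    qed
    have mu_bd: "\<bar>(\<integral>x. f x \<partial>\<mu>) - (\<integral>x. F x \<partial>\<mu>)\<bar> \<le> 3 * e"
    proof -
      have "\<bar>(\<integral>x. f x \<partial>\<mu>) - (\<integral>x. F x \<partial>\<mu>)\<bar> \<le> 2 * e + (B + (B + e)) * measure \<mu> (space \<mu> - ?S L)"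
        by (rule integral_diff_le_tail[OF mu(1) S_sets fm Fm]) (use B F e space in auto)
      also have "\<dots> \<le> 3 * e"
        using n(1) S_sets by (intro bound) (auto simp: L_def mu.prob_compl)
      finally show ?thesis .
    qed
    have "(\<lambda>k. measure_pmf.expectation (p k) F) \<longlonglongrightarrow> (\<integral>x. F x \<partial>\<mu>)"
      by (rule trig_integral_tendsto[OF mu cf F(1)])
    then have "eventually (\<lambda>k. dist (measure_pmf.expectation (p k) F) (\<integral>x. F x \<partial>\<mu>) < e) sequentially"
      using e(1) by (rule tendstoD)
    with tight show "eventually (\<lambda>k. dist (\<integral>x. f x \<partial>measure_pmf (p k)) (\<integral>x. f x \<partial>\<mu>) < \<eta>) sequentially"
    proof eventually_elim
      case (elim k)
      have AE: "AE x in measure_pmf (p k). x \<in> ?E" using supp[of k] by (auto simp: AE_measure_pmf_iff)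
      have "measure (measure_pmf (p k)) (UNIV - ?S L) = measure_pmf.expectation (p k) (indicator (UNIV - ?S L))"
        by simp
      also have "\<dots> \<le> measure_pmf.expectation (p k) (\<lambda>x. \<Sum>i\<in>I. (x i)\<^sup>2 / L\<^sup>2)"
      proof (rule integral_mono_AE)
        show "integrable (measure_pmf (p k)) (\<lambda>x. \<Sum>i\<in>I. (x i)\<^sup>2 / L\<^sup>2)"
          using int by (intro Bochner_Integration.integrable_sum integrable_divide_zero) auto
        show "AE x in measure_pmf (p k). indicator (UNIV - ?S L) x \<le> (\<Sum>i\<in>I. (x i)\<^sup>2 / L\<^sup>2)"
          using AE
        proof eventually_elim
          case (elim x)
          show ?case
          proof (cases "x \<in> ?S L")
            case True
            then show ?thesis by (simp add: sum_nonneg)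
          next
            case False
            then obtain i where i: "i \<in> I" "\<not> \<bar>x i\<bar> \<le> L" using elim by (auto simp: PiE_iff abs_le_iff)
            have "L\<^sup>2 \<le> \<bar>x i\<bar>\<^sup>2" using i n(3) by (intro power_mono) (auto simp: L_def)
            then have "1 \<le> (x i)\<^sup>2 / L\<^sup>2" using n(3) by (simp add: L_def le_divide_eq)
            also have "\<dots> \<le> (\<Sum>i\<in>I. (x i)\<^sup>2 / L\<^sup>2)"
              using i I by (intro member_le_sum) auto
            finally show ?thesis using False by simp
          qed
        qed
      qed (auto simp: integrable_indicator_iff measure_pmf.emeasure_eq_measure)
      also have "\<dots> = (\<Sum>i\<in>I. measure_pmf.expectation (p k) (\<lambda>x. (x i)\<^sup>2) / L\<^sup>2)"
        using int by (subst Bochner_Integration.integral_sum) auto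
      also have "\<dots> \<le> (\<Sum>i\<in>I. C / L\<^sup>2)" using elim(1) by (intro sum_mono divide_right_mono) auto
      also have "\<dots> < d" using n(2) by (simp add: L_def)
      finally have tail: "measure (measure_pmf (p k)) (UNIV - ?S L) < d" .
      have "\<bar>(\<integral>x. f x \<partial>measure_pmf (p k)) - (\<integral>x. F x \<partial>measure_pmf (p k))\<bar>
        \<le> 2 * e + (B + (B + e)) * measure (measure_pmf (p k)) (space (measure_pmf (p k)) - ?S L)"
      proof (rule integral_diff_le_tail[OF measure_pmf.prob_space_axioms])
        show "AE x in measure_pmf (p k). \<bar>f x\<bar> \<le> B" using AE by eventually_elim (rule B)
      qed (use F e in auto)
      also have "\<dots> \<le> 3 * e" using tail by (intro bound) auto
      finally show ?case using mu_bd elim(2) e by (auto simp: dist_real_def)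
    qed
  qed
qed

subsection \<open>Gaussian and Poisson limits\<close>

text \<open>A Gram factorisation by Cholesky elimination of one index at a time. A zero pivot is
  allowed: positivity then forces its whole row to vanish, so singular matrices are covered.\<close>

lemma psd_factor:
  assumes "finite I" "\<And>i j. i \<in> I \<Longrightarrow> j \<in> I \<Longrightarrow> A i j = A j i" "psd_on I A"
  shows "\<exists>B. \<forall>i\<in>I. \<forall>j\<in>I. A i j = (\<Sum>l\<in>I. B i l * (B j l :: real))"
  using assms
proof (induction I arbitrary: A rule: finite_induct)
  case (insert a I)
  have sym: "A i j = A j i" if "i \<in> insert a I" "j \<in> insert a I" for i j using insert.prems(1) that .
  have symI: "A i a = A a i" if "i \<in> I" for i using sym that by blast
  have quad: "(\<Sum>i\<in>insert a I. \<Sum>j\<in>insert a I. t i * A i j * t j)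
    = A a a * (t a)\<^sup>2 + 2 * t a * (\<Sum>j\<in>I. A a j * t j) + (\<Sum>i\<in>I. \<Sum>j\<in>I. t i * A i j * t j)" for t
  proof -
    have "(\<Sum>i\<in>I. t i * A i a * t a) = t a * (\<Sum>j\<in>I. A a j * t j)"
      unfolding sum_distrib_left by (intro sum.cong) (auto simp: symI)
    moreover have "(\<Sum>j\<in>I. t a * A a j * t j) = t a * (\<Sum>j\<in>I. A a j * t j)"
      unfolding sum_distrib_left by (intro sum.cong) auto
    ultimately show ?thesis
      using insert.hyps by (simp add: sum.distrib power2_eq_square algebra_simps)
  qed
  have psd: "0 \<le> A a a * (t a)\<^sup>2 + 2 * t a * (\<Sum>j\<in>I. A a j * t j) + (\<Sum>i\<in>I. \<Sum>j\<in>I. t i * A i j * t j)" for t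
    using insert.prems(2) unfolding psd_on_def quad by blast
  have Aaa: "A a a \<ge> 0" using psd[of "\<lambda>i. if i = a then 1 else 0"] insert.hyps by (auto simp: if_distrib sum.neutral cong: if_cong)
  \<comment> \<open>The Schur complement of the pivot; if the pivot is 0, division by zero leaves
    \<open>A\<close> unchanged.\<close>
  define A' where "A' i j = A i j - A i a * A a j / A a a" for i j
  have "psd_on I A'"
    unfolding psd_on_def
  proof
    fix t :: "nat \<Rightarrow> real"
    let ?w = "\<Sum>j\<in>I. A a j * t j"
    \<comment> \<open>For a positive pivot this value of the coordinate \<open>a\<close> minimises
      the quadratic form, and the minimum is the form of the Schur complement.\<close>
    let ?t = "t(a := - ?w / A a a)"
    have 1: "(\<Sum>j\<in>I. A a j * ?t j) = ?w" using insert.hyps by (intro sum.cong) auto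
    have 2: "(\<Sum>i\<in>I. \<Sum>j\<in>I. ?t i * A i j * ?t j) = (\<Sum>i\<in>I. \<Sum>j\<in>I. t i * A i j * t j)"
      using insert.hyps by (intro sum.cong refl) auto
    have "0 \<le> A a a * (?t a)\<^sup>2 + 2 * ?t a * ?w + (\<Sum>i\<in>I. \<Sum>j\<in>I. t i * A i j * t j)"
      using psd[of ?t] unfolding 1 2 .
    also have "A a a * (?t a)\<^sup>2 + 2 * ?t a * ?w = - (?w * ?w / A a a)"
    proof -
      have "r * (- w / r)\<^sup>2 + 2 * (- w / r) * w = - (w * w / r)" for r w :: real
        by (cases "r = 0") (simp_all add: power2_eq_square field_simps)
      then show ?thesis by simp
    qed
    also have "?w * ?w / A a a = (\<Sum>i\<in>I. \<Sum>j\<in>I. t i * (A i a * A a j / A a a) * t j)"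
      unfolding sum_product sum_divide_distrib by (intro sum.cong refl) (simp add: symI)
    also have "- (\<Sum>i\<in>I. \<Sum>j\<in>I. t i * (A i a * A a j / A a a) * t j) + (\<Sum>i\<in>I. \<Sum>j\<in>I. t i * A i j * t j)
      = (\<Sum>i\<in>I. \<Sum>j\<in>I. t i * A' i j * t j)"
      unfolding A'_def by (simp add: sum_subtractf[symmetric] right_diff_distrib left_diff_distrib)
    finally show "0 \<le> (\<Sum>i\<in>I. \<Sum>j\<in>I. t i * A' i j * t j)" .
  qed
  moreover have "A' i j = A' j i" if "i \<in> I" "j \<in> I" for i j
    using that sym[of i j] sym[of i a] sym[of j a] by (simp add: A'_def)
  ultimately obtain B where B: "\<forall>i\<in>I. \<forall>j\<in>I. A' i j = (\<Sum>l\<in>I. B i l * B j l)"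
    using insert.IH by blast
  have zero: "A a j = 0" if z: "A a a = 0" and j: "j \<in> I" for j
  proof (rule ccontr)
    assume nz: "A a j \<noteq> 0"
    \<comment> \<open>Chosen so that the form takes the value -1, which is possible because it is
      affine in the coordinate \<open>a\<close> when the pivot is 0.\<close>
    let ?s = "- (A j j + 1) / (2 * A a j)"
    let ?t = "\<lambda>i. if i = a then ?s else if i = j then 1 else 0"
    have ja: "j \<noteq> a" using j insert.hyps by auto
    have "(\<Sum>i\<in>I. A a i * ?t i) = (\<Sum>i\<in>I. if i = j then A a i else 0)"
      using insert.hyps by (intro sum.cong) auto
    then have 1: "(\<Sum>i\<in>I. A a i * ?t i) = A a j" using j insert.hyps by simp
    have "(\<Sum>l\<in>I. ?t i * A i l * ?t l) = (if i = j then A i j else 0)" if "i \<in> I" for i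
    proof -
      have "(\<Sum>l\<in>I. ?t i * A i l * ?t l) = (\<Sum>l\<in>I. if l = j then (if i = j then A i l else 0) else 0)"
        using that insert.hyps by (intro sum.cong) auto
      then show ?thesis using j insert.hyps by simp
    qed
    then have 2: "(\<Sum>i\<in>I. \<Sum>l\<in>I. ?t i * A i l * ?t l) = A j j" using j insert.hyps by simp
    have "0 \<le> 2 * ?s * A a j + A j j"
      using psd[of ?t] unfolding 1 2 z by simp
    also have "\<dots> = -1" using nz by (simp add: field_simps)
    finally show False by simp
  qed
  define B' where "B' i l = (if l = a then A i a / sqrt (A a a) else if i = a then 0 else B i l)" for i l
  have "A i j = (\<Sum>l\<in>insert a I. B' i l * B' j l)" if ij: "i \<in> insert a I" "j \<in> insert a I" for i j
  proof -
    have split: "(\<Sum>l\<in>insert a I. B' i l * B' j l) = A i a * A j a / A a a + (\<Sum>l\<in>I. B' i l * B' j l)"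
      using insert.hyps Aaa by (simp add: B'_def)
    show ?thesis
    proof (cases "i = a \<or> j = a")
      case True
      then have "(\<Sum>l\<in>I. B' i l * B' j l) = 0" using insert.hyps by (intro sum.neutral) (auto simp: B'_def)
      moreover have "A i j = A i a * A j a / A a a"
      proof (cases "A a a = 0")
        case True
        then have "A a l = 0" if "l \<in> insert a I" for l using that zero by auto
        moreover from this have "A l a = 0" if "l \<in> insert a I" for l using that sym[of l a] by simp
        ultimately have "A i j = 0" "A i a * A j a = 0" using \<open>i = a \<or> j = a\<close> ij by auto
        then show ?thesis by simp
      next
        case False
        then show ?thesis using \<open>i = a \<or> j = a\<close> ij sym by auto
      qed
      ultimately show ?thesis unfolding split by simp
    next
      case False
      then have ij': "i \<in> I" "j \<in> I" using ij by auto
      have "(\<Sum>l\<in>I. B' i l * B' j l) = (\<Sum>l\<in>I. B i l * B j l)"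
        using insert.hyps False by (intro sum.cong) (auto simp: B'_def)
      also have "\<dots> = A' i j" using B ij' by simp
      finally show ?thesis unfolding split A'_def using sym[of a j] ij' by simp
    qed
  qed
  then show ?case by blast
qed simp

lemma prod_exp_sum: "finite L \<Longrightarrow> (\<Prod>l\<in>L. complex_of_real (exp (f l))) = of_real (exp (\<Sum>l\<in>L. f l))"
  by (simp add: exp_sum)

text \<open>The image of independent standard normals under a Gram factor \<open>B\<close> of
  \<open>A\<close>; the characteristic function factorises over the normals and its exponent
  reassembles to the quadratic form of \<open>A\<close>.\<close>

theorem gaussian_vec_exists:
  assumes I: "finite I" and A: "\<And>i j. i \<in> I \<Longrightarrow> j \<in> I \<Longrightarrow> A i j = A j i" "psd_on I A"
  shows "\<exists>\<mu>. gaussian_vec I A \<mu>"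
proof -
  obtain B where B: "\<And>i j. i \<in> I \<Longrightarrow> j \<in> I \<Longrightarrow> A i j = (\<Sum>l\<in>I. B i l * B j l)"
    using psd_factor[of I A] I A by blast
  interpret N: real_distribution std_normal_distribution by (rule real_dist_normal_dist)
  interpret P: product_prob_space "\<lambda>_::nat. std_normal_distribution" I by unfold_locales
  let ?M = "PiM I (\<lambda>_. std_normal_distribution)" and ?R = "PiM I (\<lambda>_. borel :: real measure)"
  define f where "f z = (\<lambda>i\<in>I. \<Sum>l\<in>I. B i l * z l)" for z :: "nat \<Rightarrow> real"
  have f: "f \<in> ?M \<rightarrow>\<^sub>M ?R" unfolding f_def by measurable
  have "gaussian_vec I A (distr ?M ?R f)"
    unfolding gaussian_vec_def
  proof (intro conjI allI)
    show "prob_space (distr ?M ?R f)" by (rule P.prob_space_distr[OF f])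
    fix t :: "nat \<Rightarrow> real"
    let ?s = "\<lambda>l. \<Sum>i\<in>I. t i * B i l"
    have "(\<integral>x. cis (\<Sum>i\<in>I. t i * x i) \<partial>distr ?M ?R f) = (\<integral>z. cis (\<Sum>i\<in>I. t i * f z i) \<partial>?M)"
      by (rule integral_distr[OF f]) (intro measurable_cis, measurable)
    also have "\<dots> = (\<integral>z. (\<Prod>l\<in>I. cis (?s l * z l)) \<partial>?M)"
    proof (intro Bochner_Integration.integral_cong refl)
      fix z
      have "(\<Sum>i\<in>I. t i * f z i) = (\<Sum>i\<in>I. \<Sum>l\<in>I. t i * (B i l * z l))"
        by (intro sum.cong) (auto simp: f_def sum_distrib_left)
      also have "\<dots> = (\<Sum>l\<in>I. \<Sum>i\<in>I. t i * (B i l * z l))" by (rule sum.swap)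
      also have "\<dots> = (\<Sum>l\<in>I. ?s l * z l)" by (simp add: sum_distrib_right mult.assoc)
      finally show "cis (\<Sum>i\<in>I. t i * f z i) = (\<Prod>l\<in>I. cis (?s l * z l))" by (simp add: cis_sum[OF I])
    qed
    also have "\<dots> = (\<Prod>l\<in>I. \<integral>y. cis (?s l * y) \<partial>std_normal_distribution)"
      by (rule P.product_integral_prod[OF I])
         (auto intro!: N.integrable_const_bound[of _ 1] measurable_cis)
    also have "\<dots> = (\<Prod>l\<in>I. complex_of_real (exp (- (?s l)\<^sup>2 / 2)))"
    proof -
      have "(\<integral>y. cis (r * y) \<partial>std_normal_distribution) = complex_of_real (exp (- r\<^sup>2 / 2))" for r
        using fun_cong[OF char_std_normal_distribution, of r] unfolding char_def cis_conv_exp .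
      then show ?thesis by (simp only:)
    qed
    also have "\<dots> = of_real (exp (\<Sum>l\<in>I. - (?s l)\<^sup>2 / 2))" by (rule prod_exp_sum[OF I])
    also have "(\<Sum>l\<in>I. - (?s l)\<^sup>2 / 2) = - (\<Sum>l\<in>I. (?s l)\<^sup>2) / 2"
      by (simp add: sum_negf sum_divide_distrib)
    also have "(\<Sum>l\<in>I. (?s l)\<^sup>2) = (\<Sum>i\<in>I. \<Sum>j\<in>I. t i * A i j * t j)"
    proof -
      have "(\<Sum>l\<in>I. (?s l)\<^sup>2) = (\<Sum>l\<in>I. \<Sum>i\<in>I. \<Sum>j\<in>I. (t i * B i l) * (t j * B j l))"
        by (simp only: power2_eq_square sum_product)
      also have "\<dots> = (\<Sum>i\<in>I. \<Sum>l\<in>I. \<Sum>j\<in>I. (t i * B i l) * (t j * B j l))" by (rule sum.swap)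
      also have "\<dots> = (\<Sum>i\<in>I. \<Sum>j\<in>I. \<Sum>l\<in>I. (t i * B i l) * (t j * B j l))"
        by (intro sum.cong refl sum.swap)
      also have "\<dots> = (\<Sum>i\<in>I. \<Sum>j\<in>I. t i * A i j * t j)"
        by (intro sum.cong refl) (simp add: B sum_distrib_left sum_distrib_right mult_ac)
      finally show ?thesis .
    qed
    finally show "(\<integral>x. cis (\<Sum>i\<in>I. t i * x i) \<partial>distr ?M ?R f) = complex_of_real (exp (- (\<Sum>i\<in>I. \<Sum>j\<in>I. t i * A i j * t j) / 2))" .
  qed simp
  then show ?thesis by blast
qed

lemma expectation_poisson_cis:
  assumes "r > 0"
  shows "measure_pmf.expectation (poisson_pmf r) (\<lambda>n. cis (s * real n)) = exp (of_real r * (cis s - 1))"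
proof -
  have s: "summable (pmf (poisson_pmf r))"
  proof -
    have "pmf (poisson_pmf r) = (\<lambda>n. inverse (fact n) * r ^ n * exp (- r))"
      using assms by (auto simp: fun_eq_iff field_simps)
    then show ?thesis using summable_mult2[OF summable_exp] by simp
  qed
  have "measure_pmf.expectation (poisson_pmf r) (\<lambda>n. cis (s * real n)) = (\<Sum>n. pmf (poisson_pmf r) n *\<^sub>R cis (s * real n))"
    by (rule nat_pmf_expectation(2)) (use s in simp)
  also have "(\<lambda>n. pmf (poisson_pmf r) n *\<^sub>R cis (s * real n)) = (\<lambda>n. of_real (exp (- r)) * ((of_real r * cis s) ^ n /\<^sub>R fact n))"
    using assms by (auto simp: fun_eq_iff scaleR_conv_of_real power_mult_distrib Complex.DeMoivre divide_inverse mult_ac)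
  also have "(\<Sum>n. of_real (exp (- r)) * ((of_real r * cis s) ^ n /\<^sub>R fact n)) = of_real (exp (- r)) * exp (of_real r * cis s)"
    by (rule sums_unique[symmetric], rule sums_mult, rule exp_converges)
  also have "\<dots> = exp (of_real r * (cis s - 1))"
    by (simp add: exp_of_real[symmetric] exp_add[symmetric] right_diff_distrib add.commute)
  finally show ?thesis .
qed

text \<open>Levy's continuity theorem needs laws on the Borel sets, whereas a pmf measures every
  set. Pushing forward by the identity changes only the sigma-algebra and preserves the distribution
  function.\<close>

lemma weak_conv_m_pmfI:
  fixes p :: "nat \<Rightarrow> real pmf" and p' :: "real pmf"
  assumes "\<And>t. (\<lambda>k. measure_pmf.expectation (p k) (\<lambda>x. cis (t * x))) \<longlonglongrightarrow> measure_pmf.expectation p' (\<lambda>x. cis (t * x))"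
  shows "weak_conv_m (\<lambda>k. measure_pmf (p k)) (measure_pmf p')"
proof -
  let ?D = "\<lambda>p::real pmf. distr (measure_pmf p) borel (\<lambda>x. x)"
  have D: "real_distribution (?D p)" for p
    by (simp add: real_distribution_def real_distribution_axioms_def measure_pmf.prob_space_distr)
  have "char (?D p) t = measure_pmf.expectation p (\<lambda>x. cis (t * x))" for p t
    unfolding char_def by (subst integral_distr) (auto simp: cis_conv_exp)
  then have "weak_conv_m (\<lambda>k. ?D (p k)) (?D p')"
    using assms by (intro levy_continuity D) simp
  moreover have "cdf (?D p) = cdf (measure_pmf p)" for p
    by (auto simp: cdf_def fun_eq_iff measure_distr)
  ultimately show ?thesis by (simp add: weak_conv_m_def)
qed

lemma second_moment_shift:
  fixes X :: "nat multiset multiset \<Rightarrow> real"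
  shows "measure_pmf.expectation (CM (2 * k) n) (\<lambda>G. (X G - a)\<^sup>2)
    = measure_pmf.variance (CM (2 * k) n) X + (measure_pmf.expectation (CM (2 * k) n) X - a)\<^sup>2"
proof -
  let ?E = "measure_pmf.expectation (CM (2 * k) n)"
  have int: "integrable (measure_pmf (CM (2 * k) n)) f" for f :: "nat multiset multiset \<Rightarrow> real"
    by (rule integrable_measure_pmf_finite[OF finite_set_pmf_CM])
  have "?E (\<lambda>G. (X G - a)\<^sup>2) = ?E (\<lambda>G. (X G)\<^sup>2 + ((- 2 * a) * X G + a\<^sup>2))"
    by (intro Bochner_Integration.integral_cong) (auto simp: power2_eq_square algebra_simps)
  also have "\<dots> = ?E (\<lambda>G. (X G)\<^sup>2) + ((- 2 * a) * ?E X + a\<^sup>2)"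
    by (simp only: Bochner_Integration.integral_add[OF int int] integral_mult_right_zero) simp
  also have "?E (\<lambda>G. (X G)\<^sup>2) = measure_pmf.variance (CM (2 * k) n) X + (?E X)\<^sup>2"
    by (subst measure_pmf.variance_eq) (auto intro: int)
  finally show ?thesis by (simp add: power2_eq_square algebra_simps)
qed

section \<open>Limit laws of the rescaled component counts\<close>

abbreviation (input) dev :: "real \<Rightarrow> nat \<Rightarrow> nat \<Rightarrow> nat \<Rightarrow> nat multiset multiset \<Rightarrow> real" where
  "dev \<alpha> n k j G \<equiv> (real (U (2 * k + n) j G) - \<alpha> ^ (j - 2) / (1 + \<alpha>) ^ (j - 1) * real k) / sqrt (real k)"

context
  fixes \<alpha> :: real and N :: "nat \<Rightarrow> nat"
  assumes \<alpha>: "\<alpha> > 0"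
  defines "N \<equiv> \<lambda>k. nat \<lfloor>\<alpha> * real k\<rfloor>"
begin

lemma char_dev:
  "(\<lambda>k. measure_pmf.expectation (CM (2 * k) (N k)) (\<lambda>G. cis (\<Sum>j=2..q. t j * dev \<alpha> (N k) k j G)))
    \<longlonglongrightarrow> of_real (exp (- (\<Sum>i=2..q. \<Sum>j=2..q. t i * Hmat \<alpha> i j * t j) / 2))" if "q \<ge> 1"
  using char_U_limit[OF \<alpha> that, of 0 t] unfolding N_def by simp

lemma Hmat_sym: "Hmat \<alpha> i j = Hmat \<alpha> j i"
  by (simp add: Hmat_def add.commute mult.commute)

text \<open>Characteristic functions have norm at most one, and so has their limit exp(-form/2);
  hence the form is nonnegative.\<close>

lemma psd_Hmat:
  assumes "q \<ge> 1"
  shows "psd_on {2..q} (Hmat \<alpha>)"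
  unfolding psd_on_def
proof
  fix t :: "nat \<Rightarrow> real"
  have "(\<lambda>k. norm (measure_pmf.expectation (CM (2 * k) (N k)) (\<lambda>G. cis (\<Sum>j=2..q. t j * dev \<alpha> (N k) k j G))))
    \<longlonglongrightarrow> norm (complex_of_real (exp (- (\<Sum>i=2..q. \<Sum>j=2..q. t i * Hmat \<alpha> i j * t j) / 2)))"
    by (intro tendsto_norm char_dev assms)
  moreover have "norm (measure_pmf.expectation (CM (2 * k) (N k)) (\<lambda>G. cis (\<Sum>j=2..q. t j * dev \<alpha> (N k) k j G))) \<le> 1" for k
    by (rule order_trans[OF integral_norm_bound]) simp
  ultimately have "norm (complex_of_real (exp (- (\<Sum>i=2..q. \<Sum>j=2..q. t i * Hmat \<alpha> i j * t j) / 2))) \<le> 1"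
    by (intro LIMSEQ_le_const2) auto
  then show "0 \<le> (\<Sum>i=2..q. \<Sum>j=2..q. t i * Hmat \<alpha> i j * t j)"
    by (simp del: of_real_exp)
qed

text \<open>The second moment about the limit value is variance plus squared bias, that is O(k) +
  O(1), and the rescaling divides it by \<open>k\<close>.\<close>

lemma dev_tight:
  assumes "j \<ge> 2"
  shows "\<exists>C. eventually (\<lambda>k. measure_pmf.expectation (CM (2 * k) (N k)) (\<lambda>G. (dev \<alpha> (N k) k j G)\<^sup>2) \<le> C) sequentially"
proof -
  let ?V = "\<lambda>k. measure_pmf.variance (CM (2 * k) (N k)) (\<lambda>G. real (U (2 * k + N k) j G))"
  let ?D = "\<lambda>k. measure_pmf.expectation (CM (2 * k) (N k)) (\<lambda>G. real (U (2 * k + N k) j G)) - \<alpha> ^ (j - 2) / (1 + \<alpha>) ^ (j - 1) * real k"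
  obtain C1 where C1: "eventually (\<lambda>k. norm (?V k) \<le> C1 * norm (real k)) sequentially"
    using variance_U[OF \<alpha> assms] unfolding N_def by (elim landau_o.bigE)
  obtain C2 where C2: "eventually (\<lambda>k. norm (?D k) \<le> C2 * norm (1::real)) sequentially"
    using mean_U_near[OF \<alpha> assms] unfolding N_def by (elim landau_o.bigE)
  have "eventually (\<lambda>k. measure_pmf.expectation (CM (2 * k) (N k)) (\<lambda>G. (dev \<alpha> (N k) k j G)\<^sup>2) \<le> C1 + C2\<^sup>2) sequentially"
    using C1 C2 eventually_gt_at_top[of 0]
  proof eventually_elim
    case (elim k)
    have "measure_pmf.expectation (CM (2 * k) (N k)) (\<lambda>G. (dev \<alpha> (N k) k j G)\<^sup>2)
      = measure_pmf.expectation (CM (2 * k) (N k)) (\<lambda>G. (real (U (2 * k + N k) j G) - \<alpha> ^ (j - 2) / (1 + \<alpha>) ^ (j - 1) * real k)\<^sup>2) / real k"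
      unfolding power_divide by (simp del: of_nat_mult)
    also have "\<dots> = ?V k / real k + (?D k)\<^sup>2 / real k"
      by (subst second_moment_shift) (rule add_divide_distrib)
    also have "\<dots> \<le> C1 + C2\<^sup>2"
    proof (rule add_mono)
      show "?V k / real k \<le> C1" using elim by (simp add: divide_le_eq)
      have "\<bar>?D k\<bar>\<^sup>2 \<le> C2\<^sup>2" using elim(2) by (intro power_mono) auto
      moreover have "(?D k)\<^sup>2 / real k \<le> (?D k)\<^sup>2 / 1" using elim(3) by (intro divide_left_mono) auto
      ultimately show "(?D k)\<^sup>2 / real k \<le> C2\<^sup>2" by simp
    qed
    finally show ?case .
  qed
  then show ?thesis by blast
qed

lemma weak_conv_dev:
  assumes q: "q \<ge> 2"
  shows "\<exists>\<mu>. gaussian_vec {2..q} (Hmat \<alpha>) \<mu> \<and> weak_conv_vec {2..q}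
    (\<lambda>k. measure_pmf (map_pmf (\<lambda>G. \<lambda>j\<in>{2..q}. dev \<alpha> (N k) k j G) (CM (2 * k) (N k)))) \<mu>"
proof -
  obtain \<mu> where mu: "gaussian_vec {2..q} (Hmat \<alpha>) \<mu>"
    using gaussian_vec_exists[of "{2..q}" "Hmat \<alpha>"] psd_Hmat[of q] q Hmat_sym by auto
  let ?p = "\<lambda>k. map_pmf (\<lambda>G. \<lambda>j\<in>{2..q}. dev \<alpha> (N k) k j G) (CM (2 * k) (N k))"
  have "\<forall>j\<in>{2..q}. \<exists>C. eventually (\<lambda>k. measure_pmf.expectation (CM (2 * k) (N k)) (\<lambda>G. (dev \<alpha> (N k) k j G)\<^sup>2) \<le> C) sequentially"
    using dev_tight by simp
  from bchoice[OF this] obtain C where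
    C: "\<forall>j\<in>{2..q}. eventually (\<lambda>k. measure_pmf.expectation (CM (2 * k) (N k)) (\<lambda>G. (dev \<alpha> (N k) k j G)\<^sup>2) \<le> C j) sequentially" ..
  have "weak_conv_vec {2..q} (\<lambda>k. measure_pmf (?p k)) \<mu>"
  proof (rule weak_conv_vecI[where C = "\<Sum>j=2..q. \<bar>C j\<bar>"])
    show "prob_space \<mu>" "sets \<mu> = sets (PiM {2..q} (\<lambda>_. borel))" using mu by (auto simp: gaussian_vec_def)
    show "set_pmf (?p k) \<subseteq> PiE {2..q} (\<lambda>_. UNIV)" for k by auto
    show "(\<lambda>k. measure_pmf.expectation (?p k) (\<lambda>x. cis (\<Sum>i\<in>{2..q}. t i * x i))) \<longlonglongrightarrow> (\<integral>x. cis (\<Sum>i\<in>{2..q}. t i * x i) \<partial>\<mu>)" for t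
    proof -
      have "(\<integral>x. cis (\<Sum>i\<in>{2..q}. t i * x i) \<partial>\<mu>) = of_real (exp (- (\<Sum>i=2..q. \<Sum>j=2..q. t i * Hmat \<alpha> i j * t j) / 2))"
        using mu by (simp add: gaussian_vec_def)
      moreover have "measure_pmf.expectation (?p k) (\<lambda>x. cis (\<Sum>i\<in>{2..q}. t i * x i))
        = measure_pmf.expectation (CM (2 * k) (N k)) (\<lambda>G. cis (\<Sum>j=2..q. t j * dev \<alpha> (N k) k j G))" for k
        by (simp add: integral_map_pmf)
      ultimately show ?thesis using char_dev[of q t] q by simp
    qed
    show "integrable (measure_pmf (?p k)) (\<lambda>x. (x i)\<^sup>2)" for k i
      by (rule integrable_measure_pmf_finite) (simp add: finite_set_pmf_CM)
    have "eventually (\<lambda>k. \<forall>j\<in>{2..q}. measure_pmf.expectation (CM (2 * k) (N k)) (\<lambda>G. (dev \<alpha> (N k) k j G)\<^sup>2) \<le> C j) sequentially"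
      using C by (intro eventually_ball_finite) auto
    then show "eventually (\<lambda>k. \<forall>i\<in>{2..q}. measure_pmf.expectation (?p k) (\<lambda>x. (x i)\<^sup>2) \<le> (\<Sum>j=2..q. \<bar>C j\<bar>)) sequentially"
    proof eventually_elim
      case (elim k)
      show ?case
      proof
        fix i assume i: "i \<in> {2..q}"
        have "measure_pmf.expectation (?p k) (\<lambda>x. (x i)\<^sup>2) = measure_pmf.expectation (CM (2 * k) (N k)) (\<lambda>G. (dev \<alpha> (N k) k i G)\<^sup>2)"
          using i by (simp add: integral_map_pmf)
        also have "\<dots> \<le> \<bar>C i\<bar>" using elim i by (meson abs_ge_self order_trans)
        also have "\<dots> \<le> (\<Sum>j=2..q. \<bar>C j\<bar>)" using i by (intro member_le_sum) auto
        finally show "measure_pmf.expectation (?p k) (\<lambda>x. (x i)\<^sup>2) \<le> (\<Sum>j=2..q. \<bar>C j\<bar>)" .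
      qed
    qed
  qed simp
  with mu show ?thesis by blast
qed

text \<open>The joint limit at \<open>q = 1\<close>, where the range of marked path sizes is empty
  and only the Poisson factor is left.\<close>

lemma weak_conv_U_1:
  "weak_conv_m (\<lambda>k. measure_pmf (map_pmf (\<lambda>G. real (U (2 * k + N k) 1 G)) (CM (2 * k) (N k))))
    (measure_pmf (map_pmf real (poisson_pmf (1/2 * (\<alpha> / (1 + \<alpha>))))))"
proof (rule weak_conv_m_pmfI)
  fix s :: real
  have r: "1/2 * (\<alpha> / (1 + \<alpha>)) > 0" using \<alpha> by simp
  have "of_real (\<alpha> / (1 + \<alpha>)) * (cis s - 1) / 2 = of_real (1/2 * (\<alpha> / (1 + \<alpha>))) * (cis s - 1)"
    by simp
  then have "(\<lambda>k. measure_pmf.expectation (CM (2 * k) (N k)) (\<lambda>G. cis (s * real (U (2 * k + N k) 1 G))))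
    \<longlonglongrightarrow> exp (of_real (1/2 * (\<alpha> / (1 + \<alpha>))) * (cis s - 1))"
    using char_U_limit[OF \<alpha> order_refl, of s "\<lambda>_. 0"] unfolding N_def by (simp add: mult.commute)
  then show "(\<lambda>k. measure_pmf.expectation (map_pmf (\<lambda>G. real (U (2 * k + N k) 1 G)) (CM (2 * k) (N k))) (\<lambda>x. cis (s * x)))
    \<longlonglongrightarrow> measure_pmf.expectation (map_pmf real (poisson_pmf (1/2 * (\<alpha> / (1 + \<alpha>))))) (\<lambda>x. cis (s * x))"
    unfolding integral_map_pmf expectation_poisson_cis[OF r] .
qed

end

theorem theorem2:
  fixes \<alpha> :: real
  assumes "\<alpha> > 0"
  defines "n2 \<equiv> \<lambda>k::nat. nat \<lfloor>\<alpha> * real (2 * k) / 2\<rfloor>"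
  defines "P \<equiv> \<lambda>k::nat. CM (2 * k) (n2 k)"
  defines "Uk \<equiv> \<lambda>k::nat. \<lambda>j. \<lambda>G. real (U (2 * k + n2 k) j G)"
  defines "c \<equiv> \<lambda>j::nat. \<alpha> ^ (j - 2) / (1 + \<alpha>) ^ (j - 1)"
  shows
    "(\<forall>j\<ge>2.
        (\<lambda>k. measure_pmf.expectation (P k) (Uk k j)) \<sim>[at_top] (\<lambda>k. c j * (real (2 * k) / 2)) \<and>
        (\<lambda>k. measure_pmf.variance (P k) (Uk k j)) \<in> O(\<lambda>k. real (2 * k) / 2))
     \<and> (\<lambda>k. measure_pmf.expectation (P k) (Uk k 1)) \<sim>[at_top] (\<lambda>k. 1/2 * (\<alpha> / (1 + \<alpha>)))
     \<and> (\<lambda>k. measure_pmf.variance (P k) (Uk k 1)) \<sim>[at_top] (\<lambda>k. 1/2 * (\<alpha> / (1 + \<alpha>)))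
     \<and> (\<forall>q::nat\<ge>2. psd_on {2..q} (Hmat \<alpha>) \<and>
         (\<exists>\<mu>. gaussian_vec {2..q} (Hmat \<alpha>) \<mu> \<and>
            weak_conv_vec {2..q}
              (\<lambda>k. measure_pmf (map_pmf
                 (\<lambda>G. \<lambda>j\<in>{2..q}. (Uk k j G - c j * (real (2 * k) / 2)) / sqrt (real (2 * k) / 2))
                 (P k))) \<mu>))
     \<and> weak_conv_m (\<lambda>k. measure_pmf (map_pmf (Uk k 1) (P k)))
         (measure_pmf (map_pmf real (poisson_pmf (1/2 * (\<alpha> / (1 + \<alpha>))))))"
proof -
  \<comment> \<open>With n1 = \<open>2 * k\<close> the scale n1/2 of the statement is
    \<open>k\<close>.\<close>
  have half: "real (2 * k) / 2 = real k" "\<alpha> * real (2 * k) / 2 = \<alpha> * real k" for k by simp_all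
  have nz: "1/2 * (\<alpha> / (1 + \<alpha>)) \<noteq> 0" using assms(1) by simp
  show ?thesis
    unfolding P_def Uk_def c_def n2_def half
    by (intro conjI allI impI mean_U variance_U psd_Hmat weak_conv_dev weak_conv_U_1
        tendsto_imp_asymp_equiv_const mean_U_1 variance_U_1 assms(1) nz; simp)
qed

end
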